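(* Let $z\in\mathbb{C}^*$, $\ell_\pm=\pm\mathbb{R}_{>0}\cdot z$, $t\in\mathbb{C}^*\setminus i\ell_\pm$ and $\theta\in\mathbb{C}$. Let $$\psi_\pm(t)=F\Big(\pm\frac{z}{2\pi it},\frac{1+\tau}{2}\mp\theta\ \Big|\ 1,\tau\Big)^{-1},\qquad H_\pm(z,t,\theta)=\lim_{\tau\to0}\Big((2\pi i\tau)\cdot\log\psi_\pm(t)\Big).$$ Then there is an expression $$H_\pm(z,t,\theta)=-(2\pi i)\cdot\log\Delta\Big(\pm\frac{z}{2\pi it},\ \frac12\mp\theta\Big).$$
   Context: Here $\tau$ is a point of the upper half-plane, with $\operatorname{Re}(\tau)>0$ so that $F(\cdot,\cdot\,|\,1,\tau)$ is defined. Double gamma function: for $\operatorname{Re}(a_1),\operatorname{Re}(a_2)>0$ let $\zeta_2(s,x\,|\,a_1,a_2)=\sum_{n_1,n_2\ge0}(x+n_1a_1+n_2a_2)^{-s}$, absolutely convergent for $\operatorname{Re}(s)>2$ and continued meromorphically in $s$, and let $\Gamma_2(x\,|\,a_1,a_2)=\exp\frac{\partial}{\partial s}\zeta_2(s,x\,|\,a_1,a_2)|_{s=0}$, a meromorphic function of $x\in\mathbb{C}$. Let $B_{2,2}(x\,|\,a_1,a_2)=\frac{x^2}{a_1a_2}-(\frac1{a_1}+\frac1{a_2})x+\frac16(\frac{a_2}{a_1}+\frac{a_1}{a_2})+\frac12$. For $w\in\mathbb{C}^*\setminus\mathbb{R}_{<0}$ and $\eta\in\mathbb{C}$, with the principal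 branch of $\log w$, define $$F(w,\eta\,|\,a_1,a_2)=\Gamma_2(w+\eta\,|\,a_1,a_2)\exp\Big(\tfrac12B_{2,2}(w+\eta\,|\,a_1,a_2)\log w\Big)\exp\Big(-\frac{3w^2}{4a_1a_2}-\frac{\eta w}{a_1a_2}+\frac{w(a_1+a_2)}{2a_1a_2}\Big).$$ Define $$\Delta(w,\eta)=\frac{e^{-\zeta'(-1)}\,G(w+\eta+1)\,e^{-\frac{w^2}{4}+\frac{\eta^2}{2}-\frac\eta2+\frac1{12}}}{\Gamma(w+\eta)^{w+\eta}\;w^{-\frac{(w+\eta)^2}{2}+\frac{w+\eta}{2}-\frac1{12}}},$$ where $G$ denotes the Barnes $G$-function and $\zeta'(-1)$ is the derivative of the Riemann zeta function at $s=-1$.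
   Formalization: With x=±z/(2πit)+1/2∓θ: x in {0,-1,-2,…} is excluded (Γ has a pole, Δ undefined); if x lies in the closed third quadrant, where zeros of ψ accumulate at τ=0, τ→0 is restricted to a sector with arg τ bounded strictly below Arg x+π (and away from 0 if x<0). *)

theory Defs
  imports "HOL-Complex_Analysis.Complex_Analysis"
begin

section \<open>Riemann zeta, double zeta and double gamma\<close>

text \<open>
  Both zeta functions are the meromorphic continuations in \<open>s\<close> of their Dirichlet series.  A function
  that is \<^const>\<open>nicely_meromorphic_on\<close> the plane has the value \<open>0\<close> at its poles and no removable
  singularities, so it is determined everywhere by its values on a half-plane.
\<close>

definition riemann_zeta :: "complex \<Rightarrow> complex" where
  "riemann_zeta = (THE f. f nicely_meromorphic_on UNIV \<and>
     (\<forall>s. Re s > 1 \<longrightarrow> ((\<lambda>n::nat. of_nat (Suc n) powr (-s)) has_sum f s) UNIV))"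

definition double_zeta :: "complex \<Rightarrow> complex \<Rightarrow> complex \<Rightarrow> complex \<Rightarrow> complex" where
  "double_zeta x a1 a2 = (THE f. f nicely_meromorphic_on UNIV \<and>
     (\<forall>s. Re s > 2 \<longrightarrow>
        ((\<lambda>(m::nat, n::nat). (x + of_nat m * a1 + of_nat n * a2) powr (-s)) has_sum f s) UNIV))"

text \<open>
  The powers in the double zeta function are principal.  When \<open>Re a1, Re a2 > 0\<close> only finitely many
  terms have a base in the left half-plane, and another choice of logarithm there changes the
  derivative at \<open>s = 0\<close> by an integer multiple of \<open>2 \<pi> i\<close>, which does not affect the double gamma
  function.  At its poles, the points \<open>- m a1 - n a2\<close>, the double gamma function gets the value
  \<open>0\<close>, as for \<^const>\<open>Gamma\<close>.
\<close>

definition Gamma2 :: "complex \<Rightarrow> complex \<Rightarrow> complex \<Rightarrow> complex" where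
  "Gamma2 x a1 a2 =
     (if \<exists>m n :: nat. x + of_nat m * a1 + of_nat n * a2 = 0 then 0
      else exp (deriv (double_zeta x a1 a2) 0))"

definition B22 :: "complex \<Rightarrow> complex \<Rightarrow> complex \<Rightarrow> complex" where
  "B22 x a1 a2 =
     x^2 / (a1 * a2) - (1 / a1 + 1 / a2) * x + (1 / 6) * (a2 / a1 + a1 / a2) + 1 / 2"

definition F :: "complex \<Rightarrow> complex \<Rightarrow> complex \<Rightarrow> complex \<Rightarrow> complex" where
  "F w \<eta> a1 a2 =
     Gamma2 (w + \<eta>) a1 a2 * exp ((1 / 2) * B22 (w + \<eta>) a1 a2 * Ln w) *
     exp (- (3 * w^2) / (4 * a1 * a2) - (\<eta> * w) / (a1 * a2) + w * (a1 + a2) / (2 * a1 * a2))"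


section \<open>The Barnes G-function\<close>

text \<open>
  Weierstrass product, in the variable \<open>u = z - 1\<close>:
  \<open>G (1 + u) = (2 \<pi>)^(u/2) exp (- (u + (1 + \<gamma>) u^2) / 2) \<Prod>k\<ge>1. (1 + u/k)^k exp (u^2/(2 k) - u)\<close>.
  Taking principal logarithms factor by factor gives the logarithm of \<open>G\<close> that is real on the
  positive reals and holomorphic off the nonpositive reals; compare \<^const>\<open>ln_Gamma\<close>.
\<close>

definition Barnes_G :: "complex \<Rightarrow> complex" where
  "Barnes_G z = (let u = z - 1 in
     of_real (2 * pi) powr (u / 2) * exp (- (u + u^2 * (1 + euler_mascheroni)) / 2) *
     (\<Prod>k. (1 + u / of_nat (Suc k)) ^ Suc k * exp (u^2 / (2 * of_nat (Suc k)) - u)))"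

definition ln_Barnes_G :: "complex \<Rightarrow> complex" where
  "ln_Barnes_G z = (let u = z - 1 in
     (u / 2) * of_real (ln (2 * pi)) - (u + u^2 * (1 + euler_mascheroni)) / 2 +
     (\<Sum>k. of_nat (Suc k) * Ln (1 + u / of_nat (Suc k)) + (u^2 / (2 * of_nat (Suc k)) - u)))"

lemma norm_Ln_Taylor2_le:
  fixes v :: complex
  assumes "norm v \<le> 1 / 2"
  shows "norm (Ln (1 + v) - v + v^2 / 2) \<le> 8 * norm v ^ 3"
proof -
  define f :: "nat \<Rightarrow> complex \<Rightarrow> complex" where
    "f = (\<lambda>i x. if i = 0 then Ln (1 + x) else if i = 1 then 1 / (1 + x)
                else if i = 2 then - 1 / (1 + x)^2 else 2 / (1 + x)^3)"
  have half: "norm (1 + x) \<ge> 1 / 2" and nonneg: "1 + x \<notin> \<real>\<^sub>\<le>\<^sub>0" and nz: "1 + x \<noteq> 0"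
    if "x \<in> cball 0 (1 / 2)" for x :: complex
  proof -
    have x: "norm x \<le> 1 / 2" using that by simp
    show "norm (1 + x) \<ge> 1 / 2"
      using norm_triangle_ineq2[of 1 "-x"] x by simp
    then show "1 + x \<noteq> 0" by auto
    have "\<bar>Re x\<bar> \<le> 1 / 2" using abs_Re_le_cmod[of x] x by linarith
    then show "1 + x \<notin> \<real>\<^sub>\<le>\<^sub>0" by (auto simp: complex_nonpos_Reals_iff)
  qed
  have "norm (f 0 v - (\<Sum>i\<le>2. f i 0 * (v - 0) ^ i / fact i)) \<le> 16 * norm (v - 0) ^ Suc 2 / fact 2"
  proof (rule complex_Taylor[where S = "cball 0 (1 / 2)"])
    fix i x assume x: "x \<in> cball (0::complex) (1 / 2)" and "i \<le> (2::nat)"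
    then consider "i = 0" | "i = 1" | "i = 2" by linarith
    then show "(f i has_field_derivative f (Suc i) x) (at x within cball 0 (1 / 2))"
    proof cases
      case 1
      show ?thesis using nonneg[OF x] unfolding 1 f_def
        by (auto intro!: derivative_eq_intros simp: inverse_eq_divide)
    next
      case 2
      show ?thesis using nz[OF x] unfolding 2 f_def
        by (auto intro!: derivative_eq_intros simp: power2_eq_square)
    next
      case 3
      have "2 * y * (1 / (y^2 * y^2)) = 2 / y^3" if "y \<noteq> 0" for y :: complex
        using that by (simp add: power2_eq_square power3_eq_cube)
      from this[OF nz[OF x]] show ?thesis using nz[OF x] unfolding 3 f_def
        by (auto intro!: derivative_eq_intros) (simp add: minus_divide_left add.commute power2_eq_square power3_eq_cube)
    qed
  next
    fix x assume x: "x \<in> cball (0::complex) (1 / 2)"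
    have "(1 / 2) ^ 3 \<le> norm (1 + x) ^ 3" using half[OF x] by (intro power_mono) auto
    then show "norm (f (Suc 2) x) \<le> 16"
      using nz[OF x] by (simp add: f_def norm_divide norm_power field_simps)
  qed (use assms in auto)
  also have "(\<Sum>i\<le>2. f i 0 * (v - 0) ^ i / fact i) = v - v^2 / 2"
    by (simp add: f_def numeral_2_eq_2)
  finally show ?thesis
    by (simp add: f_def numeral_3_eq_3 numeral_2_eq_2 algebra_simps)
qed

lemma summable_ln_Barnes_G:
  fixes u :: complex
  shows "summable (\<lambda>k. of_nat (Suc k) * Ln (1 + u / of_nat (Suc k)) +
                       (u^2 / (2 * of_nat (Suc k)) - u))"
proof (rule summable_comparison_test_ev)
  show "summable (\<lambda>k. 8 * norm u ^ 3 * inverse (of_nat (Suc k) ^ 2) :: real)"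
    using inverse_power_summable[of 2, where 'a = real]
    by (intro summable_mult) (subst summable_Suc_iff, simp)
  have "eventually (\<lambda>k. norm u * 2 \<le> real k) sequentially"
    using eventually_ge_at_top[of "nat \<lceil>norm u * 2\<rceil>"] by eventually_elim linarith
  then show "\<forall>\<^sub>F k in sequentially.
      norm (of_nat (Suc k) * Ln (1 + u / of_nat (Suc k)) + (u^2 / (2 * of_nat (Suc k)) - u))
      \<le> 8 * norm u ^ 3 * inverse (of_nat (Suc k) ^ 2)"
  proof eventually_elim
    case (elim k)
    define m where "m = real (Suc k)"
    have m: "m > 0" by (simp add: m_def)
    define v where "v = u / of_nat (Suc k)"
    have u: "u = of_real m * v" and nv: "norm v = norm u / m"
      using m by (simp_all add: v_def m_def norm_divide del: of_nat_Suc)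
    have "norm v \<le> 1 / 2" using elim m unfolding nv by (simp add: m_def field_simps)
    note * = norm_Ln_Taylor2_le[OF this]
    have "of_nat (Suc k) * Ln (1 + u / of_nat (Suc k)) + (u^2 / (2 * of_nat (Suc k)) - u)
          = of_real m * (Ln (1 + v) - v + v^2 / 2)"
      using m unfolding u m_def
      by (simp add: field_simps power2_eq_square del: of_nat_Suc)
    then have "norm (of_nat (Suc k) * Ln (1 + u / of_nat (Suc k)) + (u^2 / (2 * of_nat (Suc k)) - u))
          = m * norm (Ln (1 + v) - v + v^2 / 2)"
      using m by (simp add: norm_mult)
    also have "\<dots> \<le> m * (8 * norm v ^ 3)" using * m by (intro mult_left_mono) auto
    also have "\<dots> = 8 * norm u ^ 3 * inverse (m ^ 2)"
      using m unfolding nv by (simp add: field_simps power2_eq_square power3_eq_cube)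
    finally show ?case by (simp add: m_def)
  qed
qed

lemma exp_ln_Barnes_G:
  assumes "z \<notin> \<int>\<^sub>\<le>\<^sub>0"
  shows "exp (ln_Barnes_G z) = Barnes_G z"
proof -
  define u where "u = z - 1"
  have nz: "1 + u / of_nat (Suc k) \<noteq> 0" for k
  proof
    assume "1 + u / of_nat (Suc k) = 0"
    then have "(1 + u / of_nat (Suc k)) * of_nat (Suc k) = 0" by simp
    then have "of_nat (Suc k) + u = 0" by (simp add: distrib_right del: of_nat_Suc)
    then have "z = - of_nat k" by (simp add: u_def eq_neg_iff_add_eq_0 add.commute)
    with assms show False by simp
  qed
  have "exp (of_nat (Suc k) * Ln (1 + u / of_nat (Suc k)) + (u^2 / (2 * of_nat (Suc k)) - u))
        = (1 + u / of_nat (Suc k)) ^ Suc k * exp (u^2 / (2 * of_nat (Suc k)) - u)" for k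
    using nz[of k] by (simp only: exp_add exp_of_nat_mult exp_Ln not_False_eq_True)
  then have "exp (\<Sum>k. of_nat (Suc k) * Ln (1 + u / of_nat (Suc k)) + (u^2 / (2 * of_nat (Suc k)) - u))
        = (\<Prod>k. (1 + u / of_nat (Suc k)) ^ Suc k * exp (u^2 / (2 * of_nat (Suc k)) - u))"
    using prodinf_exp[OF summable_ln_Barnes_G[of u]] by (simp only:)
  moreover have "of_real (2 * pi) powr (u / 2) = exp ((u / 2) * of_real (ln (2 * pi)))"
    using Ln_of_real[of "2 * pi"] by (simp add: powr_def)
  moreover have "exp (ln_Barnes_G z) =
      exp ((u / 2) * of_real (ln (2 * pi))) * exp (- (u + u^2 * (1 + euler_mascheroni)) / 2) *
      exp (\<Sum>k. of_nat (Suc k) * Ln (1 + u / of_nat (Suc k)) + (u^2 / (2 * of_nat (Suc k)) - u))"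
    unfolding ln_Barnes_G_def Let_def u_def[symmetric]
    by (simp only: exp_add diff_conv_add_uminus minus_divide_left)
  ultimately show ?thesis
    unfolding Barnes_G_def Let_def u_def[symmetric] by (simp only:)
qed


section \<open>The function \<open>\<Delta>\<close> and its logarithm\<close>

text \<open>
  In the denominator \<open>\<Gamma>(x)^x\<close> means \<open>exp (x ln \<Gamma>(x))\<close> with the usual log-gamma function
  \<^const>\<open>ln_Gamma\<close>, not the principal logarithm of \<open>\<Gamma>(x)\<close>, which is not continuous on the slit
  plane.  The logarithm \<open>ln_Delta\<close> of \<open>Delta\<close> is the branch that is continuous where neither \<open>w\<close>
  nor \<open>w + \<eta>\<close> is a nonpositive real, and real when \<open>w\<close> and \<open>w + \<eta>\<close> are positive.  On the cuts all
  logarithms take their limits from the upper half-plane.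
\<close>

definition Delta :: "complex \<Rightarrow> complex \<Rightarrow> complex" where
  "Delta w \<eta> =
     (exp (- deriv riemann_zeta (-1)) * Barnes_G (w + \<eta> + 1) *
      exp (- (w^2 / 4) + \<eta>^2 / 2 - \<eta> / 2 + 1 / 12)) /
     (exp ((w + \<eta>) * ln_Gamma (w + \<eta>)) *
      w powr (- ((w + \<eta>)^2 / 2) + (w + \<eta>) / 2 - 1 / 12))"

definition ln_Delta :: "complex \<Rightarrow> complex \<Rightarrow> complex" where
  "ln_Delta w \<eta> =
     - deriv riemann_zeta (-1) + ln_Barnes_G (w + \<eta> + 1) +
     (- (w^2 / 4) + \<eta>^2 / 2 - \<eta> / 2 + 1 / 12) -
     ((w + \<eta>) * ln_Gamma (w + \<eta>) +
      (- ((w + \<eta>)^2 / 2) + (w + \<eta>) / 2 - 1 / 12) * Ln w)"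

lemma exp_ln_Delta:
  assumes "w \<noteq> 0" "w + \<eta> \<notin> \<int>\<^sub>\<le>\<^sub>0"
  shows "exp (ln_Delta w \<eta>) = Delta w \<eta>"
proof -
  have "w + \<eta> + 1 \<notin> \<int>\<^sub>\<le>\<^sub>0"
    using assms(2) plus_one_in_nonpos_Ints_imp by blast
  from exp_ln_Barnes_G[OF this] assms(1) show ?thesis
    unfolding ln_Delta_def Delta_def
    by (simp only: exp_add exp_diff powr_def if_False)
qed


section \<open>The functions \<open>\<psi>\<close> and the limit \<open>\<tau> \<rightarrow> 0\<close>\<close>

text \<open>The sign \<open>\<plusminus>\<close> is a number \<open>\<sigma>\<close> that is \<open>1\<close> or \<open>-1\<close>.\<close>

definition ell :: "complex \<Rightarrow> complex \<Rightarrow> complex set" where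
  "ell \<sigma> z = {\<sigma> * of_real r * z | r::real. r > 0}"

definition psi :: "complex \<Rightarrow> complex \<Rightarrow> complex \<Rightarrow> complex \<Rightarrow> complex \<Rightarrow> complex" where
  "psi \<sigma> z t \<theta> \<tau> =
     inverse (F (\<sigma> * z / (2 * of_real pi * \<i> * t)) ((1 + \<tau>) / 2 - \<sigma> * \<theta>) 1 \<tau>)"

text \<open>
  Put \<open>x = w + 1/2 - \<sigma> \<theta>\<close>.  As a function of \<open>\<tau>\<close>, \<open>psi\<close> vanishes where
  \<open>\<tau> = - (x + m) / (n + 1/2)\<close> with \<open>m, n\<close> natural numbers.  If \<open>x\<close> lies in the closed third
  quadrant these zeros accumulate at \<open>0\<close> inside the first quadrant or along its boundary, so
  \<open>\<tau> \<rightarrow> 0\<close> has to be restricted to a sector in which \<open>arg \<tau>\<close> stays below \<open>Arg x + \<pi>\<close> (and away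
  from \<open>0\<close>, if \<open>x\<close> is a negative real).  For all other \<open>x\<close> the whole quadrant
  \<open>sector 0 (pi / 2)\<close> is allowed.
\<close>

definition sector :: "real \<Rightarrow> real \<Rightarrow> complex set" where
  "sector \<alpha> \<beta> = {\<tau>. \<alpha> < Arg \<tau> \<and> Arg \<tau> < \<beta>}"

definition log_branch_on :: "complex set \<Rightarrow> (complex \<Rightarrow> complex) \<Rightarrow> (complex \<Rightarrow> complex) \<Rightarrow> bool" where
  "log_branch_on S f L \<longleftrightarrow> continuous_on S L \<and> (\<forall>\<tau>\<in>S. exp (L \<tau>) = f \<tau>)"

text \<open>
  \<open>has_scaled_log_limit S f h\<close>: the limit of \<open>(2 \<pi> i \<tau>) log (f \<tau>)\<close> as \<open>\<tau>\<close> tends to \<open>0\<close> in \<open>S\<close> is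
  \<open>h\<close>.  Here \<open>log f\<close> is a continuous branch of the logarithm near \<open>0\<close> in \<open>S\<close>; one is required to
  exist, and all of them must give the limit \<open>h\<close>.  The principal logarithm of \<open>f \<tau>\<close> would be wrong:
  its imaginary part is bounded, so the factor \<open>\<tau>\<close> would discard the phase of \<open>f\<close>.
\<close>

definition has_scaled_log_limit :: "complex set \<Rightarrow> (complex \<Rightarrow> complex) \<Rightarrow> complex \<Rightarrow> bool" where
  "has_scaled_log_limit S f h \<longleftrightarrow>
     (\<exists>\<delta>>0. \<exists>L. log_branch_on (S \<inter> ball 0 \<delta>) f L) \<and>
     (\<forall>\<delta>>0. \<forall>L. log_branch_on (S \<inter> ball 0 \<delta>) f L \<longrightarrow>
        ((\<lambda>\<tau>. (2 * of_real pi * \<i> * \<tau>) * L \<tau>) \<longlongrightarrow> h) (at 0 within S))"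

end

theory Submission
  imports Defs "HOL-Real_Asymp.Real_Asymp"
begin

text \<open>
  Put \<open>x = w + \<eta>\<close>.  The factors of \<open>F\<close> other than \<open>\<Gamma>\<^sub>2\<close> are explicit, so everything depends on
  \<open>\<tau> ln \<Gamma>\<^sub>2 (x + \<tau> / 2 | 1, \<tau>)\<close>.  Summing \<open>(x + m + (n + 1 / 2) \<tau>)\<^sup>-\<^sup>s\<close> over \<open>n\<close> by the midpoint rule gives
  \<open>\<zeta>\<^sub>2(s) = \<zeta>\<^sub>H(s - 1, x) / (\<tau> (s - 1)) - (\<tau> / 24) s \<zeta>\<^sub>H(s + 1, x) + E(s, \<tau>)\<close>,
  where \<open>\<zeta>\<^sub>H\<close> is the Hurwitz zeta function and the defect \<open>E\<close> is a lattice sum that converges for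
  \<open>Re s > - 1\<close> and is bounded near \<open>s = 0\<close> uniformly in small \<open>\<tau>\<close>.  Hence \<open>\<tau> ln \<Gamma>\<^sub>2\<close> tends to
  \<open>- \<zeta>\<^sub>H'(-1, x) - \<zeta>\<^sub>H(-1, x)\<close>, and Euler--Maclaurin summation in \<open>m\<close> together with Stirling's formula
  turns this into \<open>ln G (x + 1) - x ln \<Gamma>(x) - \<zeta>'(-1) + x\<^sup>2 / 2 - x / 2 + 1 / 12\<close>.

  The hypotheses on \<open>Arg x\<close> say that the angle between \<open>x\<close> and \<open>\<tau>\<close> stays away from \<open>\<pi>\<close>.  All points
  \<open>x + m + v \<tau>\<close> with \<open>v \<ge> 0\<close> then lie in one closed half-plane on which the principal logarithm is
  continuous, and their modulus is bounded below by a multiple of \<open>1 + m + v |\<tau>|\<close>.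
\<close>

section \<open>Binomial remainders and dominated sums of holomorphic functions\<close>

text \<open>The argument of \<open>Gamma2\<close> in \<open>psi\<close> is x + tau / 2, so the
  lattice points are midpoints of steps of length tau. The bare midpoint rule has a defect of order
  |tau|^2 / |c|^(2 + Re s) at a point c, which at s = 0 is not summable over a two-dimensional
  lattice; the term with tau / 24 gains the order that moves convergence to Re s > -1. The spare
  powers of |tau| pay for the growing number of n with n |tau| bounded.

  The second obstacle is that the zeta functions are definite descriptions: a continuation to the
  whole plane must exist before the expansion, which reaches only Re s > -1, says anything about
  them. A recursion in s supplies it, and unique continuation identifies it with the expansion.

  No logarithm of a value of \<open>Gamma2\<close> is ever taken: the derivative of
  \<open>double_zeta\<close> at 0 is itself the logarithm, and its continuity in tau follows from
  uniform convergence together with the absence of branch jumps. Other branches differ from it by a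
  constant, which the factor tau removes in the limit.\<close>

lemma norm_gbinomial_le_pochhammer:
  fixes a :: complex
  assumes "norm a \<le> A"
  shows "norm (a gchoose k) \<le> pochhammer A k / fact k"
proof -
  have "norm (pochhammer (-a) k) \<le> pochhammer A k"
    unfolding pochhammer_prod prod_norm[symmetric]
  proof (rule prod_mono)
    fix i :: nat
    show "0 \<le> norm (- a + of_nat i) \<and> norm (- a + of_nat i) \<le> A + of_nat i"
      using norm_triangle_ineq[of "-a" "of_nat i"] assms by simp
  qed
  then show ?thesis
    by (simp add: gbinomial_pochhammer norm_mult norm_divide norm_power divide_right_mono)
qed

text \<open>The binomial coefficients of \<open>a\<close> are dominated by those of (1 - q)^(-A),
  which are nonnegative and sum to 2^A at q = 1/2. Writing |r|^k as (1/2)^k (2 |r|)^k leaves the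
  factor (2 |r|)^n for the tail. The bound is uniform in the exponent, as locally uniform
  convergence in s requires.\<close>

lemma powr_Taylor_remainder:
  fixes a r :: complex
  assumes r: "norm r \<le> 1 / 2" and a: "norm a \<le> A"
  shows "norm ((1 + r) powr a - (\<Sum>k<n. (a gchoose k) * r ^ k)) \<le> 2 powr A * (2 * norm r) ^ n"
proof -
  define g where "g = (\<lambda>k. pochhammer A k / fact k * (1 / 2) ^ k)"
  have A: "A \<ge> 0" using a norm_ge_zero[of a] by linarith
  have gsums: "g sums (2 powr A)"
  proof -
    have "(\<lambda>k. (-A gchoose k) * (-1/2) ^ k) sums (1 + (-1/2)) powr (-A)"
      by (rule gen_binomial_real) simp
    moreover have "(-A gchoose k) * (-1/2) ^ k = g k" for k
    proof -
      have "(-1/2 :: real) ^ k = (-1) ^ k * (1/2) ^ k"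
        by (simp flip: power_mult_distrib)
      then have "(-A gchoose k) * (-1/2) ^ k = ((-1) ^ k * (-1) ^ k) * (pochhammer A k / fact k * (1 / 2) ^ k)"
        by (simp add: gbinomial_pochhammer)
      also have "((-1) ^ k * (-1) ^ k :: real) = 1"
        by (simp flip: power_mult_distrib)
      finally show ?thesis by (simp add: g_def)
    qed
    moreover have "(1 + (-1/2)) powr (-A) = (2 powr A :: real)"
      by (simp add: powr_minus powr_divide)
    ultimately show ?thesis by simp
  qed
  have gnn: "g k \<ge> 0" for k
    unfolding g_def pochhammer_prod using A
    by (intro mult_nonneg_nonneg divide_nonneg_nonneg prod_nonneg) auto
  define f where "f = (\<lambda>k. (a gchoose k) * r ^ k)"
  have fsums: "f sums ((1 + r) powr a)"
    unfolding f_def by (rule gen_binomial_complex) (use r in auto)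
  have tail: "(\<lambda>k. f (k + n)) sums ((1 + r) powr a - (\<Sum>k<n. f k))"
    by (rule sums_split_initial_segment[OF fsums])
  have fg: "norm (f k) \<le> g k * (2 * norm r) ^ k" for k
  proof -
    have "norm (f k) \<le> pochhammer A k / fact k * norm r ^ k"
      unfolding f_def norm_mult norm_power
      using norm_gbinomial_le_pochhammer[OF a, of k] by (intro mult_right_mono) auto
    also have "\<dots> = g k * (2 * norm r) ^ k"
      by (simp add: g_def power_mult_distrib power_divide)
    finally show ?thesis .
  qed
  have bound: "norm (f (k + n)) \<le> (2 * norm r) ^ n * g (k + n)" for k
  proof -
    have "norm (f (k + n)) \<le> g (k + n) * ((2 * norm r) ^ k * (2 * norm r) ^ n)"
      using fg[of "k + n"] by (simp add: power_add)
    also have "\<dots> \<le> g (k + n) * (1 * (2 * norm r) ^ n)"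
      using r gnn by (intro mult_left_mono mult_right_mono power_le_one) auto
    finally show ?thesis by (simp add: mult.commute)
  qed
  have gs: "summable (\<lambda>k. (2 * norm r) ^ n * g (k + n))"
    by (intro summable_mult summable_ignore_initial_segment sums_summable[OF gsums])
  have "norm ((1 + r) powr a - (\<Sum>k<n. f k)) = norm (\<Sum>k. f (k + n))"
    using sums_unique[OF tail] by simp
  also have "\<dots> \<le> (\<Sum>k. (2 * norm r) ^ n * g (k + n))"
    by (rule norm_suminf_le[OF bound gs])
  also have "\<dots> = (2 * norm r) ^ n * (\<Sum>k. g (k + n))"
    by (intro suminf_mult summable_ignore_initial_segment sums_summable[OF gsums])
  also have "\<dots> \<le> (2 * norm r) ^ n * 2 powr A"
  proof (intro mult_left_mono)
    have "(\<Sum>k. g (k + n)) = 2 powr A - (\<Sum>k<n. g k)"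
      using sums_split_initial_segment[OF gsums, of n] by (simp add: sums_iff)
    also have "\<dots> \<le> 2 powr A" using gnn by (simp add: sum_nonneg)
    finally show "(\<Sum>k. g (k + n)) \<le> 2 powr A" .
  qed auto
  finally show ?thesis by (simp add: f_def mult.commute)
qed

lemma norm_powr_le:
  fixes c w :: complex
  shows "norm (c powr w) \<le> norm c powr Re w * exp (pi * \<bar>Im w\<bar>)"
proof -
  have "- Im w * Arg c \<le> \<bar>Im w * Arg c\<bar>" by simp
  also have "\<dots> = \<bar>Im w\<bar> * \<bar>Arg c\<bar>" by (simp add: abs_mult)
  also have "\<dots> \<le> \<bar>Im w\<bar> * pi"
    using Arg_bounded[of c] by (intro mult_left_mono) auto
  finally show ?thesis
    unfolding norm_powr_complex by (intro mult_left_mono) (auto simp: mult.commute)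
qed

lemma has_sum_finite_sum:
  fixes f :: "'k \<Rightarrow> 'a \<Rightarrow> 'b :: topological_comm_monoid_add"
  assumes "\<And>k. k \<in> K \<Longrightarrow> (f k has_sum S k) I"
  shows "((\<lambda>i. \<Sum>k\<in>K. f k i) has_sum (\<Sum>k\<in>K. S k)) I"
  using assms by (induction K rule: infinite_finite_induct) (auto intro!: has_sum_add)

lemma compact_norm_bound:
  fixes C :: "complex set"
  assumes "compact C" "continuous_on C f"
  obtains B where "B \<ge> 0" "\<And>w. w \<in> C \<Longrightarrow> norm (f w :: complex) \<le> B"
proof -
  have "bounded (f ` C)"
    using compact_continuous_image[OF assms(2,1)] by (rule compact_imp_bounded)
  then obtain B where "B > 0" "\<forall>y\<in>f ` C. norm y \<le> B"
    unfolding bounded_pos by auto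
  then show ?thesis using that[of B] by auto
qed

text \<open>Weierstrass' theorem on locally uniform limits, for sums over an arbitrary index set.
  The finite set \<open>J\<close> absorbs the terms whose base is too small for the power estimates;
  both it and the majorant may depend on the compact set.\<close>

lemma
  fixes f :: "'a \<Rightarrow> complex \<Rightarrow> complex"
  assumes U: "open U" and hol: "\<And>i. i \<in> I \<Longrightarrow> f i holomorphic_on U"
    and dom: "\<And>C. compact C \<Longrightarrow> C \<subseteq> U \<Longrightarrow>
       \<exists>M J. finite J \<and> M summable_on I \<and> (\<forall>i\<in>I - J. \<forall>w\<in>C. norm (f i w) \<le> M i)"
  shows holomorphic_on_infsum: "(\<lambda>w. \<Sum>\<^sub>\<infinity>i\<in>I. f i w) holomorphic_on U"
    and summable_on_dominated: "s \<in> U \<Longrightarrow> (\<lambda>i. f i s) summable_on I"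
    and deriv_infsum_has_sum: "s \<in> U \<Longrightarrow> ((\<lambda>i. deriv (f i) s) has_sum deriv (\<lambda>w. \<Sum>\<^sub>\<infinity>i\<in>I. f i w) s) I"
proof -
  have dom': "\<exists>M. M summable_on I \<and> (\<forall>i\<in>I. \<forall>w\<in>C. norm (f i w) \<le> M i)"
    if C: "compact C" "C \<subseteq> U" for C
  proof -
    from dom[OF C] obtain M J where J: "finite J" and M: "M summable_on I"
      and le: "\<And>i w. i \<in> I - J \<Longrightarrow> w \<in> C \<Longrightarrow> norm (f i w) \<le> M i" by blast
    have "\<exists>B. \<forall>w\<in>C. norm (f i w) \<le> B" if "i \<in> I" for i
    proof -
      have "continuous_on C (f i)"
        using hol[OF that] C(2) holomorphic_on_imp_continuous_on holomorphic_on_subset by blast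
      from compact_norm_bound[OF C(1) this] show ?thesis by metis
    qed
    then obtain B where B: "\<And>i w. i \<in> I \<Longrightarrow> w \<in> C \<Longrightarrow> norm (f i w) \<le> B i" by metis
    \<comment> \<open>The finitely many exceptional terms get their own bounds on \<open>C\<close>,
      so that \<open>N\<close> dominates every term.\<close>
    define N where "N = (\<lambda>i. if i \<in> J then B i else M i)"
    have "N summable_on I"
    proof -
      have "N summable_on (I \<inter> J)" using J by (intro summable_on_finite) auto
      moreover have "M summable_on (I - J)" using summable_on_subset_banach[OF M] by blast
      then have "N summable_on (I - J)"
        by (rule summable_on_cong[THEN iffD1, rotated]) (auto simp: N_def)
      ultimately have "N summable_on (I \<inter> J \<union> (I - J))"
        by (intro summable_on_Un_disjoint) auto
      then show ?thesis by (simp add: Int_Diff_Un)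
    qed
    moreover have "\<forall>i\<in>I. \<forall>w\<in>C. norm (f i w) \<le> N i"
      using le B by (auto simp: N_def)
    ultimately show ?thesis by blast
  qed
  define S where "S = (\<lambda>w. \<Sum>\<^sub>\<infinity>i\<in>I. f i w)"
  have ulim: "uniform_limit C (\<lambda>X w. \<Sum>i\<in>X. f i w) S (finite_subsets_at_top I)"
    if "compact C" "C \<subseteq> U" for C
    using dom'[OF that] Weierstrass_m_test_general[of I C f] unfolding S_def by blast
  have finsum_hol: "\<forall>\<^sub>F X in finite_subsets_at_top I. (\<lambda>w. \<Sum>i\<in>X. f i w) holomorphic_on U"
    by (intro eventually_finite_subsets_at_top_weakI holomorphic_intros) (use hol in auto)
  have loc: "S holomorphic_on ball s r"
    if "cball s r \<subseteq> U" for s r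
  proof (rule holomorphic_uniform_limit)
    show "uniform_limit (cball s r) (\<lambda>X w. \<Sum>i\<in>X. f i w) S (finite_subsets_at_top I)"
      using that by (intro ulim) auto
    show "\<forall>\<^sub>F X in finite_subsets_at_top I. continuous_on (cball s r) (\<lambda>w. \<Sum>i\<in>X. f i w) \<and>
            (\<lambda>w. \<Sum>i\<in>X. f i w) holomorphic_on ball s r"
      using finsum_hol
    proof eventually_elim
      case (elim X)
      then show ?case
        using that holomorphic_on_subset[OF elim that]
        by (metis ball_subset_cball holomorphic_on_imp_continuous_on holomorphic_on_subset)
    qed
  qed auto
  show "S holomorphic_on U"
    unfolding holomorphic_on_def
  proof
    fix s assume "s \<in> U"
    then obtain r where r: "r > 0" "cball s r \<subseteq> U" using U open_contains_cball by metis
    have "S field_differentiable at s"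
      using loc[OF r(2)] r(1) by (auto simp: holomorphic_on_open field_differentiable_def)
    then show "S field_differentiable at s within U"
      by (rule field_differentiable_at_within)
  qed
  show "(\<lambda>i. f i s) summable_on I" if "s \<in> U" for s
  proof -
    from dom'[of "{s}"] that obtain M where M: "M summable_on I" "\<And>i. i \<in> I \<Longrightarrow> norm (f i s) \<le> M i"
      by auto
    have "(\<lambda>i. norm (f i s)) summable_on I"
      by (rule Infinite_Sum.abs_summable_on_comparison_test'[OF M])
    then show ?thesis by (rule abs_summable_summable)
  qed
  show "((\<lambda>i. deriv (f i) s) has_sum deriv S s) I" if s: "s \<in> U" for s
  proof -
    obtain r where r: "r > 0" "cball s r \<subseteq> U" using U open_contains_cball s by metis
    have "((\<lambda>X. deriv (\<lambda>w. \<Sum>i\<in>X. f i w) s) \<longlongrightarrow> deriv S s) (finite_subsets_at_top I)"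
    proof (rule deriv_complex_uniform_limit)
      show "uniform_limit (ball s r) (\<lambda>X w. \<Sum>i\<in>X. f i w) S (finite_subsets_at_top I)"
        using r by (intro uniform_limit_on_subset[OF ulim[of "cball s r"]]) auto
      show "\<forall>\<^sub>F X in finite_subsets_at_top I. (\<lambda>w. \<Sum>i\<in>X. f i w) holomorphic_on ball s r"
        using finsum_hol
        by eventually_elim (meson ball_subset_cball holomorphic_on_subset r(2))
    qed (use r in auto)
    moreover have "\<forall>\<^sub>F X in finite_subsets_at_top I.
        deriv (\<lambda>w. \<Sum>i\<in>X. f i w) s = (\<Sum>i\<in>X. deriv (f i) s)"
    proof (intro eventually_finite_subsets_at_top_weakI)
      fix X assume "finite X" "X \<subseteq> I"
      then show "deriv (\<lambda>w. \<Sum>i\<in>X. f i w) s = (\<Sum>i\<in>X. deriv (f i) s)"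
        using s by (intro DERIV_imp_deriv DERIV_sum holomorphic_derivI[OF hol U]) auto
    qed
    ultimately show ?thesis
      unfolding has_sum_def using tendsto_cong by force
  qed
qed

section \<open>Meromorphic continuation of sums of powers\<close>

text \<open>Off a sparse set, a meromorphic difference on a connected open set either vanishes or
  avoids 0; agreement on \<open>V\<close> rules out the second.\<close>

lemma meromorphic_eventually_eq:
  assumes f: "f meromorphic_on A" and g: "g meromorphic_on A"
    and A: "open A" "connected A" and V: "open V" "V \<noteq> {}" "V \<subseteq> A"
    and eq: "\<And>z. z \<in> V \<Longrightarrow> f z = g z" and z: "z \<in> A"
  shows "eventually (\<lambda>w. f w = g w) (at z)"
proof -
  have "(\<lambda>w. f w - g w) meromorphic_on A"
    using f g by (intro meromorphic_intros)
  from meromorphic_imp_constant_or_avoid[OF this A, of 0]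
  have "(\<forall>\<^sub>\<approx>z\<in>A. f z - g z = 0)"
  proof
    assume "\<forall>\<^sub>\<approx>z\<in>A. f z - g z \<noteq> 0"
    moreover obtain v where v: "v \<in> V" using V by blast
    ultimately have "eventually (\<lambda>w. f w - g w \<noteq> 0) (at v)"
      using A V by (auto simp: eventually_cosparse_open_eq)
    moreover have "eventually (\<lambda>w. f w - g w = 0) (at v)"
      using eventually_at_in_open'[OF V(1) v] by eventually_elim (use eq in auto)
    ultimately have "eventually (\<lambda>w. False) (at v)" by eventually_elim auto
    then show ?thesis by simp
  qed
  then show ?thesis using A z by (auto simp: eventually_cosparse_open_eq)
qed

text \<open>A nicely meromorphic function is determined at each point by its values nearby: it is 0
  at a pole and equals its limit elsewhere. Hence two continuations agree even at their
  poles.\<close>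

lemma nicely_meromorphic_on_eq:
  assumes f: "f nicely_meromorphic_on A" and g: "g nicely_meromorphic_on A"
    and A: "open A" "connected A" and V: "open V" "V \<noteq> {}" "V \<subseteq> A"
    and eq: "\<And>z. z \<in> V \<Longrightarrow> f z = g z" and z: "z \<in> A"
  shows "f z = g z"
proof -
  have ev: "eventually (\<lambda>w. f w = g w) (at z)"
    using f g by (intro meromorphic_eventually_eq[OF _ _ A V eq z]) (auto simp: nicely_meromorphic_on_def)
  have pole: "is_pole f z \<longleftrightarrow> is_pole g z"
    by (rule is_pole_cong[OF ev refl])
  show ?thesis
  proof (cases "is_pole f z")
    case True
    then have "\<not> f \<midarrow>z\<rightarrow> f z" "\<not> g \<midarrow>z\<rightarrow> g z"
      using pole not_tendsto_and_filterlim_at_infinity[of "at z"]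
      unfolding is_pole_def by (auto simp: trivial_limit_at)
    then show ?thesis using f g z unfolding nicely_meromorphic_on_def by metis
  next
    case False
    then have "f \<midarrow>z\<rightarrow> f z" "g \<midarrow>z\<rightarrow> g z"
      using f g z pole by (auto simp: nicely_meromorphic_on_def)
    then show ?thesis
      using tendsto_cong[OF ev] LIM_unique by metis
  qed
qed

section \<open>Series of complex powers on a right half-plane\<close>

lemma open_Re_gt: "open {s. Re s > c}"
  by (rule open_halfspace_Re_gt)

lemma connected_Re_gt: "connected {s. Re s > c}"
  by (intro convex_connected convex_halfspace_Re_gt)

lemma compact_subset_Re_gt:
  assumes "compact C" "C \<subseteq> {s. Re s > c}"
  obtains c' B where "c' > c" "\<And>s. s \<in> C \<Longrightarrow> Re s \<ge> c'" "\<And>s. s \<in> C \<Longrightarrow> norm s \<le> B"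
proof (cases "C = {}")
  case True
  then show ?thesis using that[of "c + 1" 0] by auto
next
  case False
  have "continuous_on C Re" by (intro continuous_intros)
  from continuous_attains_inf[OF assms(1) False this] obtain s0 where
    s0: "s0 \<in> C" "\<forall>y\<in>C. Re s0 \<le> Re y" by blast
  obtain B where "\<forall>s\<in>C. norm s \<le> B"
    using compact_imp_bounded[OF assms(1)] unfolding bounded_iff by blast
  then show ?thesis using that[of "Re s0" B] s0 assms(2) by auto
qed

lemma holomorphic_on_powr_exponent [holomorphic_intros]:
  assumes "f holomorphic_on A"
  shows "(\<lambda>s. c powr f s) holomorphic_on A"
proof (cases "c = 0")
  case False
  then show ?thesis unfolding powr_def using assms by (auto intro!: holomorphic_intros)
qed auto

lemma norm_powr_minus_le:
  fixes c s :: complex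
  assumes c: "1 \<le> norm c" and s: "\<sigma> \<le> Re s" "norm s \<le> B"
  shows "norm (c powr (- s)) \<le> exp (pi * B) * norm c powr (- \<sigma>)"
proof -
  have "norm (c powr (- s)) \<le> norm c powr Re (- s) * exp (pi * \<bar>Im (- s)\<bar>)"
    by (rule norm_powr_le)
  also have "\<dots> \<le> norm c powr (- \<sigma>) * exp (pi * B)"
    using c s abs_Im_le_cmod[of s] by (intro mult_mono powr_mono) auto
  finally show ?thesis by (simp add: mult.commute)
qed

text \<open>Terms with base inside the unit disc grow with Re s, so the majorant taken at the
  smallest real part fails for them. Being finitely many, they serve as the exceptional set of the
  dominated sum.\<close>

lemma
  fixes z :: "'a \<Rightarrow> complex"
  assumes fin: "finite {i\<in>I. norm (z i) < 1}"
    and summ: "\<And>\<sigma>. \<sigma> > \<sigma>0 \<Longrightarrow> (\<lambda>i. norm (z i) powr (- \<sigma>)) summable_on I"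
  shows holomorphic_on_powr_series:
      "(\<lambda>s. \<Sum>\<^sub>\<infinity>i\<in>I. z i powr (- s)) holomorphic_on {s. Re s > \<sigma>0}"
    and summable_on_powr_series: "Re s > \<sigma>0 \<Longrightarrow> (\<lambda>i. z i powr (- s)) summable_on I"
proof -
  have dom: "\<exists>M J. finite J \<and> M summable_on I \<and> (\<forall>i\<in>I - J. \<forall>w\<in>C. norm (z i powr (- w)) \<le> M i)"
    if C: "compact C" "C \<subseteq> {s. Re s > \<sigma>0}" for C
  proof -
    obtain \<sigma> B where "\<sigma> > \<sigma>0" and C': "\<And>s. s \<in> C \<Longrightarrow> Re s \<ge> \<sigma>" "\<And>s. s \<in> C \<Longrightarrow> norm s \<le> B"
      using compact_subset_Re_gt[OF C] by blast
    from summ[OF this(1)] have "(\<lambda>i. exp (pi * B) * norm (z i) powr (- \<sigma>)) summable_on I"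
      by (rule summable_on_cmult_right)
    moreover have "\<forall>i\<in>I - {i\<in>I. norm (z i) < 1}. \<forall>w\<in>C.
        norm (z i powr (- w)) \<le> exp (pi * B) * norm (z i) powr (- \<sigma>)"
      using C' by (auto intro!: norm_powr_minus_le)
    ultimately show ?thesis using fin by blast
  qed
  have hol: "(\<lambda>s. z i powr (- s)) holomorphic_on {s. Re s > \<sigma>0}" for i
    by (intro holomorphic_intros)
  show "(\<lambda>s. \<Sum>\<^sub>\<infinity>i\<in>I. z i powr (- s)) holomorphic_on {s. Re s > \<sigma>0}"
    by (rule holomorphic_on_infsum[OF open_Re_gt hol dom])
  show "(\<lambda>i. z i powr (- s)) summable_on I" if "Re s > \<sigma>0"
    using summable_on_dominated[OF open_Re_gt hol dom] that by simp
qed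

text \<open>The continuation must reach the whole plane, since that is what the definite
  descriptions of the zeta functions demand. Holomorphy on the half-plane is recorded so that
  \<open>remove_sings\<close> leaves the values of the sum unchanged there.\<close>

definition has_continuation :: "'a set \<Rightarrow> ('a \<Rightarrow> complex) \<Rightarrow> real \<Rightarrow> bool" where
  "has_continuation I z \<sigma>0 \<longleftrightarrow>
     (\<exists>F. F meromorphic_on UNIV \<and> F holomorphic_on {s. Re s > \<sigma>0} \<and>
          (\<forall>s. Re s > \<sigma>0 \<longrightarrow> ((\<lambda>i. z i powr (- s)) has_sum F s) I))"

text \<open>
  Expanding \<open>(z + a)\<^sup>-\<^sup>s\<close> by the binomial series turns the difference \<open>g\<close> into a recursion that
  expresses the series at \<open>s + 1\<close> through its values at \<open>s + 2, s + 3, \<dots>\<close>; each use of the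
  recursion extends the domain by a strip of width one.
\<close>

lemma powr_series_continuation:
  fixes z :: "'a \<Rightarrow> complex"
  assumes a: "a \<noteq> 0" and \<sigma>0: "\<sigma>0 \<ge> 0"
    and big: "\<And>i. i \<in> I \<Longrightarrow> 1 \<le> norm (z i)" "\<And>i. i \<in> I \<Longrightarrow> 2 * norm a \<le> norm (z i)"
    and branch: "\<And>i w. i \<in> I \<Longrightarrow> (z i + a) powr w = z i powr w * (1 + a / z i) powr w"
    and summ: "\<And>\<sigma>. \<sigma> > \<sigma>0 \<Longrightarrow> (\<lambda>i. norm (z i) powr (- \<sigma>)) summable_on I"
    and g: "g meromorphic_on UNIV"
    and diff: "\<And>s. Re s > \<sigma>0 \<Longrightarrow> (\<Sum>\<^sub>\<infinity>i\<in>I. (z i + a) powr (- s)) = (\<Sum>\<^sub>\<infinity>i\<in>I. z i powr (- s)) - g s"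
  shows "has_continuation I z \<sigma>0"
proof -
  define D where "D = (\<lambda>s. \<Sum>\<^sub>\<infinity>i\<in>I. z i powr (- s))"
  have fin: "finite {i\<in>I. norm (z i) < 1}"
  proof -
    have "{i\<in>I. norm (z i) < 1} = {}" using big(1) by force
    then show ?thesis by (metis finite.emptyI)
  qed
  have Dsumm: "(\<lambda>i. z i powr (- s)) summable_on I" if "Re s > \<sigma>0" for s
    using summable_on_powr_series[OF fin summ that] .
  have Dhol: "D holomorphic_on {s. Re s > \<sigma>0}"
    unfolding D_def by (rule holomorphic_on_powr_series[OF fin summ])
  define H where "H = (\<lambda>N::nat. {s. Re s > \<sigma>0 - N})"
  have H: "open (H N)" "connected (H N)" for N
    unfolding H_def using open_Re_gt connected_Re_gt by auto
  define r where "r = (\<lambda>i. a / z i)"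
  have r: "norm (r i) \<le> 1 / 2" and znz: "z i \<noteq> 0" if "i \<in> I" for i
    using big[OF that] by (auto simp: r_def norm_divide divide_le_eq)
  \<comment> \<open>Subtracting N binomial terms gains N powers of \<open>a / z i\<close>, so the
    sum of these remainders is holomorphic on \<open>H N\<close>.\<close>
  define \<rho> where "\<rho> = (\<lambda>N i s. z i powr (-s) * ((1 + r i) powr (-s) - (\<Sum>k<N. ((-s) gchoose k) * r i ^ k)))"
  define R where "R = (\<lambda>N s. \<Sum>\<^sub>\<infinity>i\<in>I. \<rho> N i s)"
  have gbin_hol: "(\<lambda>s. h s gchoose k) holomorphic_on A" if "h holomorphic_on A" for h :: "complex \<Rightarrow> complex" and k A
    unfolding gbinomial_prod_rev using that by (intro holomorphic_intros) auto
  have \<rho>hol: "\<rho> N i holomorphic_on A" for N i A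
    unfolding \<rho>_def by (intro holomorphic_intros gbin_hol)
  have \<rho>dom: "\<exists>M J. finite J \<and> M summable_on I \<and> (\<forall>i\<in>I - J. \<forall>w\<in>C. norm (\<rho> N i w) \<le> M i)"
    if C: "compact C" "C \<subseteq> H N" for C N
  proof -
    obtain \<sigma> B where \<sigma>: "\<sigma> > \<sigma>0 - N" and C': "\<And>s. s \<in> C \<Longrightarrow> Re s \<ge> \<sigma>" "\<And>s. s \<in> C \<Longrightarrow> norm s \<le> B"
      using compact_subset_Re_gt[OF C[unfolded H_def]] by blast
    define M where "M = (\<lambda>i. exp (pi * B) * 2 powr B * (2 * norm a) ^ N * norm (z i) powr (- (\<sigma> + N)))"
    have "M summable_on I"
      unfolding M_def using \<sigma> by (intro summable_on_cmult_right summ) simp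
    moreover have "norm (\<rho> N i w) \<le> M i" if i: "i \<in> I" and w: "w \<in> C" for i w
    proof -
      have "norm (\<rho> N i w) \<le> (exp (pi * B) * norm (z i) powr (- \<sigma>)) * (2 powr B * (2 * norm (r i)) ^ N)"
        unfolding \<rho>_def norm_mult using C'[OF w] big(1)[OF i] r[OF i]
        by (intro mult_mono norm_powr_minus_le powr_Taylor_remainder) auto
      also have "\<dots> = exp (pi * B) * 2 powr B * (2 * norm a) ^ N * (norm (z i) powr (- \<sigma>) / norm (z i) ^ N)"
        by (simp add: r_def norm_divide power_divide)
      also have "norm (z i) powr (- \<sigma>) / norm (z i) ^ N = norm (z i) powr (- (\<sigma> + N))"
        using znz[OF i] by (simp add: powr_diff powr_realpow flip: diff_conv_add_uminus)
      finally show ?thesis by (simp add: M_def)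
    qed
    ultimately show ?thesis by (intro exI[of _ M] exI[of _ "{}"]) auto
  qed
  have Rhol: "R N holomorphic_on H N" for N
    unfolding R_def by (rule holomorphic_on_infsum[OF H(1) \<rho>hol \<rho>dom])
  have \<rho>summ: "(\<lambda>i. \<rho> N i s) summable_on I" if "s \<in> H N" for N s
    by (rule summable_on_dominated[OF H(1) \<rho>hol \<rho>dom that])
  \<comment> \<open>The term k = 0 cancels against \<open>D s\<close>, and k = 1 contributes - s a
    D(s + 1), which is singled out. All further terms involve \<open>D\<close> only from s + 2
    on.\<close>
  have expand: "g s = s * a * D (s + 1) - (\<Sum>k=2..<N+2. ((-s) gchoose k) * a ^ k * D (s + of_nat k)) - R (N + 2) s"
    if s: "Re s > \<sigma>0" for s N
  proof -
    have trm: "(z i + a) powr (- s) =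
        (\<Sum>k<N+2. ((-s) gchoose k) * a ^ k * z i powr (- (s + of_nat k))) + \<rho> (N + 2) i s" if i: "i \<in> I" for i
    proof -
      have "z i powr (- (s + of_nat k)) = z i powr (- s) / z i ^ k" for k
        using znz[OF i] by (simp add: powr_diff flip: diff_conv_add_uminus)
      then have "((-s) gchoose k) * a ^ k * z i powr (- (s + of_nat k)) = z i powr (-s) * (((-s) gchoose k) * r i ^ k)" for k
        by (simp add: r_def power_divide)
      then have "(\<Sum>k<N+2. ((-s) gchoose k) * a ^ k * z i powr (- (s + of_nat k)))
          = z i powr (-s) * (\<Sum>k<N+2. ((-s) gchoose k) * r i ^ k)"
        by (simp only: sum_distrib_left)
      then show ?thesis
        using branch[OF i, of "-s"] by (simp add: \<rho>_def r_def ring_distribs)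
    qed
    have sH: "s \<in> H (N + 2)" using s by (simp add: H_def)
    have "((\<lambda>i. (\<Sum>k<N+2. ((-s) gchoose k) * a ^ k * z i powr (- (s + of_nat k))) + \<rho> (N + 2) i s) has_sum
        ((\<Sum>k<N+2. ((-s) gchoose k) * a ^ k * D (s + of_nat k)) + R (N + 2) s)) I"
      unfolding D_def R_def using s
      by (intro has_sum_add has_sum_finite_sum has_sum_cmult_right has_sum_infsum \<rho>summ[OF sH] Dsumm) auto
    then have "(\<Sum>\<^sub>\<infinity>i\<in>I. (z i + a) powr (- s)) =
        (\<Sum>k<N+2. ((-s) gchoose k) * a ^ k * D (s + of_nat k)) + R (N + 2) s"
      by (subst infsum_cong[OF trm]) (auto intro!: infsumI)
    also have "(\<Sum>k<N+2. ((-s) gchoose k) * a ^ k * D (s + of_nat k)) =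
        D s - s * a * D (s + 1) + (\<Sum>k=2..<N+2. ((-s) gchoose k) * a ^ k * D (s + of_nat k))"
    proof -
      have *: "{..<N+2} = insert 0 (insert 1 {2..<N+2})" by auto
      show ?thesis unfolding * by (simp add: algebra_simps)
    qed
    finally have "D s - g s = D s - s * a * D (s + 1) +
        (\<Sum>k=2..<N+2. ((-s) gchoose k) * a ^ k * D (s + of_nat k)) + R (N + 2) s"
      using diff[OF s] by (simp only: D_def)
    moreover have "x = u - v - w" if "y - x = y - u + v + w" for x y u v w :: complex
      using that by (simp add: algebra_simps)
    ultimately show ?thesis by blast
  qed
  \<comment> \<open>As the meromorphic domain grows to the left, the half-plane of verified
    agreement with \<open>D\<close> shrinks to the right. Any nonempty half-plane is enough for
    unique continuation.\<close>
  have "\<exists>f. f meromorphic_on H N \<and> (\<forall>s. Re s > \<sigma>0 + N \<longrightarrow> f s = D s)" for N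
  proof (induction N)
    case 0
    show ?case using Dhol H(1)[of 0]
      by (intro exI[of _ D]) (auto simp: H_def analytic_on_open intro!: analytic_on_imp_meromorphic_on)
  next
    case (Suc N)
    then obtain f where f: "f meromorphic_on H N" and fD: "\<And>s. Re s > \<sigma>0 + N \<Longrightarrow> f s = D s" by blast
    \<comment> \<open>The recursion at s - 1, solved for \<open>D s\<close>: arguments s - 1 + k
      with k >= 2 lie in \<open>H N\<close> when s lies in \<open>H (Suc N)\<close>, and the
      remainder of order N + 2 covers s - 1.\<close>
    define f' where "f' = (\<lambda>s. (g (s - 1) + (\<Sum>k=2..<N+2. ((- (s - 1)) gchoose k) * a ^ k * f (s - 1 + of_nat k))
        + R (N + 2) (s - 1)) / ((s - 1) * a))"
    have shift: "(\<lambda>s. h (s + c)) meromorphic_on A" if "h meromorphic_on B" "\<And>s. s \<in> A \<Longrightarrow> s + c \<in> B" for h A B c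
    proof -
      have "\<exists>F. (\<lambda>w. h (x + w + c)) has_laurent_expansion F" if "x \<in> A" for x
      proof -
        have "(\<lambda>w. h (x + w + c)) = (\<lambda>w. h ((x + c) + w))" by (simp add: add_ac)
        then show ?thesis
          using \<open>h meromorphic_on B\<close> \<open>\<And>s. s \<in> A \<Longrightarrow> s + c \<in> B\<close>[OF that]
          unfolding meromorphic_on_def by auto
      qed
      then show ?thesis by (simp add: meromorphic_on_def)
    qed
    have "f' meromorphic_on H (Suc N)"
    proof -
      have 1: "(\<lambda>s. g (s - 1)) meromorphic_on H (Suc N)"
        using shift[OF g, of "H (Suc N)" "-1"] by simp
      have 2: "(\<lambda>s. f (s - 1 + of_nat k)) meromorphic_on H (Suc N)" if "k \<ge> 2" for k
        using shift[OF f, of "H (Suc N)" "of_nat k - 1"] that by (simp add: H_def algebra_simps)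
      have 3: "(\<lambda>s. R (N + 2) (s - 1)) meromorphic_on H (Suc N)"
      proof -
        have "R (N + 2) meromorphic_on H (N + 2)"
          using Rhol H(1) by (auto simp: analytic_on_open intro!: analytic_on_imp_meromorphic_on)
        from shift[OF this, of "H (Suc N)" "-1"] show ?thesis by (simp add: H_def)
      qed
      have 4: "(\<lambda>s. (- (s - 1)) gchoose k) meromorphic_on H (Suc N)" for k
      proof (rule analytic_on_imp_meromorphic_on)
        have "(\<lambda>s. (- (s - 1)) gchoose k) holomorphic_on H (Suc N)"
          by (intro gbin_hol holomorphic_intros)
        then show "(\<lambda>s. (- (s - 1)) gchoose k) analytic_on H (Suc N)"
          using H(1) by (simp only: analytic_on_open)
      qed
      show ?thesis unfolding f'_def
        by (intro meromorphic_intros 1 2 3 4) auto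
    qed
    moreover have "f' s = D s" if s: "Re s > \<sigma>0 + Suc N" for s
    proof -
      have "f (s - 1 + of_nat k) = D (s - 1 + of_nat k)" if "k \<in> {2..<N+2}" for k
        using s that by (intro fD) auto
      then have eq: "(\<Sum>k=2..<N+2. ((- (s - 1)) gchoose k) * a ^ k * f (s - 1 + of_nat k)) =
          (\<Sum>k=2..<N+2. ((- (s - 1)) gchoose k) * a ^ k * D (s - 1 + of_nat k))"
        by (intro sum.cong refl arg_cong2[where f = "(*)"])
      have "f' s = (g (s - 1) + (\<Sum>k=2..<N+2. ((- (s - 1)) gchoose k) * a ^ k * D (s - 1 + of_nat k))
        + R (N + 2) (s - 1)) / ((s - 1) * a)"
        unfolding f'_def eq ..
      also have "g (s - 1) + (\<Sum>k=2..<N+2. ((- (s - 1)) gchoose k) * a ^ k * D (s - 1 + of_nat k))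
        + R (N + 2) (s - 1) = (s - 1) * a * D (s - 1 + 1)"
      proof -
        have "x + v + w = u" if "x = u - v - w" for x u v w :: complex
          using that by simp
        moreover have "Re (s - 1) > \<sigma>0" using s by simp
        ultimately show ?thesis using expand by blast
      qed
      also have "(s - 1) * a * D (s - 1 + 1) / ((s - 1) * a) = D s" using a s \<sigma>0 by auto
      finally show ?thesis .
    qed
    ultimately show ?case by blast
  qed
  then obtain f where f: "\<And>N. f N meromorphic_on H N" and fD: "\<And>N s. Re s > \<sigma>0 + real N \<Longrightarrow> f N s = D s"
    by metis
  \<comment> \<open>Normalising the values at singularities makes the functions for different N
    agree at every point, so that they glue.\<close>
  define f' where "f' = (\<lambda>N. remove_sings (f N))"
  have f': "f' N nicely_meromorphic_on H N" for N
    unfolding f'_def using f by (rule remove_sings_nicely_meromorphic)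
  have f'D: "f' N s = D s" if s: "Re s > \<sigma>0 + real N" for N s
  proof -
    have "f N holomorphic_on {s. Re s > \<sigma>0 + real N}"
      by (rule holomorphic_transform[of D]) (use Dhol fD in \<open>auto elim!: holomorphic_on_subset\<close>)
    then have "f N analytic_on {s}"
      using s open_Re_gt[of "\<sigma>0 + N"] by (auto simp: analytic_on_open analytic_at)
    then show ?thesis using fD[OF s] by (simp add: f'_def)
  qed
  have mono: "f' N s = f' M s" if "N \<le> M" "s \<in> H N" for N M s
  proof (rule nicely_meromorphic_on_eq[OF f' _ H(1,2) open_Re_gt _ _ _ that(2)])
    show "f' M nicely_meromorphic_on H N"
      by (rule nicely_meromorphic_on_subset[OF f']) (use that in \<open>auto simp: H_def\<close>)
    show "{s. Re s > \<sigma>0 + real M} \<noteq> {}"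
      by (auto intro!: exI[of _ "of_real (\<sigma>0 + real M + 1)"])
  qed (use that f'D in \<open>auto simp: H_def\<close>)
  define N where "N = (\<lambda>s. nat \<lceil>\<sigma>0 - Re s\<rceil> + 1)"
  have N: "s \<in> H (N s)" for s
    unfolding H_def N_def by simp linarith
  define F where "F = (\<lambda>s. f' (N s) s)"
  have F: "F s = f' M s" if "s \<in> H M" for M s
    unfolding F_def
  proof (cases "N s \<le> M")
    case True
    then show "f' (N s) s = f' M s" using N by (rule mono)
  next
    case False
    then show "f' (N s) s = f' M s" using that by (intro mono[symmetric]) auto
  qed
  have "F meromorphic_on {s}" for s
  proof -
    have "eventually (\<lambda>w. w \<in> H (N s)) (at s)"
      using H(1) N by (intro eventually_at_in_open') auto
    then have "eventually (\<lambda>w. F w = f' (N s) w) (at s)"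
      by eventually_elim (rule F)
    moreover have "f' (N s) meromorphic_on {s}"
      using f'[of "N s"] N[of s] by (auto simp: nicely_meromorphic_on_def intro: meromorphic_on_subset)
    ultimately show ?thesis
      by (subst meromorphic_on_cong[where B = "{s}" and g = "f' (N s)"]) auto
  qed
  then have "F meromorphic_on UNIV" by (subst meromorphic_on_meromorphic_at) auto
  moreover have "((\<lambda>i. z i powr (- s)) has_sum F s) I" if "Re s > \<sigma>0" for s
    using F[of s 0] f'D[of 0 s] that has_sum_infsum[OF Dsumm[OF that]] by (simp add: H_def D_def)
  moreover have "F holomorphic_on {s. Re s > \<sigma>0}"
    by (rule holomorphic_transform[OF Dhol]) (use F[of _ 0] f'D[of 0] in \<open>auto simp: H_def\<close>)
  ultimately show ?thesis unfolding has_continuation_def by blast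
qed

section \<open>Permanence properties and uniqueness of continuations\<close>

lemma has_continuation_finite:
  assumes "finite I"
  shows "has_continuation I z \<sigma>"
proof -
  have hol: "(\<lambda>s. \<Sum>i\<in>I. z i powr (- s)) holomorphic_on A" for A
    by (intro holomorphic_intros)
  from hol[of UNIV] have "(\<lambda>s. \<Sum>i\<in>I. z i powr (- s)) meromorphic_on UNIV"
    by (intro analytic_on_imp_meromorphic_on) (simp add: analytic_on_open)
  with hol assms show ?thesis unfolding has_continuation_def
    by (intro exI[of _ "\<lambda>s. \<Sum>i\<in>I. z i powr (- s)"]) auto
qed

lemma has_continuation_Un_disjoint:
  assumes "has_continuation I z \<sigma>" "has_continuation J z \<sigma>" "I \<inter> J = {}"
  shows "has_continuation (I \<union> J) z \<sigma>"
proof -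
  from assms obtain F G where "F meromorphic_on UNIV" "F holomorphic_on {s. Re s > \<sigma>}"
    "\<forall>s. Re s > \<sigma> \<longrightarrow> ((\<lambda>i. z i powr (- s)) has_sum F s) I"
    "G meromorphic_on UNIV" "G holomorphic_on {s. Re s > \<sigma>}"
    "\<forall>s. Re s > \<sigma> \<longrightarrow> ((\<lambda>i. z i powr (- s)) has_sum G s) J"
    unfolding has_continuation_def by blast
  with assms(3) show ?thesis unfolding has_continuation_def
    by (intro exI[of _ "\<lambda>s. F s + G s"])
       (auto intro!: meromorphic_intros holomorphic_intros has_sum_Un_disjoint)
qed

lemma has_continuation_image_iff:
  assumes "inj_on h J"
  shows "has_continuation (h ` J) z \<sigma> \<longleftrightarrow> has_continuation J (\<lambda>j. z (h j)) \<sigma>"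
  unfolding has_continuation_def by (simp add: has_sum_reindex[OF assms] o_def)

lemma has_continuation_mono:
  assumes "has_continuation I z \<sigma>" "\<sigma> \<le> \<sigma>'"
  shows "has_continuation I z \<sigma>'"
proof -
  from assms(1) obtain F where F: "F meromorphic_on UNIV" "F holomorphic_on {s. Re s > \<sigma>}"
    "\<forall>s. Re s > \<sigma> \<longrightarrow> ((\<lambda>i. z i powr (- s)) has_sum F s) I"
    unfolding has_continuation_def by blast
  have "F holomorphic_on {s. Re s > \<sigma>'}"
    by (rule holomorphic_on_subset[OF F(2)]) (use assms(2) in auto)
  with F assms(2) show ?thesis unfolding has_continuation_def by (intro exI[of _ F]) auto
qed

text \<open>This is the premise under which \<open>theI'\<close> applies to the definitions of
  \<open>riemann_zeta\<close> and \<open>double_zeta\<close>.\<close>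

lemma has_continuation_imp_nicely_unique:
  assumes "has_continuation I z \<sigma>"
  shows "\<exists>!F. F nicely_meromorphic_on UNIV \<and> (\<forall>s. Re s > \<sigma> \<longrightarrow> ((\<lambda>i. z i powr (- s)) has_sum F s) I)"
proof (rule ex_ex1I)
  from assms obtain F where F: "F meromorphic_on UNIV" "F holomorphic_on {s. Re s > \<sigma>}"
    "\<forall>s. Re s > \<sigma> \<longrightarrow> ((\<lambda>i. z i powr (- s)) has_sum F s) I"
    unfolding has_continuation_def by blast
  have "remove_sings F s = F s" if "Re s > \<sigma>" for s
  proof -
    have "F analytic_on {s}"
      using F(2) open_Re_gt[of \<sigma>] that by (auto simp: analytic_at)
    then show ?thesis by simp
  qed
  with F show "\<exists>F. F nicely_meromorphic_on UNIV \<and> (\<forall>s. Re s > \<sigma> \<longrightarrow> ((\<lambda>i. z i powr (- s)) has_sum F s) I)"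
    by (intro exI[of _ "remove_sings F"]) (auto intro: remove_sings_nicely_meromorphic)
next
  fix F G
  assume F: "F nicely_meromorphic_on UNIV \<and> (\<forall>s. Re s > \<sigma> \<longrightarrow> ((\<lambda>i. z i powr (- s)) has_sum F s) I)"
    and G: "G nicely_meromorphic_on UNIV \<and> (\<forall>s. Re s > \<sigma> \<longrightarrow> ((\<lambda>i. z i powr (- s)) has_sum G s) I)"
  have ne: "{s. Re s > \<sigma>} \<noteq> {}"
    by (auto intro!: exI[of _ "of_real (\<sigma> + 1)"])
  show "F = G"
  proof
    fix s
    have eq: "F w = G w" if "w \<in> {s. Re s > \<sigma>}" for w
      using F G that by (auto intro: has_sum_unique)
    show "F s = G s"
      by (rule nicely_meromorphic_on_eq[OF _ _ _ _ open_Re_gt ne _ eq]) (use F G in auto)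
  qed
qed

text \<open>
  Closed half-planes on which the principal logarithm is continuous: for \<open>\<phi> = \<pi> / 2\<close> the boundary
  contains the cut, approached from above.
\<close>

definition half_plane :: "real \<Rightarrow> complex set" where
  "half_plane \<phi> = {c. c \<noteq> 0 \<and> Re (c * cis (- \<phi>)) \<ge> 0}"

lemma half_plane_nonzero: "c \<in> half_plane \<phi> \<Longrightarrow> c \<noteq> 0"
  by (simp add: half_plane_def)

text \<open>Rotation by -phi brings the half-plane to Re >= 0, where arguments lie in [-pi/2, pi/2].
  The bounds on phi are exactly those that keep the argument in (-pi, pi] after phi is added
  back.\<close>

lemma Ln_half_plane:
  assumes \<phi>: "- pi / 2 < \<phi>" "\<phi> \<le> pi / 2" and c: "c \<in> half_plane \<phi>"
  shows "Ln c = Ln (c * cis (- \<phi>)) + \<i> * \<phi>"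
proof (rule Ln_unique)
  have nz: "c * cis (- \<phi>) \<noteq> 0" and "Re (c * cis (- \<phi>)) \<ge> 0"
    using c by (auto simp: half_plane_def)
  then have Im: "\<bar>Im (Ln (c * cis (- \<phi>)))\<bar> \<le> pi / 2"
    using Re_Ln_pos_le by blast
  show "exp (Ln (c * cis (- \<phi>)) + \<i> * \<phi>) = c"
    using nz by (simp add: exp_add mult.assoc flip: cis_conv_exp) (simp add: cis_mult)
  show "- pi < Im (Ln (c * cis (- \<phi>)) + \<i> * \<phi>)" "Im (Ln (c * cis (- \<phi>)) + \<i> * \<phi>) \<le> pi"
    using Im \<phi> by (auto simp: abs_le_iff)
qed

lemma continuous_on_Ln_half_plane:
  assumes "- pi / 2 < \<phi>" "\<phi> \<le> pi / 2"
  shows "continuous_on (half_plane \<phi>) Ln"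
proof -
  have "c * cis (- \<phi>) \<notin> \<real>\<^sub>\<le>\<^sub>0" if "c \<in> half_plane \<phi>" for c
  proof
    assume "c * cis (- \<phi>) \<in> \<real>\<^sub>\<le>\<^sub>0"
    with that have "c * cis (- \<phi>) = 0"
      by (auto simp: half_plane_def complex_nonpos_Reals_iff complex_eq_iff)
    with that show False by (simp add: half_plane_def)
  qed
  then have "continuous_on (half_plane \<phi>) (\<lambda>c. Ln (c * cis (- \<phi>)) + \<i> * \<phi>)"
    by (intro continuous_intros)
  then show ?thesis
    by (rule continuous_on_cong[THEN iffD1, rotated 2]) (use Ln_half_plane[OF assms] in auto)
qed

text \<open>After the rotation the two arguments are at most pi/2 and strictly less than pi/2 in
  absolute value, so their sum meets no cut. That the product stays in the half-plane allows the
  rotation to be undone.\<close>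

lemma Ln_mult_half_plane:
  assumes \<phi>: "- pi / 2 < \<phi>" "\<phi> \<le> pi / 2" and c: "c \<in> half_plane \<phi>"
    and d: "c * (1 + r) \<in> half_plane \<phi>" and r: "norm r < 1"
  shows "Ln (c * (1 + r)) = Ln c + Ln (1 + r)"
proof -
  define e where "e = c * cis (- \<phi>)"
  have e: "e \<noteq> 0" "Re e \<ge> 0" using c by (auto simp: e_def half_plane_def)
  have r': "1 + r \<noteq> 0" "Re (1 + r) > 0"
    using r abs_Re_le_cmod[of r] by (auto simp: add_eq_0_iff)
  have "\<bar>Im (Ln e)\<bar> \<le> pi / 2" "\<bar>Im (Ln (1 + r))\<bar> < pi / 2"
    using e r' Re_Ln_pos_le[of e] Re_Ln_pos_lt[of "1 + r"] by auto
  then have "Ln (e * (1 + r)) = Ln e + Ln (1 + r)"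
    using e r' by (intro Ln_unique) (auto simp: exp_add abs_le_iff abs_less_iff)
  moreover have "c * (1 + r) * cis (- \<phi>) = e * (1 + r)"
    by (simp add: e_def)
  ultimately show ?thesis
    unfolding Ln_half_plane[OF \<phi> c] Ln_half_plane[OF \<phi> d] by (simp only: e_def) simp
qed

lemma powr_add_half_plane:
  assumes \<phi>: "- pi / 2 < \<phi>" "\<phi> \<le> pi / 2" and c: "c \<in> half_plane \<phi>"
    and d: "c + a \<in> half_plane \<phi>" and a: "norm a < norm c"
  shows "(c + a) powr w = c powr w * (1 + a / c) powr w"
proof -
  have nz: "c \<noteq> 0" "c + a \<noteq> 0" using c d by (auto simp: half_plane_def)
  have eq: "c + a = c * (1 + a / c)" using nz by (simp add: field_simps)
  then have "Ln (c + a) = Ln c + Ln (1 + a / c)"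
    using Ln_mult_half_plane[OF \<phi> c, of "a / c"] d a nz by (simp add: norm_divide)
  moreover have "1 + a / c \<noteq> 0" using nz eq by auto
  ultimately show ?thesis using nz by (simp add: powr_def exp_add ring_distribs)
qed

section \<open>Continuation of sums over progressions and lattices\<close>

lemma pos_Re_in_half_plane: "Re c > 0 \<Longrightarrow> c \<in> half_plane 0"
  by (auto simp: half_plane_def)

lemma summable_on_Suc_powr:
  assumes "p > 1"
  shows "(\<lambda>n::nat. (1 + real n) powr (- p)) summable_on UNIV"
proof -
  have "summable (\<lambda>n. real (Suc n) powr (- p))"
    using assms by (subst summable_Suc_iff) (simp add: summable_real_powr_iff)
  then show ?thesis by (intro summable_nonneg_imp_summable_on) (auto simp: add.commute)
qed

lemma summable_on_Suc_powr_prod: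
  assumes "p > 1"
  shows "(\<lambda>(m::nat, n::nat). (1 + real m) powr (- p) * (1 + real n) powr (- p)) summable_on UNIV"
proof -
  note s = summable_on_Suc_powr[OF assms]
  have "(\<lambda>(m::nat, n::nat). (1 + real m) powr (- p) * (1 + real n) powr (- p)) summable_on UNIV \<times> UNIV"
  proof (rule summable_on_SigmaI)
    show "((\<lambda>n. case (m, n) of (m, n) \<Rightarrow> (1 + real m) powr (- p) * (1 + real n) powr (- p)) has_sum
        (1 + real m) powr (- p) * (\<Sum>\<^sub>\<infinity>n. (1 + real n) powr (- p))) UNIV" for m :: nat
      using has_sum_cmult_right[OF has_sum_infsum[OF s]] by simp
  qed (auto intro!: summable_on_cmult_left s)
  then show ?thesis by simp
qed

text \<open>Halving the exponent separates the variables, so that a lattice sum is bounded by a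
  product of two single sums.\<close>

lemma powr_minus_le_prod:
  fixes m n \<sigma> :: real
  assumes "m \<ge> 0" "n \<ge> 0" "\<sigma> \<ge> 0"
  shows "(1 + m + n) powr (- \<sigma>) \<le> (1 + m) powr (- (\<sigma> / 2)) * (1 + n) powr (- (\<sigma> / 2))"
proof -
  have "(1 + m + n) powr (- \<sigma>) = (1 + m + n) powr (- (\<sigma> / 2)) * (1 + m + n) powr (- (\<sigma> / 2))"
    by (simp flip: powr_add)
  also have "\<dots> \<le> (1 + m) powr (- (\<sigma> / 2)) * (1 + n) powr (- (\<sigma> / 2))"
    using assms by (intro mult_mono powr_mono2') auto
  finally show ?thesis .
qed

text \<open>A shift by tau drops only the first term \<open>q powr (- s)\<close>, which is entire in
  s. The binomial recursion needs |tau / z| <= 1/2, so it is applied to q with large real part; the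
  general case adds finitely many initial terms.\<close>

lemma has_continuation_progression:
  assumes \<tau>: "Re \<tau> > 0"
  shows "has_continuation UNIV (\<lambda>n::nat. q + of_nat n * \<tau>) 1"
proof -
  have nat_eq: "UNIV = {0} \<union> range Suc" using UNIV_nat_eq by blast
  have step: "has_continuation UNIV (\<lambda>n::nat. q + of_nat n * \<tau>) 1"
    if "has_continuation UNIV (\<lambda>n::nat. q + \<tau> + of_nat n * \<tau>) 1" for q
  proof -
    have "has_continuation (range Suc) (\<lambda>n::nat. q + of_nat n * \<tau>) 1"
      using that by (subst has_continuation_image_iff) (auto simp: algebra_simps)
    from has_continuation_Un_disjoint[OF has_continuation_finite[of "{0}"] this]
    have "has_continuation ({0} \<union> range Suc) (\<lambda>n::nat. q + of_nat n * \<tau>) 1" by simp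
    then show ?thesis by (simp only: flip: nat_eq)
  qed
  have base: "has_continuation UNIV (\<lambda>n::nat. q + of_nat n * \<tau>) 1"
    if q: "Re q \<ge> 1" "Re q \<ge> 2 * norm \<tau>" for q
  proof (rule powr_series_continuation[where a = \<tau> and g = "\<lambda>s. q powr (- s)"])
    let ?z = "\<lambda>n::nat. q + of_nat n * \<tau>"
    have Re: "Re (?z n) \<ge> Re q" for n using \<tau> by simp
    have norm: "norm (?z n) \<ge> Re q" for n
      using Re[of n] complex_Re_le_cmod[of "?z n"] by linarith
    show "\<tau> \<noteq> 0" using \<tau> by auto
    show "1 \<le> norm (?z n)" "2 * norm \<tau> \<le> norm (?z n)" for n
      using norm[of n] q by linarith+
    show "(?z n + \<tau>) powr w = ?z n powr w * (1 + \<tau> / ?z n) powr w" for n w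
    proof (rule powr_add_half_plane[of 0])
      show "norm \<tau> < norm (?z n)"
        using norm[of n] q \<tau> by (smt (verit) complex_Re_le_cmod)
      show "?z n \<in> half_plane 0" "?z n + \<tau> \<in> half_plane 0"
        using Re[of n] q(1) \<tau> by (auto intro!: pos_Re_in_half_plane simp: add_pos_nonneg)
    qed auto
    define \<kappa> where "\<kappa> = min 1 (Re \<tau>)"
    have \<kappa>: "\<kappa> > 0" using \<tau> by (simp add: \<kappa>_def)
    have lower: "norm (?z n) \<ge> \<kappa> * (1 + real n)" for n
    proof -
      have "\<kappa> * (1 + real n) = \<kappa> + real n * \<kappa>" by (simp add: algebra_simps)
      also have "\<dots> \<le> Re q + real n * Re \<tau>"
        using q(1) by (intro add_mono mult_left_mono) (auto simp: \<kappa>_def)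
      also have "\<dots> = Re (?z n)" by simp
      also have "\<dots> \<le> norm (?z n)" by (rule complex_Re_le_cmod)
      finally show ?thesis .
    qed
    show summ: "(\<lambda>n. norm (?z n) powr (- \<sigma>)) summable_on UNIV" if "\<sigma> > 1" for \<sigma>
    proof (rule summable_on_comparison_test)
      show "(\<lambda>n. \<kappa> powr (- \<sigma>) * (1 + real n) powr (- \<sigma>)) summable_on UNIV"
        using that by (intro summable_on_cmult_right summable_on_Suc_powr)
      show "norm (?z n) powr (- \<sigma>) \<le> \<kappa> powr (- \<sigma>) * (1 + real n) powr (- \<sigma>)" for n
      proof -
        have "norm (?z n) powr (- \<sigma>) \<le> (\<kappa> * (1 + real n)) powr (- \<sigma>)"
          using \<kappa> that lower by (intro powr_mono2') auto
        then show ?thesis using \<kappa> by (simp add: powr_mult)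
      qed
    qed auto
    show "(\<lambda>s. q powr (- s)) meromorphic_on UNIV"
      by (intro analytic_on_imp_meromorphic_on) (auto simp: analytic_on_open intro!: holomorphic_intros)
    show "(\<Sum>\<^sub>\<infinity>n\<in>UNIV. (?z n + \<tau>) powr (- s)) = (\<Sum>\<^sub>\<infinity>n\<in>UNIV. ?z n powr (- s)) - q powr (- s)"
      if "Re s > 1" for s
    proof -
      have fin: "finite {n\<in>UNIV. norm (?z n) < 1}"
      proof -
        have "{n\<in>UNIV. norm (?z n) < 1} = {}" using norm q(1) by (smt (verit) Collect_empty_eq)
        then show ?thesis by (metis finite.emptyI)
      qed
      have "(\<lambda>n. ?z n powr (- s)) summable_on UNIV"
        by (rule summable_on_powr_series[OF fin summ that])
      then have s: "(\<lambda>n. ?z n powr (- s)) summable_on range Suc"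
        by (rule summable_on_subset_banach) auto
      have "(\<Sum>\<^sub>\<infinity>n\<in>UNIV. ?z n powr (- s)) = (\<Sum>\<^sub>\<infinity>n\<in>{0} \<union> range Suc. ?z n powr (- s))"
        by (simp only: flip: nat_eq)
      also have "\<dots> = q powr (- s) + (\<Sum>\<^sub>\<infinity>n\<in>range Suc. ?z n powr (- s))"
        using s by (subst infsum_Un_disjoint) auto
      also have "(\<Sum>\<^sub>\<infinity>n\<in>range Suc. ?z n powr (- s)) = (\<Sum>\<^sub>\<infinity>n\<in>UNIV. (?z n + \<tau>) powr (- s))"
        by (subst infsum_reindex) (auto simp: o_def algebra_simps)
      finally show ?thesis by simp
    qed
  qed auto
  have "has_continuation UNIV (\<lambda>n::nat. q + of_nat n * \<tau>) 1"
    if "has_continuation UNIV (\<lambda>n::nat. q + of_nat N * \<tau> + of_nat n * \<tau>) 1" for N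
    using that
  proof (induction N)
    case (Suc N)
    have "(\<lambda>n::nat. q + of_nat (Suc N) * \<tau> + of_nat n * \<tau>) =
          (\<lambda>n::nat. q + of_nat N * \<tau> + \<tau> + of_nat n * \<tau>)"
      by (simp add: algebra_simps)
    with Suc.prems have "has_continuation UNIV (\<lambda>n::nat. q + of_nat N * \<tau> + \<tau> + of_nat n * \<tau>) 1"
      by simp
    from Suc.IH[OF step[OF this]] show ?case .
  qed simp
  moreover obtain N :: nat where "real N \<ge> (max 1 (2 * norm \<tau>) - Re q) / Re \<tau>"
    using real_arch_simple by blast
  then have "max 1 (2 * norm \<tau>) \<le> Re q + real N * Re \<tau>"
    using \<tau> by (simp add: field_simps)
  then have "has_continuation UNIV (\<lambda>n::nat. q + of_nat N * \<tau> + of_nat n * \<tau>) 1"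
    by (intro base) auto
  ultimately show ?thesis by blast
qed

text \<open>A shift by 1 in m drops the row m = 0, a progression with step tau, whose continuation
  is already available and plays the part of \<open>g\<close>. As for progressions, the recursion is
  run far to the right (Re y >= 2) and finitely many rows are added afterwards.\<close>

lemma has_continuation_lattice:
  assumes \<tau>: "Re \<tau> > 0"
  shows "has_continuation UNIV (\<lambda>(m::nat, n::nat). y + of_nat m + of_nat n * \<tau>) 2"
proof -
  define z where "z = (\<lambda>y (m::nat, n::nat). y + of_nat m + of_nat n * \<tau>)"
  have split: "UNIV = range (\<lambda>n::nat. (0::nat, n)) \<union> range (map_prod Suc id :: nat \<times> nat \<Rightarrow> _)"
  proof -
    have "(m, n) \<in> range (\<lambda>n::nat. (0::nat, n)) \<union> range (map_prod Suc id :: nat \<times> nat \<Rightarrow> _)" for m n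
      by (cases m) (auto simp: image_iff)
    then show ?thesis by auto
  qed
  have disj: "range (\<lambda>n::nat. (0::nat, n)) \<inter> range (map_prod Suc id :: nat \<times> nat \<Rightarrow> _) = {}"
    by auto
  have inj: "inj (\<lambda>n::nat. (0::nat, n))" "inj (map_prod Suc id :: nat \<times> nat \<Rightarrow> _)"
    by (auto simp: inj_on_def)
  have z_Suc: "z y (map_prod Suc id p) = z (y + 1) p" and z_1: "z y p + 1 = z (y + 1) p"
    and z_0: "z y (0, n) = y + of_nat n * \<tau>" for y p n
    by (auto simp: z_def algebra_simps split: prod.splits)
  have row: "has_continuation (range (\<lambda>n::nat. (0::nat, n))) (z y) 1" for y
    using has_continuation_progression[OF \<tau>] inj(1) by (simp add: has_continuation_image_iff z_0)
  have step: "has_continuation UNIV (z y) 2" if "has_continuation UNIV (z (y + 1)) 2" for y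
  proof -
    have "has_continuation (range (map_prod Suc id)) (z y) 2"
      using that inj(2) by (simp add: has_continuation_image_iff z_Suc)
    then have "has_continuation (range (\<lambda>n::nat. (0::nat, n)) \<union> range (map_prod Suc id)) (z y) 2"
      using has_continuation_mono[OF row] disj by (intro has_continuation_Un_disjoint) auto
    then show ?thesis by (simp only: flip: split)
  qed
  have base: "has_continuation UNIV (z y) 2" if y: "Re y \<ge> 2" for y
  proof -
    from row[of y] obtain g where g: "g meromorphic_on UNIV"
      "\<And>s. Re s > 1 \<Longrightarrow> ((\<lambda>p. z y p powr (- s)) has_sum g s) (range (\<lambda>n::nat. (0::nat, n)))"
      unfolding has_continuation_def by blast
    define \<kappa> where "\<kappa> = min 1 (Re \<tau>)"
    have \<kappa>: "\<kappa> > 0" using \<tau> by (simp add: \<kappa>_def)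
    have Re: "Re (z y p) \<ge> 2" for p
      using y \<tau> by (auto simp: z_def split: prod.splits) (smt (verit) of_nat_0_le_iff mult_nonneg_nonneg)
    have norm: "norm (z y p) \<ge> 2" for p
      using Re[of p] complex_Re_le_cmod[of "z y p"] by linarith
    have lower: "norm (z y (m, n)) \<ge> \<kappa> * (1 + real m + real n)" for m n
    proof -
      have "\<kappa> * (1 + real m + real n) = \<kappa> + real m * \<kappa> + real n * \<kappa>" by (simp add: algebra_simps)
      also have "\<dots> \<le> Re y + real m * 1 + real n * Re \<tau>"
        using y by (intro add_mono mult_left_mono) (auto simp: \<kappa>_def)
      also have "\<dots> = Re (z y (m, n))" by (simp add: z_def)
      also have "\<dots> \<le> norm (z y (m, n))" by (rule complex_Re_le_cmod)
      finally show ?thesis .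
    qed
    have summ: "(\<lambda>p. norm (z y p) powr (- \<sigma>)) summable_on UNIV" if \<sigma>: "\<sigma> > 2" for \<sigma>
    proof (rule summable_on_comparison_test)
      show "(\<lambda>p. \<kappa> powr (- \<sigma>) * (case p of (m::nat, n::nat) \<Rightarrow>
          (1 + real m) powr (- (\<sigma> / 2)) * (1 + real n) powr (- (\<sigma> / 2)))) summable_on UNIV"
        using \<sigma> by (intro summable_on_cmult_right summable_on_Suc_powr_prod) simp
      fix p :: "nat \<times> nat"
      obtain m n where p: "p = (m, n)" by (cases p)
      have "norm (z y p) powr (- \<sigma>) \<le> (\<kappa> * (1 + real m + real n)) powr (- \<sigma>)"
        using \<kappa> \<sigma> lower[of m n] unfolding p by (intro powr_mono2') auto
      also have "\<dots> = \<kappa> powr (- \<sigma>) * (1 + real m + real n) powr (- \<sigma>)"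
        using \<kappa> by (simp add: powr_mult)
      also have "\<dots> \<le> \<kappa> powr (- \<sigma>) * ((1 + real m) powr (- (\<sigma> / 2)) * (1 + real n) powr (- (\<sigma> / 2)))"
        using \<sigma> by (intro mult_left_mono powr_minus_le_prod) auto
      finally show "norm (z y p) powr (- \<sigma>) \<le> \<kappa> powr (- \<sigma>) * (case p of (m::nat, n::nat) \<Rightarrow>
          (1 + real m) powr (- (\<sigma> / 2)) * (1 + real n) powr (- (\<sigma> / 2)))"
        by (simp add: p)
    qed auto
    show ?thesis
    proof (rule powr_series_continuation[where a = 1 and g = g])
      show "(z y p + 1) powr w = z y p powr w * (1 + 1 / z y p) powr w" for p w
        using Re[of p] norm[of p]
        by (intro powr_add_half_plane[of 0] pos_Re_in_half_plane) auto
      show "(\<Sum>\<^sub>\<infinity>p. (z y p + 1) powr (- s)) = (\<Sum>\<^sub>\<infinity>p. z y p powr (- s)) - g s"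
        if s: "Re s > 2" for s
      proof -
        have fin: "finite {p\<in>UNIV. norm (z y p) < 1}"
        proof -
          have "{p\<in>UNIV. norm (z y p) < 1} = {}" using norm by (smt (verit) Collect_empty_eq)
          then show ?thesis by (metis finite.emptyI)
        qed
        have "(\<lambda>p. z y p powr (- s)) summable_on UNIV"
          by (rule summable_on_powr_series[OF fin summ s])
        then have summ': "(\<lambda>p. z y p powr (- s)) summable_on A" for A
          by (rule summable_on_subset_banach) auto
        have "(\<Sum>\<^sub>\<infinity>p. z y p powr (- s)) = (\<Sum>\<^sub>\<infinity>p\<in>range (\<lambda>n::nat. (0::nat, n)) \<union>
            range (map_prod Suc id). z y p powr (- s))"
          by (simp only: flip: split)
        also have "\<dots> = g s + (\<Sum>\<^sub>\<infinity>p\<in>range (map_prod Suc id). z y p powr (- s))"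
          using infsumI[OF g(2)[of s]] s by (subst infsum_Un_disjoint[OF summ' summ' disj]) auto
        also have "(\<Sum>\<^sub>\<infinity>p\<in>range (map_prod Suc id). z y p powr (- s)) =
            (\<Sum>\<^sub>\<infinity>p. (z y p + 1) powr (- s))"
          by (subst infsum_reindex[OF inj(2)]) (simp add: o_def z_Suc z_1)
        finally show ?thesis by simp
      qed
      show "1 \<le> norm (z y p)" "2 * norm (1 :: complex) \<le> norm (z y p)" for p
        using norm[of p] by auto
    qed (use summ g in auto)
  qed
  have "has_continuation UNIV (z y) 2" if "has_continuation UNIV (z (y + of_nat N)) 2" for N
    using that
  proof (induction N)
    case (Suc N)
    have "y + of_nat (Suc N) = y + of_nat N + 1" by simp
    with Suc.prems have "has_continuation UNIV (z (y + of_nat N + 1)) 2" by metis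
    from Suc.IH[OF step[OF this]] show ?case .
  qed simp
  moreover obtain N :: nat where "real N \<ge> 2 - Re y"
    using real_arch_simple by blast
  then have "has_continuation UNIV (z (y + of_nat N)) 2"
    by (intro base) auto
  ultimately show ?thesis by (auto simp: z_def)
qed

lemma riemann_zeta_continuation:
  "riemann_zeta nicely_meromorphic_on UNIV"
  "Re s > 1 \<Longrightarrow> ((\<lambda>n::nat. of_nat (Suc n) powr (- s)) has_sum riemann_zeta s) UNIV"
proof -
  have "has_continuation UNIV (\<lambda>n::nat. of_nat (Suc n)) 1"
    using has_continuation_progression[of 1 1] by simp
  from theI'[OF has_continuation_imp_nicely_unique[OF this]]
  show "riemann_zeta nicely_meromorphic_on UNIV"
    "Re s > 1 \<Longrightarrow> ((\<lambda>n::nat. of_nat (Suc n) powr (- s)) has_sum riemann_zeta s) UNIV"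
    unfolding riemann_zeta_def by auto
qed

lemma double_zeta_continuation:
  assumes "Re \<tau> > 0"
  shows "double_zeta y 1 \<tau> nicely_meromorphic_on UNIV"
    and "Re s > 2 \<Longrightarrow> ((\<lambda>(m::nat, n::nat). (y + of_nat m + of_nat n * \<tau>) powr (- s)) has_sum double_zeta y 1 \<tau> s) UNIV"
  using theI'[OF has_continuation_imp_nicely_unique[OF has_continuation_lattice[OF assms, of y]]]
  unfolding double_zeta_def by (auto simp: case_prod_unfold)

section \<open>The cone of lattice points\<close>

lemma Re_mult_cis: "Re (z * cis (- \<psi>)) = norm z * cos (Arg z - \<psi>)"
proof -
  have "z * cis (- \<psi>) = of_real (norm z) * (cis (Arg z) * cis (- \<psi>))"
    using rcis_cmod_Arg[of z] by (simp add: rcis_def mult.assoc flip: of_real_mult)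
  also have "\<dots> = of_real (norm z) * cis (Arg z - \<psi>)"
    by (simp add: cis_mult)
  finally show ?thesis by simp
qed

text \<open>The quotient (1 + m) / (x + m) has no zero denominator and tends to 1, hence is
  bounded.\<close>

lemma norm_add_of_nat_ge:
  fixes x :: complex
  assumes "x \<notin> \<int>\<^sub>\<le>\<^sub>0"
  obtains \<kappa> where "\<kappa> > 0" "\<And>m::nat. norm (x + of_nat m) \<ge> \<kappa> * (1 + real m)"
proof -
  have nz: "x + of_nat m \<noteq> 0" for m
    using assms by (metis add.commute add_eq_0_iff minus_of_nat_in_nonpos_Ints)
  have "filterlim (\<lambda>m. x + of_nat m :: complex) at_infinity sequentially"
    by (intro tendsto_add_filterlim_at_infinity[OF tendsto_const] tendsto_of_nat)
  then have "(\<lambda>m. 1 + (1 - x) / (x + of_nat m)) \<longlonglongrightarrow> 1 + 0"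
    by (intro tendsto_add tendsto_const tendsto_divide_0[OF tendsto_const])
  then have "Bseq (\<lambda>m. 1 + (1 - x) / (x + of_nat m))"
    by (intro convergent_imp_Bseq) (auto simp: convergent_def)
  then obtain K where K: "K > 0" "\<And>m. norm (1 + (1 - x) / (x + of_nat m)) \<le> K"
    by (auto elim!: BseqE)
  show ?thesis
  proof (rule that[of "1 / K"])
    fix m :: nat
    have "1 + (1 - x) / (x + of_nat m) = of_nat (Suc m) / (x + of_nat m)"
      using nz[of m] by (simp add: field_simps)
    then have "(1 + real m) / norm (x + of_nat m) \<le> K"
      using K(2)[of m] by (simp add: norm_divide del: of_nat_Suc) simp
    then show "norm (x + of_nat m) \<ge> 1 / K * (1 + real m)"
      using K(1) nz[of m] by (simp add: field_simps)
  qed (use K in auto)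
qed

lemma Re_mult_cis_lattice:
  "Re ((x + of_nat m + of_real v * \<tau>) * cis (- \<psi>)) =
    norm x * cos (Arg x - \<psi>) + real m * cos \<psi> + v * norm \<tau> * cos (Arg \<tau> - \<psi>)"
proof -
  have "(x + of_nat m + of_real v * \<tau>) * cis (- \<psi>) =
      x * cis (- \<psi>) + of_nat m * cis (- \<psi>) + of_real v * (\<tau> * cis (- \<psi>))"
    by (simp add: algebra_simps)
  then have "Re ((x + of_nat m + of_real v * \<tau>) * cis (- \<psi>)) =
      Re (x * cis (- \<psi>)) + real m * cos \<psi> + v * Re (\<tau> * cis (- \<psi>))"
    by (simp only: plus_complex.sel Re_complex_of_real times_complex.sel) simp
  then show ?thesis unfolding Re_mult_cis by simp
qed

lemma sector_Arg: "\<tau> \<in> sector \<alpha> \<beta> \<longleftrightarrow> \<alpha> < Arg \<tau> \<and> Arg \<tau> < \<beta>"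
  by (simp add: sector_def)

text \<open>If 1, x and tau all lie strictly inside one half-plane, their projections onto its
  central direction psi are fixed fractions of their moduli and add up without cancellation. For
  negative real x no such half-plane exists and the imaginary part is used instead.\<close>

lemma cone_lower_bound:
  fixes x :: complex
  assumes x: "x \<notin> \<int>\<^sub>\<le>\<^sub>0" and ab: "0 \<le> \<alpha>" "\<alpha> < \<beta>" "\<beta> \<le> pi / 2"
    and arg: "\<beta> - pi < Arg x" "Arg x < pi + \<alpha>"
  obtains \<kappa> where "\<kappa> > 0"
    "\<And>\<tau> v (m::nat). \<tau> \<in> sector \<alpha> \<beta> \<Longrightarrow> v \<ge> 0 \<Longrightarrow>
       norm (x + of_nat m + of_real v * \<tau>) \<ge> \<kappa> * (1 + real m + v * norm \<tau>)"
proof (cases "Arg x = pi")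
  case False
  have x0: "norm x > 0" using x by (metis zero_in_nonpos_Ints zero_less_norm_iff)
  have Argx: "- pi < Arg x" "Arg x < pi"
    using Arg_bounded[of x] False by auto
  \<comment> \<open>A direction psi strictly between \<open>l\<close> and \<open>u\<close> is within
    pi/2 of 0, of \<open>Arg x\<close> and of every angle in [alpha, beta]. The hypotheses on
    \<open>Arg x\<close> are what makes this interval nonempty.\<close>
  define l where "l = max (max (- pi / 2) (Arg x - pi / 2)) (\<beta> - pi / 2)"
  define u where "u = min (min (pi / 2) (Arg x + pi / 2)) (\<alpha> + pi / 2)"
  define \<psi> where "\<psi> = (l + u) / 2"
  have "l < u"
    unfolding l_def u_def max_less_iff_conj min_less_iff_conj
    using ab arg Argx pi_gt_zero by (intro conjI; linarith)
  then have "l < \<psi>" "\<psi> < u" by (auto simp: \<psi>_def)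
  then have \<psi>: "\<bar>\<psi>\<bar> < pi / 2" "\<bar>Arg x - \<psi>\<bar> < pi / 2" "\<beta> - \<psi> < pi / 2" "\<psi> - \<alpha> < pi / 2"
    by (auto simp: l_def u_def abs_if)
  define \<delta> where "\<delta> = max (\<beta> - \<psi>) (\<psi> - \<alpha>)"
  have \<delta>: "\<delta> < pi / 2" "\<delta> \<ge> 0" using \<psi> ab by (auto simp: \<delta>_def max_def)
  define c where "c = min (min (cos \<psi>) (cos (Arg x - \<psi>))) (cos \<delta>)"
  have cos_pos: "cos y > 0" if "\<bar>y\<bar> < pi / 2" for y
    using that by (intro cos_gt_zero_pi) linarith+
  then have c: "c > 0"
    using \<psi> \<delta> by (simp add: c_def)
  show ?thesis
  proof (rule that[of "c * min 1 (norm x)"])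
    show "c * min 1 (norm x) > 0" using c x0 by simp
    fix \<tau> and v :: real and m :: nat assume \<tau>: "\<tau> \<in> sector \<alpha> \<beta>" and v: "v \<ge> 0"
    have "\<bar>Arg \<tau> - \<psi>\<bar> \<le> \<delta>" using \<tau> by (auto simp: sector_Arg \<delta>_def)
    then have "cos \<delta> \<le> cos \<bar>Arg \<tau> - \<psi>\<bar>"
      using \<delta> by (intro cos_monotone_0_pi_le) auto
    then have cos: "c \<le> cos (Arg \<tau> - \<psi>)" by (simp add: c_def)
    have "c * min 1 (norm x) * (1 + real m + v * norm \<tau>)
        = c * (min 1 (norm x) * 1) + c * (min 1 (norm x) * real m) + c * (min 1 (norm x) * (v * norm \<tau>))"
      by (simp add: algebra_simps)
    also have "\<dots> \<le> c * (norm x * 1) + c * (1 * real m) + c * (1 * (v * norm \<tau>))"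
      using c v by (intro add_mono mult_left_mono mult_right_mono) auto
    also have "\<dots> \<le> norm x * cos (Arg x - \<psi>) + real m * cos \<psi> + v * norm \<tau> * cos (Arg \<tau> - \<psi>)"
    proof (intro add_mono)
      show "c * (norm x * 1) \<le> norm x * cos (Arg x - \<psi>)"
        by (subst mult.commute) (auto intro!: mult_left_mono simp: c_def)
      show "c * (1 * real m) \<le> real m * cos \<psi>"
        by (subst mult.commute) (auto intro!: mult_left_mono simp: c_def)
      show "c * (1 * (v * norm \<tau>)) \<le> v * norm \<tau> * cos (Arg \<tau> - \<psi>)"
        using v cos by (subst mult.commute) (auto intro!: mult_left_mono)
    qed
    also have "\<dots> = Re ((x + of_nat m + of_real v * \<tau>) * cis (- \<psi>))"
      by (rule Re_mult_cis_lattice[symmetric])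
    also have "\<dots> \<le> norm ((x + of_nat m + of_real v * \<tau>) * cis (- \<psi>))"
      by (rule complex_Re_le_cmod)
    finally show "c * min 1 (norm x) * (1 + real m + v * norm \<tau>) \<le> norm (x + of_nat m + of_real v * \<tau>)"
      by (simp add: norm_mult)
  qed
next
  \<comment> \<open>Now x is a negative non-integer and the points x + m lie on both half-axes. The
    hypothesis forces alpha > 0, so v tau has imaginary part at least v |tau| sin alpha.\<close>
  case True
  then have Imx: "Im x = 0" by (simp add: Arg_eq_pi)
  have \<alpha>: "\<alpha> > 0" using True arg by simp
  then have s: "sin \<alpha> > 0" using ab pi_gt_zero by (intro sin_gt_zero) auto
  obtain \<kappa> where \<kappa>: "\<kappa> > 0" "\<And>m::nat. norm (x + of_nat m) \<ge> \<kappa> * (1 + real m)"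
    using norm_add_of_nat_ge[OF x] by blast
  \<comment> \<open>With z the full point, |x + m| + v |tau| <= |z| + 2 v |tau|, and v |tau| <= |z|
    / sin alpha.\<close>
  define K where "K = 1 + 2 / sin \<alpha>"
  have K: "K > 0" using s by (simp add: K_def add_pos_pos)
  show ?thesis
  proof (rule that[of "min \<kappa> 1 / K"])
    show "min \<kappa> 1 / K > 0" using \<kappa> K by simp
    fix \<tau> and v :: real and m :: nat assume \<tau>: "\<tau> \<in> sector \<alpha> \<beta>" and v: "v \<ge> 0"
    let ?z = "x + of_nat m + of_real v * \<tau>"
    have "sin \<alpha> \<le> sin (Arg \<tau>)"
      using \<tau> ab by (intro sin_monotone_2pi_le) (auto simp: sector_Arg)
    moreover have "Im \<tau> = norm \<tau> * sin (Arg \<tau>)"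
      using arg_cong[OF rcis_cmod_Arg[of \<tau>], of Im] by simp
    ultimately have "norm \<tau> * sin \<alpha> \<le> Im \<tau>" by (simp add: mult_left_mono)
    then have "v * (norm \<tau> * sin \<alpha>) \<le> v * Im \<tau>" using v by (rule mult_left_mono)
    also have "\<dots> = Im ?z" using Imx by simp
    also have "\<dots> \<le> norm ?z" using abs_Im_le_cmod[of ?z] by linarith
    finally have 1: "2 * (v * norm \<tau>) \<le> 2 / sin \<alpha> * norm ?z"
      using s by (simp add: field_simps)
    have "norm (x + of_nat m) \<le> norm ?z + norm (of_real v * \<tau>)"
      using norm_triangle_ineq4[of ?z "of_real v * \<tau>"] by simp
    then have 2: "norm (x + of_nat m) \<le> norm ?z + v * norm \<tau>"
      using v by (simp add: norm_mult)
    have "min \<kappa> 1 * (1 + real m + v * norm \<tau>) = min \<kappa> 1 * (1 + real m) + min \<kappa> 1 * (v * norm \<tau>)"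
      by (simp add: algebra_simps)
    also have "\<dots> \<le> \<kappa> * (1 + real m) + 1 * (v * norm \<tau>)"
      using v by (intro add_mono mult_right_mono) auto
    also have "\<dots> \<le> K * norm ?z"
      using 1 2 \<kappa>(2)[of m] by (simp add: K_def distrib_right)
    finally show "min \<kappa> 1 / K * (1 + real m + v * norm \<tau>) \<le> norm ?z"
      using K by (simp add: field_simps)
  qed
qed

text \<open>If Im x >= 0, the whole cone lies in the closed upper half-plane, on which the principal
  logarithm is continuous up to the cut. If Im x < 0, the arguments in [beta - pi, beta] form a
  half-plane that contains 1, x and the sector and stays off the cut because beta > 0.\<close>

lemma cone_half_plane:
  fixes x :: complex
  assumes x: "x \<notin> \<int>\<^sub>\<le>\<^sub>0" and ab: "0 \<le> \<alpha>" "\<alpha> < \<beta>" "\<beta> \<le> pi / 2"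
    and arg: "\<beta> - pi < Arg x" "Arg x < pi + \<alpha>"
  obtains \<phi> where "- pi / 2 < \<phi>" "\<phi> \<le> pi / 2"
    "\<And>\<tau> v (m::nat). \<tau> \<in> sector \<alpha> \<beta> \<Longrightarrow> v \<ge> 0 \<Longrightarrow> x + of_nat m + of_real v * \<tau> \<in> half_plane \<phi>"
proof -
  obtain \<kappa> where \<kappa>: "\<kappa> > 0"
    "\<And>\<tau> v (m::nat). \<tau> \<in> sector \<alpha> \<beta> \<Longrightarrow> v \<ge> 0 \<Longrightarrow>
       norm (x + of_nat m + of_real v * \<tau>) \<ge> \<kappa> * (1 + real m + v * norm \<tau>)"
    using cone_lower_bound[OF assms] by blast
  have nz: "x + of_nat m + of_real v * \<tau> \<noteq> 0" if "\<tau> \<in> sector \<alpha> \<beta>" "v \<ge> 0" for \<tau> v and m :: nat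
  proof -
    have "0 < \<kappa> * (1 + real m + v * norm \<tau>)"
      using \<kappa>(1) that by (intro mult_pos_pos add_pos_nonneg mult_nonneg_nonneg) auto
    then show ?thesis using \<kappa>(2)[OF that, of m] by (metis norm_zero not_le)
  qed
  show ?thesis
  proof (cases "Im x \<ge> 0")
    case True
    show ?thesis
    proof (rule that[of "pi / 2"])
      fix \<tau> and v :: real and m :: nat assume \<tau>: "\<tau> \<in> sector \<alpha> \<beta>" and v: "v \<ge> 0"
      have "Im \<tau> \<ge> 0" using \<tau> ab Arg_less_0[of \<tau>] by (auto simp: sector_Arg)
      moreover have "Re (z * cis (- (pi / 2))) = Im z" for z
        by simp
      ultimately show "x + of_nat m + of_real v * \<tau> \<in> half_plane (pi / 2)"
        using nz[OF \<tau> v, of m] True v by (simp add: half_plane_def)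
    qed auto
  next
    case False
    then have Argx: "Arg x < 0" using Arg_less_0[of x] by linarith
    show ?thesis
    proof (rule that[of "\<beta> - pi / 2"])
      fix \<tau> and v :: real and m :: nat assume \<tau>: "\<tau> \<in> sector \<alpha> \<beta>" and v: "v \<ge> 0"
      have "0 \<le> cos (Arg x - (\<beta> - pi / 2))" "0 \<le> cos (\<beta> - pi / 2)" "0 \<le> cos (Arg \<tau> - (\<beta> - pi / 2))"
        using ab arg Argx \<tau> pi_gt_zero by (auto intro!: cos_ge_zero simp: sector_Arg)
      then show "x + of_nat m + of_real v * \<tau> \<in> half_plane (\<beta> - pi / 2)"
        unfolding half_plane_def mem_Collect_eq
        using nz[OF \<tau> v, of m] v by (subst Re_mult_cis_lattice) auto
    qed (use ab in auto)
  qed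
qed

section \<open>Hurwitz sums near \<open>s = 0\<close>\<close>

lemma gbinomial_low_orders:
  fixes b :: complex
  shows "b gchoose 0 = 1" "b gchoose 1 = b" "b gchoose 2 = b * (b - 1) / 2"
    "b gchoose 3 = b * (b - 1) * (b - 2) / 6"
  by (simp_all add: gbinomial_prod_rev numeral_2_eq_2 numeral_3_eq_3 algebra_simps)

lemma powr_Taylor_polynomials:
  fixes b r :: complex
  shows "(\<Sum>k<2. (b gchoose k) * r ^ k) = 1 + b * r"
    and "(\<Sum>k<3. (b gchoose k) * r ^ k) = 1 + b * r + b * (b - 1) / 2 * r\<^sup>2"
    and "(\<Sum>k<4. (b gchoose k) * r ^ k) = 1 + b * r + b * (b - 1) / 2 * r\<^sup>2 + b * (b - 1) * (b - 2) / 6 * r ^ 3"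
proof -
  have *: "{..<2} = {0, 1::nat}" "{..<3} = {0, 1, 2::nat}" "{..<4} = {0, 1, 2, 3::nat}" by auto
  show "(\<Sum>k<2. (b gchoose k) * r ^ k) = 1 + b * r"
    "(\<Sum>k<3. (b gchoose k) * r ^ k) = 1 + b * r + b * (b - 1) / 2 * r\<^sup>2"
    "(\<Sum>k<4. (b gchoose k) * r ^ k) = 1 + b * r + b * (b - 1) / 2 * r\<^sup>2 + b * (b - 1) * (b - 2) / 6 * r ^ 3"
    unfolding * by (simp_all add: gbinomial_low_orders)
qed

text \<open>Euler--Maclaurin approximation of \<open>\<Sum>k. (p + k) powr (1 - s)\<close>.\<close>

definition em_sum :: "complex \<Rightarrow> complex \<Rightarrow> complex" where
  "em_sum s p = p powr (2 - s) / (s - 2) + p powr (1 - s) / 2 + (s - 1) / 12 * p powr (- s)"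

text \<open>The error of a single step: an exact sum S over p, p + 1, ... would satisfy S(p) - S(p +
  1) = p^(1 - s).\<close>

definition em_defect :: "complex \<Rightarrow> complex \<Rightarrow> complex" where
  "em_defect s p = p powr (1 - s) - em_sum s p + em_sum s (p + 1)"

lemma powr_minus_numeral:
  fixes p :: complex
  assumes "p \<noteq> 0"
  shows "p powr (1 - s) = p powr (- s) * p" "p powr (2 - s) = p powr (- s) * p\<^sup>2"
    "p powr (- 1 - s) = p powr (- s) / p"
  using assms by (simp_all add: powr_diff powr_minus power2_eq_square field_simps)

text \<open>In r = 1/p the three terms of \<open>em_sum\<close> carry the factors p^2, p and 1, so
  remainders of orders 4, 3 and 2 all contribute p^2 r^4, and the polynomial parts cancel. The
  resulting decay |p|^(-2 - sigma) is summable for sigma > -1. The summands 16 / d, 4 and (B + 1) /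
  3 come from the three remainders in turn; d is a distance from the pole s = 2.\<close>

lemma em_defect_bound:
  assumes \<phi>: "- pi / 2 < \<phi>" "\<phi> \<le> pi / 2" and p: "p \<in> half_plane \<phi>" "p + 1 \<in> half_plane \<phi>"
    and p2: "norm p \<ge> 2" and s: "\<sigma> \<le> Re s" "norm s \<le> B" "d \<le> norm (s - 2)" "d > 0"
  shows "norm (em_defect s p) \<le>
    exp (pi * B) * 2 powr (B + 2) * (16 / d + 4 + (B + 1) / 3) * norm p powr (- (2 + \<sigma>))"
proof -
  define r where "r = 1 / p"
  have pnz: "p \<noteq> 0" using p2 by auto
  have r: "norm r \<le> 1 / 2" using p2 by (simp add: r_def norm_divide divide_le_eq)
  have s2: "s \<noteq> 2" using s by auto
  define E where "E = (\<lambda>n b. (1 + r) powr b - (\<Sum>k<n. (b gchoose k) * r ^ k))"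
  have B: "B \<ge> 0" using s(2) norm_ge_zero[of s] by linarith
  have E: "norm (E n b) \<le> 2 powr (B + 2) * (2 * norm r) ^ n" if "norm b \<le> B + 2" for n b
    unfolding E_def using r that by (rule powr_Taylor_remainder)
  have shift: "(p + 1) powr b = p powr b * (1 + r) powr b" for b
    unfolding r_def using powr_add_half_plane[OF \<phi> p] p2 by simp
  have pw: "p powr (1 - s) = p powr (- s) * p" "p powr (2 - s) = p powr (- s) * p\<^sup>2"
    using powr_minus_numeral[OF pnz] by auto
  define D where "D = E 4 (2 - s) / (s - 2) + r / 2 * E 3 (1 - s) + (s - 1) / 12 * r\<^sup>2 * E 2 (- s)"
  have "em_defect s p = p powr (- s) * (p + p\<^sup>2 * ((1 + r) powr (2 - s) - 1) / (s - 2)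
      + p * ((1 + r) powr (1 - s) - 1) / 2 + (s - 1) / 12 * ((1 + r) powr (- s) - 1))"
    unfolding em_defect_def em_sum_def shift pw by (simp add: algebra_simps diff_divide_distrib)
  also have "p + p\<^sup>2 * ((1 + r) powr (2 - s) - 1) / (s - 2)
      + p * ((1 + r) powr (1 - s) - 1) / 2 + (s - 1) / 12 * ((1 + r) powr (- s) - 1) = p\<^sup>2 * D"
  proof -
    have pr: "p * r = 1" using pnz by (simp add: r_def)
    have "(1 + r) powr (2 - s) - 1 = E 4 (2 - s) - (s - 2) * (r + (1 - s) / 2 * r\<^sup>2 - (1 - s) * s / 6 * r ^ 3)"
      unfolding E_def powr_Taylor_polynomials by (simp add: field_simps)
    then have e4: "((1 + r) powr (2 - s) - 1) / (s - 2) =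
        E 4 (2 - s) / (s - 2) - (r + (1 - s) / 2 * r\<^sup>2 - (1 - s) * s / 6 * r ^ 3)"
      using s2 by (simp add: diff_divide_distrib)
    have e3: "(1 + r) powr (1 - s) - 1 = E 3 (1 - s) + ((1 - s) * r - (1 - s) * s / 2 * r\<^sup>2)"
      and e2: "(1 + r) powr (- s) - 1 = E 2 (- s) - s * r"
      unfolding E_def powr_Taylor_polynomials by (simp_all add: field_simps)
    have ring: "r + (a - (r + (1 - s) / 2 * r\<^sup>2 - (1 - s) * s / 6 * r ^ 3))
        + r * (b + ((1 - s) * r - (1 - s) * s / 2 * r\<^sup>2)) / 2 + (s - 1) / 12 * r\<^sup>2 * (c - s * r)
        = a + r / 2 * b + (s - 1) / 12 * r\<^sup>2 * c" for a b c :: complex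
      by (simp add: field_simps power2_eq_square power3_eq_cube)
    have fac: "p + p\<^sup>2 * x / (s - 2) + p * y / 2 + (s - 1) / 12 * z =
        p\<^sup>2 * (r + x / (s - 2) + r * y / 2 + (s - 1) / 12 * r\<^sup>2 * z)" for x y z :: complex
    proof -
      have "p\<^sup>2 * (r + x / (s - 2) + r * y / 2 + (s - 1) / 12 * r\<^sup>2 * z) =
          p * (p * r) + p\<^sup>2 * x / (s - 2) + p * (p * r) * y / 2 + (s - 1) / 12 * (p * r)\<^sup>2 * z"
        by (simp add: ring_distribs power2_eq_square power_mult_distrib mult_ac)
      then show ?thesis unfolding pr by simp
    qed
    show ?thesis
      unfolding fac e4 e3 e2 ring D_def ..
  qed
  finally have eq: "em_defect s p = p powr (- s) * (p\<^sup>2 * D)" .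
  have "norm D \<le> 2 powr (B + 2) * (16 / d + 4 + (B + 1) / 3) * norm r ^ 4"
  proof -
    have "norm (E 4 (2 - s) / (s - 2)) \<le> 2 powr (B + 2) * (2 * norm r) ^ 4 / d"
      unfolding norm_divide using s norm_triangle_ineq4[of 2 s]
      by (intro frac_le E) auto
    also have "\<dots> = 2 powr (B + 2) * norm r ^ 4 * (16 / d)"
      by (simp add: power_mult_distrib)
    finally have 1: "norm (E 4 (2 - s) / (s - 2)) \<le> 2 powr (B + 2) * norm r ^ 4 * (16 / d)" .
    have "norm (r / 2 * E 3 (1 - s)) \<le> norm r / 2 * (2 powr (B + 2) * (2 * norm r) ^ 3)"
      unfolding norm_mult using s(2) norm_triangle_ineq4[of 1 s]
      by (intro mult_mono E) (auto simp: norm_divide)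
    also have "\<dots> = 2 powr (B + 2) * norm r ^ 4 * 4"
      by (simp add: power_mult_distrib power3_eq_cube power4_eq_xxxx)
    finally have 2: "norm (r / 2 * E 3 (1 - s)) \<le> 2 powr (B + 2) * norm r ^ 4 * 4" .
    have "norm ((s - 1) / 12 * r\<^sup>2 * E 2 (- s)) \<le> (B + 1) / 12 * norm r ^ 2 * (2 powr (B + 2) * (2 * norm r) ^ 2)"
      unfolding norm_mult using s(2) B norm_triangle_ineq4[of s 1]
      by (intro mult_mono E) (auto simp: norm_divide norm_power)
    also have "\<dots> = 2 powr (B + 2) * norm r ^ 4 * ((B + 1) / 3)"
      by (simp add: power_mult_distrib power2_eq_square power4_eq_xxxx)
    finally have 3: "norm ((s - 1) / 12 * r\<^sup>2 * E 2 (- s)) \<le> 2 powr (B + 2) * norm r ^ 4 * ((B + 1) / 3)" .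
    have "norm D \<le> norm (E 4 (2 - s) / (s - 2)) + norm (r / 2 * E 3 (1 - s)) + norm ((s - 1) / 12 * r\<^sup>2 * E 2 (- s))"
      unfolding D_def by (intro order_trans[OF norm_triangle_ineq] add_mono) auto
    also have "\<dots> \<le> 2 powr (B + 2) * norm r ^ 4 * (16 / d) + 2 powr (B + 2) * norm r ^ 4 * 4 + 2 powr (B + 2) * norm r ^ 4 * ((B + 1) / 3)"
      using 1 2 3 by (intro add_mono)
    finally show ?thesis by (simp add: algebra_simps)
  qed
  then have "norm (em_defect s p) \<le> exp (pi * B) * norm p powr (- \<sigma>) *
      (norm p ^ 2 * (2 powr (B + 2) * (16 / d + 4 + (B + 1) / 3) * norm r ^ 4))"
    unfolding eq norm_mult norm_power using s p2
    by (intro mult_mono norm_powr_minus_le mult_left_mono) auto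
  also have "\<dots> = exp (pi * B) * 2 powr (B + 2) * (16 / d + 4 + (B + 1) / 3) * (norm p powr (- \<sigma>) / norm p ^ 2)"
    using pnz by (simp add: r_def norm_divide power_divide power2_eq_square power4_eq_xxxx)
  also have "norm p powr (- \<sigma>) / norm p ^ 2 = norm p powr (- (2 + \<sigma>))"
  proof -
    have "- (2 + \<sigma>) = - \<sigma> - 2" by simp
    then show ?thesis using pnz by (simp only: powr_diff) simp
  qed
  finally show ?thesis .
qed

text \<open>One Euler--Maclaurin term is enough here: the integral of s p^(-1 - s) is p^(-s), and
  the telescoped difference leaves a second-order binomial remainder. The factor s cancels the pole
  at s = 0.\<close>

lemma powr_telescope_bound:
  assumes \<phi>: "- pi / 2 < \<phi>" "\<phi> \<le> pi / 2" and p: "p \<in> half_plane \<phi>" "p + 1 \<in> half_plane \<phi>"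
    and p2: "norm p \<ge> 2" and s: "\<sigma> \<le> Re s" "norm s \<le> B"
  shows "norm (s * p powr (- 1 - s) - p powr (- s) + (p + 1) powr (- s)) \<le>
    exp (pi * B) * (4 * 2 powr B) * norm p powr (- (2 + \<sigma>))"
proof -
  define r where "r = 1 / p"
  have pnz: "p \<noteq> 0" using p2 by auto
  have r: "norm r \<le> 1 / 2" using p2 by (simp add: r_def norm_divide divide_le_eq)
  have shift: "(p + 1) powr (- s) = p powr (- s) * (1 + r) powr (- s)"
    unfolding r_def using powr_add_half_plane[OF \<phi> p] p2 by simp
  have "s * p powr (- 1 - s) - p powr (- s) + (p + 1) powr (- s) =
      p powr (- s) * ((1 + r) powr (- s) - (\<Sum>k<2. (- s gchoose k) * r ^ k))"
    unfolding shift powr_Taylor_polynomials powr_minus_numeral[OF pnz]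
    by (simp add: r_def algebra_simps)
  also have "norm \<dots> \<le> exp (pi * B) * norm p powr (- \<sigma>) * (2 powr B * (2 * norm r) ^ 2)"
    unfolding norm_mult using s p2 r
    by (intro mult_mono norm_powr_minus_le powr_Taylor_remainder) auto
  also have "\<dots> = exp (pi * B) * (4 * 2 powr B) * (norm p powr (- \<sigma>) / norm p ^ 2)"
    by (simp add: r_def norm_divide power_mult_distrib power_divide)
  also have "norm p powr (- \<sigma>) / norm p ^ 2 = norm p powr (- (2 + \<sigma>))"
  proof -
    have "- (2 + \<sigma>) = - \<sigma> - 2" by simp
    then show ?thesis using pnz by (simp only: powr_diff) simp
  qed
  finally show ?thesis .
qed

lemma infsum_telescope:
  fixes f :: "nat \<Rightarrow> 'a :: banach"
  assumes "f \<longlonglongrightarrow> 0" "(\<lambda>m. f m - f (Suc m)) summable_on UNIV"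
  shows "(\<Sum>\<^sub>\<infinity>m. f m - f (Suc m)) = f 0"
proof -
  have "(\<lambda>m. f m - f (Suc m)) sums (f 0 - 0)"
    using assms(1) by (rule telescope_sums')
  moreover have "(\<lambda>m. f m - f (Suc m)) sums (\<Sum>\<^sub>\<infinity>m. f m - f (Suc m))"
    using assms(2) by (intro has_sum_imp_sums) simp
  ultimately show ?thesis by (simp add: sums_unique2)
qed

lemma compact_norm_diff_ge:
  fixes a :: complex
  assumes "compact C" "a \<notin> C"
  obtains d where "d > 0" "\<And>s. s \<in> C \<Longrightarrow> d \<le> norm (s - a)"
  using separate_point_closed[OF compact_imp_closed[OF assms(1)] assms(2)]
  by (metis dist_commute dist_norm)

text \<open>The derivative of \<open>em_sum s p\<close> at s = 0. Apart from the constant 1/12 this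
  is the Glaisher--Kinkelin asymptotic expansion of the sum of k ln k over k < p.\<close>

definition em_sum_deriv :: "complex \<Rightarrow> complex" where
  "em_sum_deriv p = (p\<^sup>2 / 2 - p / 2 + 1 / 12) * Ln p - p\<^sup>2 / 4 + 1 / 12"

lemma has_field_derivative_powr_diff:
  fixes p :: complex
  assumes "p \<noteq> 0"
  shows "((\<lambda>s. p powr (c - s)) has_field_derivative - (Ln p * p powr (c - s))) (at s)"
  using assms unfolding powr_def by (auto intro!: derivative_eq_intros)

lemma has_field_derivative_em_sum:
  assumes "p \<noteq> 0"
  shows "((\<lambda>s. em_sum s p) has_field_derivative em_sum_deriv p) (at 0)"
proof -
  have pw: "p powr 2 = p\<^sup>2" "p powr 1 = p" "p powr 0 = 1"
    using assms powr_nat'[of p 2] by auto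
  have "((\<lambda>s. em_sum s p) has_field_derivative
     ((- (Ln p * p powr (2 - 0))) * (0 - 2) - p powr (2 - 0) * 1) / ((0 - 2) * (0 - 2))
     + - (Ln p * p powr (1 - 0)) / 2 + (1 / 12 * p powr (- 0) + (0 - 1) / 12 * - (Ln p * p powr (- 0)))) (at 0)"
    unfolding em_sum_def
    using assms has_field_derivative_powr_diff[OF assms, of 0 0]
    by (auto intro!: derivative_eq_intros has_field_derivative_powr_diff) (simp add: field_simps)
  from this show ?thesis
    by (rule DERIV_cong) (use assms in \<open>simp add: pw em_sum_deriv_def field_simps\<close>)
qed

lemma em_sum_0:
  assumes "p \<noteq> 0"
  shows "em_sum 0 p = - p\<^sup>2 / 2 + p / 2 - 1 / 12"
  using assms powr_nat'[of p 2] by (simp add: em_sum_def)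

lemma holomorphic_on_em_sum: "2 \<notin> A \<Longrightarrow> (\<lambda>s. em_sum s p) holomorphic_on A"
  unfolding em_sum_def by (intro holomorphic_intros) auto

lemma holomorphic_on_em_defect: "2 \<notin> A \<Longrightarrow> (\<lambda>s. em_defect s p) holomorphic_on A"
  unfolding em_defect_def by (intro holomorphic_intros holomorphic_on_em_sum)

text \<open>Only the points x + m enter here, without tau, so that the same construction at x = 1
  yields the Riemann zeta function.\<close>

locale hurwitz_sequence =
  fixes x :: complex and \<phi> \<kappa> :: real
  assumes \<phi>: "- pi / 2 < \<phi>" "\<phi> \<le> pi / 2" and \<kappa>: "\<kappa> > 0"
    and in_half_plane: "\<And>m::nat. x + of_nat m \<in> half_plane \<phi>"
    and lower: "\<And>m::nat. norm (x + of_nat m) \<ge> \<kappa> * (1 + real m)"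
begin

text \<open>The Hurwitz zeta function at s - 1, continued to Re s > -1; the shift puts the point of
  interest at s = 0 and the pole at s = 2.\<close>

definition hurwitz :: "complex \<Rightarrow> complex" where
  "hurwitz s = em_sum s x + (\<Sum>\<^sub>\<infinity>m::nat. em_defect s (x + of_nat m))"

text \<open>This is s times the Hurwitz zeta function at s + 1, which is regular at s = 0.\<close>

definition hurwitz_shift :: "complex \<Rightarrow> complex" where
  "hurwitz_shift s = x powr (- s) +
     (\<Sum>\<^sub>\<infinity>m::nat. s * (x + of_nat m) powr (- 1 - s) - (x + of_nat m) powr (- s) + (x + of_nat m + 1) powr (- s))"

lemma nonzero: "x + of_nat m \<noteq> 0" "x \<noteq> 0"
  using half_plane_nonzero[OF in_half_plane[of m]] half_plane_nonzero[OF in_half_plane[of 0]] by auto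

lemma in_half_plane_Suc: "x + of_nat m + 1 \<in> half_plane \<phi>"
  using in_half_plane[of "Suc m"] by (simp add: add_ac)

lemma finite_small: "finite {m::nat. norm (x + of_nat m) < c}"
proof (rule finite_subset)
  show "{m::nat. norm (x + of_nat m) < c} \<subseteq> {..nat \<lceil>c / \<kappa>\<rceil>}"
  proof (rule subsetI)
    fix m :: nat assume "m \<in> {m::nat. norm (x + of_nat m) < c}"
    then have "norm (x + of_nat m) < c" by simp
    then have "\<kappa> * (1 + real m) < c" using lower[of m] by linarith
    then have "1 + real m < c / \<kappa>" using \<kappa> by (simp add: field_simps)
    then show "m \<in> {..nat \<lceil>c / \<kappa>\<rceil>}" by simp linarith
  qed
qed simp

lemma summable_norm_powr:
  assumes "\<rho> > 1"
  shows "(\<lambda>m::nat. norm (x + of_nat m) powr (- \<rho>)) summable_on UNIV"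
proof (rule summable_on_comparison_test)
  show "(\<lambda>m. \<kappa> powr (- \<rho>) * (1 + real m) powr (- \<rho>)) summable_on UNIV"
    using assms by (intro summable_on_cmult_right summable_on_Suc_powr)
  show "norm (x + of_nat m) powr (- \<rho>) \<le> \<kappa> powr (- \<rho>) * (1 + real m) powr (- \<rho>)" for m
  proof -
    have "norm (x + of_nat m) powr (- \<rho>) \<le> (\<kappa> * (1 + real m)) powr (- \<rho>)"
      using \<kappa> assms lower by (intro powr_mono2') auto
    then show ?thesis using \<kappa> by (simp add: powr_mult)
  qed
qed auto

lemma summable_powr:
  assumes "Re s > 1"
  shows "(\<lambda>m::nat. (x + of_nat m) powr (- s)) summable_on UNIV"
proof (rule summable_on_powr_series[of UNIV "\<lambda>m::nat. x + of_nat m" 1])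
  show "finite {m\<in>UNIV. norm (x + of_nat m) < 1}" using finite_small[of 1] by simp
qed (use assms summable_norm_powr in auto)

lemma powr_tendsto_0:
  assumes "Re b < 0"
  shows "(\<lambda>m::nat. (x + of_nat m) powr b) \<longlonglongrightarrow> 0"
proof (rule Lim_null_comparison)
  show "\<forall>\<^sub>F m in sequentially. norm ((x + of_nat m) powr b) \<le> exp (pi * \<bar>Im b\<bar>) * \<kappa> powr Re b * (1 + real m) powr Re b"
  proof (rule always_eventually, rule allI)
    fix m :: nat
    have "norm ((x + of_nat m) powr b) \<le> norm (x + of_nat m) powr Re b * exp (pi * \<bar>Im b\<bar>)"
      by (rule norm_powr_le)
    also have "norm (x + of_nat m) powr Re b \<le> (\<kappa> * (1 + real m)) powr Re b"
      using \<kappa> assms lower by (intro powr_mono2') auto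
    finally show "norm ((x + of_nat m) powr b) \<le> exp (pi * \<bar>Im b\<bar>) * \<kappa> powr Re b * (1 + real m) powr Re b"
      using \<kappa> by (simp add: powr_mult mult_ac)
  qed
  have "filterlim (\<lambda>m::nat. 1 + real m) at_top sequentially"
    by (intro filterlim_tendsto_add_at_top[OF tendsto_const] filterlim_real_sequentially)
  from tendsto_neg_powr[OF assms this]
  show "(\<lambda>m. exp (pi * \<bar>Im b\<bar>) * \<kappa> powr Re b * (1 + real m) powr Re b) \<longlonglongrightarrow> 0"
    by (intro tendsto_mult_right_zero)
qed

lemma defect_dominated:
  assumes C: "compact C" "C \<subseteq> {s. Re s > - 1} - {2}"
  shows "\<exists>M J. finite J \<and> M summable_on UNIV \<and> (\<forall>m\<in>UNIV - J. \<forall>s\<in>C. norm (em_defect s (x + of_nat m)) \<le> M m)"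
proof -
  obtain \<sigma> B where \<sigma>: "\<sigma> > - 1" and C': "\<And>s. s \<in> C \<Longrightarrow> Re s \<ge> \<sigma>" "\<And>s. s \<in> C \<Longrightarrow> norm s \<le> B"
    using compact_subset_Re_gt[of C "-1"] C by blast
  obtain d where d: "d > 0" "\<And>s. s \<in> C \<Longrightarrow> d \<le> norm (s - 2)"
    using compact_norm_diff_ge[OF C(1), of 2] C(2) by blast
  define M where "M = (\<lambda>m. exp (pi * B) * 2 powr (B + 2) * (16 / d + 4 + (B + 1) / 3) * norm (x + of_nat m) powr (- (2 + \<sigma>)))"
  have "M summable_on UNIV"
    unfolding M_def using \<sigma> by (intro summable_on_cmult_right summable_norm_powr) auto
  moreover have "norm (em_defect s (x + of_nat m)) \<le> M m"
    if "s \<in> C" "m \<in> UNIV - {m::nat. norm (x + of_nat m) < 2}" for s m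
    unfolding M_def using that C' d
    by (intro em_defect_bound[OF \<phi> in_half_plane in_half_plane_Suc]) auto
  ultimately show ?thesis
    by (intro exI[of _ M] exI[of _ "{m::nat. norm (x + of_nat m) < 2}"] conjI ballI finite_small)
qed

lemma telescope_dominated:
  assumes C: "compact C" "C \<subseteq> {s. Re s > - 1}"
  shows "\<exists>M J. finite J \<and> M summable_on UNIV \<and> (\<forall>m\<in>UNIV - J. \<forall>s\<in>C.
    norm (s * (x + of_nat m) powr (- 1 - s) - (x + of_nat m) powr (- s) + (x + of_nat m + 1) powr (- s)) \<le> M m)"
proof -
  obtain \<sigma> B where \<sigma>: "\<sigma> > - 1" and C': "\<And>s. s \<in> C \<Longrightarrow> Re s \<ge> \<sigma>" "\<And>s. s \<in> C \<Longrightarrow> norm s \<le> B"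
    using compact_subset_Re_gt[OF C] by blast
  define M where "M = (\<lambda>m. exp (pi * B) * (4 * 2 powr B) * norm (x + of_nat m) powr (- (2 + \<sigma>)))"
  have "M summable_on UNIV"
    unfolding M_def using \<sigma> by (intro summable_on_cmult_right summable_norm_powr) auto
  moreover have "norm (s * (x + of_nat m) powr (- 1 - s) - (x + of_nat m) powr (- s) + (x + of_nat m + 1) powr (- s)) \<le> M m"
    if "s \<in> C" "m \<in> UNIV - {m::nat. norm (x + of_nat m) < 2}" for s m
    unfolding M_def using that C'
    by (intro powr_telescope_bound[OF \<phi> in_half_plane in_half_plane_Suc]) auto
  ultimately show ?thesis
    by (intro exI[of _ M] exI[of _ "{m::nat. norm (x + of_nat m) < 2}"] conjI ballI finite_small)
qed

lemma open_strip: "open ({s. Re s > - 1} - {2 :: complex})"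
  using open_Re_gt by (intro open_Diff) auto

lemma hurwitz_holomorphic: "hurwitz holomorphic_on {s. Re s > - 1} - {2}"
  unfolding hurwitz_def[abs_def]
  by (intro holomorphic_intros holomorphic_on_em_sum
       holomorphic_on_infsum[OF open_strip holomorphic_on_em_defect defect_dominated]) auto

lemma hurwitz_shift_holomorphic: "hurwitz_shift holomorphic_on {s. Re s > - 1}"
  unfolding hurwitz_shift_def[abs_def]
  by (intro holomorphic_intros holomorphic_on_infsum[OF open_Re_gt _ telescope_dominated]) auto

text \<open>The terms are the defects plus differences of \<open>em_sum\<close>. For Re s > 2 every
  power in \<open>em_sum\<close> tends to 0, so the differences telescope to
  \<open>em_sum s x\<close>.\<close>

lemma has_sum_hurwitz:
  assumes s: "Re s > 2"
  shows "((\<lambda>m::nat. (x + of_nat m) powr (1 - s)) has_sum hurwitz s) UNIV"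
proof -
  define h where "h = (\<lambda>m::nat. em_sum s (x + of_nat m))"
  have "s \<in> {s. Re s > - 1} - {2}" using s by auto
  then have 1: "(\<lambda>m::nat. em_defect s (x + of_nat m)) summable_on UNIV"
    using summable_on_dominated[OF open_strip holomorphic_on_em_defect defect_dominated] by simp
  have 2: "(\<lambda>m::nat. (x + of_nat m) powr (1 - s)) summable_on UNIV"
    using summable_powr[of "s - 1"] s by simp
  have eq: "(x + of_nat m) powr (1 - s) = em_defect s (x + of_nat m) + (h m - h (Suc m))" for m
    by (simp add: em_defect_def h_def add_ac)
  have 3: "(\<lambda>m. h m - h (Suc m)) summable_on UNIV"
    using summable_on_add[OF 2 summable_on_uminus[THEN iffD2, OF 1]] by (simp add: eq)
  have "h \<longlonglongrightarrow> 0 / (s - 2) + 0 / 2 + (s - 1) / 12 * 0"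
    unfolding h_def em_sum_def using s by (intro tendsto_intros powr_tendsto_0) auto
  then have "(\<Sum>\<^sub>\<infinity>m. h m - h (Suc m)) = h 0" using 3 by (intro infsum_telescope) auto
  moreover have "h 0 = em_sum s x" by (simp add: h_def)
  ultimately have "((\<lambda>m. h m - h (Suc m)) has_sum em_sum s x) UNIV"
    using has_sum_infsum[OF 3] by (simp only:)
  from has_sum_add[OF has_sum_infsum[OF 1] this] show ?thesis
    by (simp add: eq hurwitz_def add.commute)
qed

lemma has_sum_hurwitz_shift:
  assumes s: "Re s > 0"
  shows "((\<lambda>m::nat. s * (x + of_nat m) powr (- 1 - s)) has_sum hurwitz_shift s) UNIV"
proof -
  define h where "h = (\<lambda>m::nat. (x + of_nat m) powr (- s))"
  define e where "e = (\<lambda>m::nat. s * (x + of_nat m) powr (- 1 - s) - (x + of_nat m) powr (- s) + (x + of_nat m + 1) powr (- s))"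
  have 1: "e summable_on UNIV"
    unfolding e_def
  proof (rule summable_on_dominated[OF open_Re_gt[of "- 1"] _ telescope_dominated])
    show "(\<lambda>s. s * (x + of_nat m) powr (- 1 - s) - (x + of_nat m) powr (- s) + (x + of_nat m + 1) powr (- s))
        holomorphic_on {s. Re s > - 1}" for m
      by (intro holomorphic_intros)
  qed (use s in auto)
  have 2: "(\<lambda>m::nat. s * (x + of_nat m) powr (- 1 - s)) summable_on UNIV"
    using summable_on_cmult_right[OF summable_powr[of "1 + s"]] s by simp
  have eq: "s * (x + of_nat m) powr (- 1 - s) = e m + (h m - h (Suc m))" for m
    by (simp add: e_def h_def add_ac)
  have 3: "(\<lambda>m. h m - h (Suc m)) summable_on UNIV"
    using summable_on_add[OF 2 summable_on_uminus[THEN iffD2, OF 1]] by (simp add: eq)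
  have "h \<longlonglongrightarrow> 0"
    unfolding h_def using s by (intro powr_tendsto_0) auto
  then have "(\<Sum>\<^sub>\<infinity>m. h m - h (Suc m)) = h 0" using 3 by (intro infsum_telescope) auto
  moreover have "h 0 = x powr (- s)" by (simp add: h_def)
  ultimately have "((\<lambda>m. h m - h (Suc m)) has_sum x powr (- s)) UNIV"
    using has_sum_infsum[OF 3] by (simp only:)
  from has_sum_add[OF has_sum_infsum[OF 1] this]
  have "((\<lambda>m. e m + (h m - h (Suc m))) has_sum (infsum e UNIV + x powr (- s))) UNIV" .
  moreover have "infsum e UNIV + x powr (- s) = hurwitz_shift s"
    by (simp add: hurwitz_shift_def e_def add.commute)
  ultimately show ?thesis by (simp only: eq)
qed

text \<open>At s = 0 the summand is linear in p and the Euler--Maclaurin formula is exact. The value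
  is -B_2(x) / 2 with the Bernoulli polynomial B_2.\<close>

lemma hurwitz_0: "hurwitz 0 = - x\<^sup>2 / 2 + x / 2 - 1 / 12"
proof -
  have "em_defect 0 p = 0" if "p \<noteq> 0" "p + 1 \<noteq> 0" for p
    using that by (simp add: em_defect_def em_sum_0 field_simps power2_eq_square)
  then have "em_defect 0 (x + of_nat m) = 0" for m
    using nonzero(1)[of m] half_plane_nonzero[OF in_half_plane_Suc[of m]] by blast
  then show ?thesis using nonzero(2) by (simp add: hurwitz_def em_sum_0)
qed

text \<open>Termwise differentiation turns each defect into -p Ln p plus a difference of
  \<open>em_sum_deriv\<close>. In the partial sums these differences telescope, and the initial
  value \<open>em_sum_deriv x\<close> cancels against the derivative of the explicit part of
  \<open>hurwitz\<close>.\<close>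

lemma hurwitz_deriv_0:
  "(\<lambda>N. em_sum_deriv (x + of_nat N) - (\<Sum>m<N. (x + of_nat m) * Ln (x + of_nat m))) \<longlonglongrightarrow> deriv hurwitz 0"
proof -
  let ?U = "{s. Re s > - 1} - {2 :: complex}"
  let ?D = "\<lambda>s. \<Sum>\<^sub>\<infinity>m::nat. em_defect s (x + of_nat m)"
  have U: "0 \<in> ?U" by simp
  have hol: "?D holomorphic_on ?U"
    by (rule holomorphic_on_infsum[OF open_strip holomorphic_on_em_defect defect_dominated]) auto
  have d: "deriv (\<lambda>s. em_defect s (x + of_nat m)) 0 = - ((x + of_nat m) * Ln (x + of_nat m))
      + (em_sum_deriv (x + of_nat (Suc m)) - em_sum_deriv (x + of_nat m))" for m
  proof -
    have p: "x + of_nat m \<noteq> 0" by (rule nonzero)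
    have p1: "x + of_nat m + 1 \<noteq> 0" using half_plane_nonzero[OF in_half_plane_Suc] .
    have "((\<lambda>s. em_defect s (x + of_nat m)) has_field_derivative
        - (Ln (x + of_nat m) * (x + of_nat m) powr (1 - 0)) - em_sum_deriv (x + of_nat m) + em_sum_deriv (x + of_nat m + 1)) (at 0)"
      unfolding em_defect_def using p
      by (auto intro!: derivative_eq_intros has_field_derivative_em_sum[OF p] has_field_derivative_em_sum[OF p1]
           has_field_derivative_powr_diff[OF p, of 1 0, simplified])
    then show ?thesis using p by (auto dest!: DERIV_imp_deriv simp: add_ac mult_ac)
  qed
  have "((\<lambda>m. deriv (\<lambda>s. em_defect s (x + of_nat m)) 0) has_sum deriv ?D 0) UNIV"
    by (rule deriv_infsum_has_sum[OF open_strip holomorphic_on_em_defect defect_dominated U]) auto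
  then have "(\<lambda>N. \<Sum>m<N. deriv (\<lambda>s. em_defect s (x + of_nat m)) 0) \<longlonglongrightarrow> deriv ?D 0"
    by (intro has_sum_imp_sums[unfolded sums_def])
  also have "(\<lambda>N. \<Sum>m<N. deriv (\<lambda>s. em_defect s (x + of_nat m)) 0) =
     (\<lambda>N. em_sum_deriv (x + of_nat N) - (\<Sum>m<N. (x + of_nat m) * Ln (x + of_nat m)) - em_sum_deriv x)"
  proof
    fix N
    have "(\<Sum>m<N. em_sum_deriv (x + of_nat (Suc m)) - em_sum_deriv (x + of_nat m)) = em_sum_deriv (x + of_nat N) - em_sum_deriv x"
      using sum_lessThan_telescope[of "\<lambda>m. em_sum_deriv (x + of_nat m)" N] by simp
    then show "(\<Sum>m<N. deriv (\<lambda>s. em_defect s (x + of_nat m)) 0) =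
      em_sum_deriv (x + of_nat N) - (\<Sum>m<N. (x + of_nat m) * Ln (x + of_nat m)) - em_sum_deriv x"
      unfolding d sum.distrib sum_negf by simp
  qed
  finally have lim: "(\<lambda>N. em_sum_deriv (x + of_nat N) - (\<Sum>m<N. (x + of_nat m) * Ln (x + of_nat m)) - em_sum_deriv x)
    \<longlonglongrightarrow> deriv ?D 0" .
  have "(hurwitz has_field_derivative em_sum_deriv x + deriv ?D 0) (at 0)"
    unfolding hurwitz_def[abs_def]
    by (intro DERIV_add has_field_derivative_em_sum nonzero holomorphic_derivI[OF hol open_strip U])
  then have "deriv hurwitz 0 = em_sum_deriv x + deriv ?D 0" by (rule DERIV_imp_deriv)
  with tendsto_add[OF tendsto_const[of "em_sum_deriv x"] lim] show ?thesis by simp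
qed

end

section \<open>The Riemann zeta function as the case x = 1\<close>

interpretation zeta: hurwitz_sequence 1 0 1
proof
  show "1 + of_nat m \<in> half_plane 0" for m :: nat
    by (rule pos_Re_in_half_plane) simp
  show "norm (1 + of_nat m :: complex) \<ge> 1 * (1 + real m)" for m :: nat
    using complex_Re_le_cmod[of "1 + of_nat m"] by simp
qed auto

text \<open>The identity of \<open>riemann_zeta w\<close> with \<open>zeta.hurwitz (w + 1)\<close>
  is read off from the series for Re w > 1 and carried to a neighbourhood of -1 by unique
  continuation; the half-plane Re w > -2 stays connected when the pole w = 1 is taken out.\<close>

lemma deriv_riemann_zeta_eq_hurwitz: "deriv riemann_zeta (- 1) = deriv zeta.hurwitz 0"
proof -
  let ?A = "{s. Re s > - 2} - {1 :: complex}"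
  have A: "open ?A" "connected ?A"
    using open_Re_gt[of "-2"] connected_Re_gt[of "-2"]
    by (auto intro: connected_open_delete)
  have hol: "(\<lambda>w. zeta.hurwitz (w + 1)) holomorphic_on ?A"
  proof -
    have "(\<lambda>w. w + 1) holomorphic_on ?A" by (intro holomorphic_intros)
    moreover have "(\<lambda>w. w + 1) ` ?A \<subseteq> {s. Re s > - 1} - {2}" by auto
    ultimately show ?thesis
      using holomorphic_on_compose_gen[OF _ zeta.hurwitz_holomorphic] by (simp add: o_def)
  qed
  have eq: "riemann_zeta w = zeta.hurwitz (w + 1)" if "w \<in> ?A" for w
  proof (rule nicely_meromorphic_on_eq[of riemann_zeta ?A "\<lambda>w. zeta.hurwitz (w + 1)" "{s. Re s > 1}" w])
    show "riemann_zeta nicely_meromorphic_on ?A"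
      using riemann_zeta_continuation(1) by (rule nicely_meromorphic_on_subset) auto
    show "(\<lambda>w. zeta.hurwitz (w + 1)) nicely_meromorphic_on ?A"
      using hol A by (intro analytic_on_imp_nicely_meromorphic_on) (auto simp: analytic_on_open)
    show "{s. Re s > 1} \<noteq> {}" by (auto intro!: exI[of _ 2])
    show "open {s. Re s > 1}" by (rule open_Re_gt)
    fix w assume "w \<in> {s. Re s > 1}"
    then have w: "Re w > 1" by simp
    have "((\<lambda>m::nat. of_nat (Suc m) powr (- w)) has_sum zeta.hurwitz (w + 1)) UNIV"
    proof -
      have "((\<lambda>m::nat. (1 + of_nat m) powr (1 - (w + 1))) has_sum zeta.hurwitz (w + 1)) UNIV"
        by (rule zeta.has_sum_hurwitz) (use w in simp)
      moreover have "1 - (w + 1) = - w" by simp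
      ultimately show ?thesis by (simp only: of_nat_Suc)
    qed
    with riemann_zeta_continuation(2)[OF w] show "riemann_zeta w = zeta.hurwitz (w + 1)"
      by (rule has_sum_unique)
  qed (use that A in auto)
  have "(zeta.hurwitz has_field_derivative deriv zeta.hurwitz 0) (at (- 1 + 1))"
    using holomorphic_derivI[OF zeta.hurwitz_holomorphic zeta.open_strip, of 0] by simp
  then have "((\<lambda>w. zeta.hurwitz (w + 1)) has_field_derivative deriv zeta.hurwitz 0 * 1) (at (- 1))"
    by (rule DERIV_chain2) (auto intro!: derivative_eq_intros)
  then have "((\<lambda>w. zeta.hurwitz (w + 1)) has_field_derivative deriv zeta.hurwitz 0) (at (- 1))"
    by simp
  then have "(riemann_zeta has_field_derivative deriv zeta.hurwitz 0) (at (- 1))"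
    by (rule has_field_derivative_transform_within_open[OF _ A(1)]) (use eq in auto)
  then show ?thesis by (rule DERIV_imp_deriv)
qed

section \<open>Stirling's formula and the Barnes function\<close>

text \<open>Closed form of the partial Wallis product, with the factorials cleared from the
  denominator so that the induction step is a polynomial identity.\<close>

lemma wallis_prod_fact:
  "(\<Prod>k=1..n. (4 * real k ^ 2) / (4 * real k ^ 2 - 1)) * (fact (2 * n) ^ 2 * (2 * real n + 1)) = 16 ^ n * fact n ^ 4"
proof (induction n)
  case (Suc n)
  define Q where "Q = (\<Prod>k=1..n. (4 * real k ^ 2) / (4 * real k ^ 2 - 1))"
  define f g where "f = (fact n :: real)" and "g = (fact (2 * n) :: real)"
  have IH: "Q * (g ^ 2 * (2 * real n + 1)) = 16 ^ n * f ^ 4"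
    using Suc.IH by (simp add: Q_def f_def g_def)
  have f': "fact (Suc n) = (real n + 1) * f" by (simp add: f_def)
  have g': "fact (2 * Suc n) = (2 * real n + 2) * (2 * real n + 1) * g"
    by (simp add: g_def algebra_simps)
  have e: "2 * real (Suc n) + 1 = 2 * real n + 3" by simp
  have d: "4 * real (Suc n) ^ 2 - 1 = (2 * real n + 1) * (2 * real n + 3)"
    by (simp add: power2_eq_square algebra_simps)
  have "(\<Prod>k=1..Suc n. (4 * real k ^ 2) / (4 * real k ^ 2 - 1)) = Q * (4 * real (Suc n) ^ 2) / ((2 * real n + 1) * (2 * real n + 3))"
    using d by (simp add: Q_def)
  then have "(\<Prod>k=1..Suc n. (4 * real k ^ 2) / (4 * real k ^ 2 - 1)) * (fact (2 * Suc n) ^ 2 * (2 * real (Suc n) + 1))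
      = Q * (4 * real (Suc n) ^ 2) / ((2 * real n + 1) * (2 * real n + 3)) * (((2 * real n + 2) * (2 * real n + 1) * g) ^ 2 * (2 * real n + 3))"
    by (simp only: g' e)
  also have "\<dots> = 16 * (real n + 1) ^ 4 * (Q * (g ^ 2 * (2 * real n + 1)))"
  proof -
    have nz: "2 * real n + 1 \<noteq> 0" "2 * real n + 3 \<noteq> 0" by linarith+
    have "Q * (4 * (c * c)) / (a * b) * (((2 * c) * a * g) ^ 2 * b) = 16 * c ^ 4 * (Q * (g ^ 2 * a))"
      if "a \<noteq> 0" "b \<noteq> 0" for a b c :: real
      using that by (simp add: field_simps power2_eq_square power4_eq_xxxx)
    from this[OF nz, of "real n + 1"] show ?thesis by (simp add: power2_eq_square algebra_simps)
  qed
  also have "\<dots> = 16 ^ Suc n * fact (Suc n) ^ 4"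
    unfolding IH f' by (simp add: power_mult_distrib)
  finally show ?case .
qed simp

text \<open>Stirling's formula. The increments are O(1 / n^2), so a limit c exists; the logarithm of
  the Wallis product is 4 a(n) - 2 a(2 n) up to convergent terms, whence ln (pi / 2) = 2 c - 2 ln
  2.\<close>

lemma ln_fact_asymptotics:
  "(\<lambda>n. ln (fact n) - ((real n + 1 / 2) * ln (real n) - real n)) \<longlonglongrightarrow> ln (2 * pi) / 2"
proof -
  define a where "a = (\<lambda>n. ln (fact n) - ((real n + 1 / 2) * ln (real n) - real n))"
  have "summable (\<lambda>n. a (Suc n) - a n)"
  proof (rule summable_comparison_test_bigo)
    show "summable (\<lambda>n. norm (1 / real n ^ 2))"
      using inverse_power_summable[of 2, where 'a = real] by (simp add: inverse_eq_divide)
    have lnf: "ln (fact (Suc n) :: real) = ln (real n + 1) + ln (fact n)" for n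
      by (simp add: ln_mult add.commute)
    have "eventually (\<lambda>n. a (Suc n) - a n = ln (real n + 1) - (real n + 3 / 2) * ln (real n + 1) + (real n + 1 / 2) * ln (real n) + 1) sequentially"
      using eventually_gt_at_top[of 0]
      by eventually_elim (simp add: a_def lnf algebra_simps del: fact_Suc)
    moreover have "(\<lambda>n. ln (real n + 1) - (real n + 3 / 2) * ln (real n + 1) + (real n + 1 / 2) * ln (real n) + 1) \<in> O(\<lambda>n. 1 / real n ^ 2)"
      by real_asymp
    ultimately show "(\<lambda>n. a (Suc n) - a n) \<in> O(\<lambda>n. 1 / real n ^ 2)"
      by (subst landau_o.big.in_cong)
  qed
  then have "convergent (\<lambda>n. \<Sum>k<n. a (Suc k) - a k)"
    by (simp add: summable_iff_convergent)
  then have "convergent (\<lambda>n. a n - a 0)"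
    by (simp only: sum_lessThan_telescope)
  then obtain c0 where "(\<lambda>n. a n - a 0) \<longlonglongrightarrow> c0" by (auto simp: convergent_def)
  from tendsto_add[OF this tendsto_const[of "a 0"]]
  obtain c where c: "a \<longlonglongrightarrow> c" by auto
  have c2: "(\<lambda>n. a (2 * n)) \<longlonglongrightarrow> c"
    using LIMSEQ_subseq_LIMSEQ[OF c, of "\<lambda>n. 2 * n"] by (auto simp: strict_mono_def o_def)
  have L1: "(\<lambda>n. 4 * a n - 2 * a (2 * n) - ln 2 + ln (real n / (2 * real n + 1))) \<longlonglongrightarrow> 4 * c - 2 * c - ln 2 + (- ln 2)"
  proof (intro tendsto_intros c c2)
    have "(\<lambda>n. ln (real n / (2 * real n + 1))) \<longlonglongrightarrow> ln (1 / 2)" by real_asymp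
    then show "(\<lambda>n. ln (real n / (2 * real n + 1))) \<longlonglongrightarrow> - ln 2" by (simp add: ln_div)
  qed
  have L2: "(\<lambda>n. ln (\<Prod>k=1..n. (4 * real k ^ 2) / (4 * real k ^ 2 - 1))) \<longlonglongrightarrow> ln (pi / 2)"
    using wallis by (intro tendsto_ln) auto
  have ev: "eventually (\<lambda>n. ln (\<Prod>k=1..n. (4 * real k ^ 2) / (4 * real k ^ 2 - 1)) =
      4 * a n - 2 * a (2 * n) - ln 2 + ln (real n / (2 * real n + 1))) sequentially"
    using eventually_gt_at_top[of 0]
  proof eventually_elim
    case (elim n)
    have "(\<Prod>k=1..n. (4 * real k ^ 2) / (4 * real k ^ 2 - 1)) = 16 ^ n * fact n ^ 4 / (fact (2 * n) ^ 2 * (2 * real n + 1))"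
    proof (rule eq_divide_imp[OF _ wallis_prod_fact])
      have "2 * real n + 1 \<noteq> 0" by linarith
      then show "fact (2 * n) ^ 2 * (2 * real n + 1) \<noteq> 0" by simp
    qed
    then have "ln (\<Prod>k=1..n. (4 * real k ^ 2) / (4 * real k ^ 2 - 1)) =
        real n * ln 16 + 4 * ln (fact n) - 2 * ln (fact (2 * n)) - ln (2 * real n + 1)"
      by (simp add: ln_div ln_mult ln_realpow)
    moreover have "ln (16 :: real) = 4 * ln 2"
      using ln_realpow[of 2 4] by simp
    moreover have "ln (2 * real n) = ln 2 + ln (real n)" "ln (real n / (2 * real n + 1)) = ln (real n) - ln (2 * real n + 1)"
      using elim by (simp_all add: ln_mult ln_div)
    ultimately show ?case using elim
      by (simp add: a_def algebra_simps diff_divide_distrib)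
  qed
  have "ln (pi / 2) = 4 * c - 2 * c - ln 2 + (- ln 2)"
    by (rule LIMSEQ_unique[OF Lim_transform_eventually[OF L2 ev] L1])
  then have "c = ln (2 * pi) / 2" by (simp add: ln_mult ln_div)
  with c show ?thesis by (simp add: a_def)
qed

text \<open>Let n = N + 1 and let P be the quadratic coefficient of the logarithm in
  \<open>em_sum_deriv\<close>. The factor of ln N is P(x + n) - P(n). As P(x + n) grows like n^2 /
  2, the expansion of Ln (1 + x / n) is needed through second order, with a remainder that is o(1 /
  n^2).\<close>

lemma em_sum_deriv_diff_limit:
  fixes x :: complex
  assumes nz: "\<And>n::nat. x + of_nat n \<noteq> 0"
  shows "(\<lambda>N. em_sum_deriv (x + of_nat (Suc N)) - em_sum_deriv (of_nat (Suc N))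
      - (x * of_nat N + x / 2 + x\<^sup>2 / 2) * of_real (ln (real N))) \<longlonglongrightarrow> x / 2 + x\<^sup>2 / 2"
proof -
  define P where "P = (\<lambda>p::complex. p\<^sup>2 / 2 - p / 2 + 1 / 12)"
  define n where "n = (\<lambda>N. of_nat (Suc N) :: complex)"
  define i where "i = (\<lambda>N. 1 / n N)"
  have n0: "n N \<noteq> 0" for N by (simp add: n_def del: of_nat_Suc)
  define \<rho> where "\<rho> = (\<lambda>N. Ln (1 + x * i N) - x * i N + (x * i N)\<^sup>2 / 2)"
  have i0: "i \<longlonglongrightarrow> 0"
    unfolding i_def n_def using LIMSEQ_Suc[OF lim_inverse_n[where 'a = complex]] by (simp add: inverse_eq_divide del: of_nat_Suc)
  have n2rho: "(\<lambda>N. (n N)\<^sup>2 * \<rho> N) \<longlonglongrightarrow> 0"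
  proof (rule Lim_null_comparison)
    have "(\<lambda>N. x * i N) \<longlonglongrightarrow> x * 0" by (intro tendsto_intros i0)
    then have "(\<lambda>N. norm (x * i N)) \<longlonglongrightarrow> 0" by (simp add: tendsto_norm_zero)
    then have "eventually (\<lambda>N. norm (x * i N) < 1 / 2) sequentially"
      by (rule order_tendstoD) simp
    then show "eventually (\<lambda>N. norm ((n N)\<^sup>2 * \<rho> N) \<le> 8 * norm x ^ 3 * norm (i N)) sequentially"
    proof eventually_elim
      case (elim N)
      then have "norm (\<rho> N) \<le> 8 * norm (x * i N) ^ 3"
        unfolding \<rho>_def by (intro norm_Ln_Taylor2_le) simp
      then have "norm ((n N)\<^sup>2 * \<rho> N) \<le> norm (n N) ^ 2 * (8 * norm (x * i N) ^ 3)"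
        by (simp add: norm_mult norm_power mult_left_mono)
      also have "\<dots> = 8 * norm x ^ 3 * norm (i N)"
        using n0[of N] by (simp add: i_def norm_mult norm_divide power2_eq_square power3_eq_cube field_simps)
      finally show ?case .
    qed
    have "(\<lambda>N. 8 * norm x ^ 3 * norm (i N)) \<longlonglongrightarrow> 8 * norm x ^ 3 * norm (0 :: complex)"
      by (intro tendsto_intros i0)
    then show "(\<lambda>N. 8 * norm x ^ 3 * norm (i N)) \<longlonglongrightarrow> 0" by simp
  qed
  have lnlim: "(\<lambda>N. of_real (real N * (ln (real N + 1) - ln (real N))) :: complex) \<longlonglongrightarrow> of_real 1"
    "(\<lambda>N. of_real (ln (real N + 1) - ln (real N)) :: complex) \<longlonglongrightarrow> of_real 0"
    by (intro tendsto_of_real; real_asymp)+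
  have "(\<lambda>N. (x * of_real (real N * (ln (real N + 1) - ln (real N))) + (x / 2 + x\<^sup>2 / 2) * of_real (ln (real N + 1) - ln (real N)))
      + (3 * x\<^sup>2 / 4 - x / 2 + (P x * x - (x - 1 / 2) * x\<^sup>2 / 2) * i N - P x * x\<^sup>2 / 2 * (i N)\<^sup>2
         + (1 / 2 + (x - 1 / 2) * i N + P x * (i N)\<^sup>2) * ((n N)\<^sup>2 * \<rho> N)) - x\<^sup>2 / 4) \<longlonglongrightarrow>
     (x * of_real 1 + (x / 2 + x\<^sup>2 / 2) * of_real 0)
      + (3 * x\<^sup>2 / 4 - x / 2 + (P x * x - (x - 1 / 2) * x\<^sup>2 / 2) * 0 - P x * x\<^sup>2 / 2 * 0\<^sup>2
         + (1 / 2 + (x - 1 / 2) * 0 + P x * 0\<^sup>2) * 0) - x\<^sup>2 / 4"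
    by (intro tendsto_intros lnlim i0 n2rho)
  also have "(x * of_real 1 + (x / 2 + x\<^sup>2 / 2) * of_real 0)
      + (3 * x\<^sup>2 / 4 - x / 2 + (P x * x - (x - 1 / 2) * x\<^sup>2 / 2) * 0 - P x * x\<^sup>2 / 2 * 0\<^sup>2
         + (1 / 2 + (x - 1 / 2) * 0 + P x * 0\<^sup>2) * 0) - x\<^sup>2 / 4 = x / 2 + x\<^sup>2 / 2"
    by (simp add: field_simps)
  finally show ?thesis
  proof (rule Lim_transform_eventually, intro always_eventually allI)
    fix N
    define l where "l = Ln (1 + x * i N)"
    have ln_n: "Ln (n N) = of_real (ln (real N + 1))"
      unfolding n_def using Ln_of_real[of "real (Suc N)"] by (simp add: add.commute)
    have "1 + x * i N \<noteq> 0"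
      using nz[of "Suc N"] n0[of N] unfolding i_def n_def by (simp add: field_simps del: of_nat_Suc)
    then have "Ln (of_real (real N + 1) * (1 + x * i N)) = of_real (ln (real N + 1)) + l"
      using Ln_times_of_real[of "real N + 1" "1 + x * i N"] Ln_of_real[of "real N + 1"]
      by (simp only: l_def) simp
    also have "of_real (real N + 1) * (1 + x * i N) = x + n N"
      using n0[of N] unfolding i_def n_def by (simp add: field_simps)
    finally have ln_xn: "Ln (x + n N) = of_real (ln (real N + 1)) + l" .
    have Pn: "P (x + n N) = (n N)\<^sup>2 / 2 + n N * (x - 1 / 2) + P x"
      by (simp add: P_def field_simps power2_eq_square)
    have l: "l = x * i N - (x * i N)\<^sup>2 / 2 + \<rho> N" by (simp add: l_def \<rho>_def)
    have l2: "P (x + n N) * l = x * n N / 2 + (3 * x\<^sup>2 / 4 - x / 2 + (P x * x - (x - 1 / 2) * x\<^sup>2 / 2) * i N - P x * x\<^sup>2 / 2 * (i N)\<^sup>2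
         + (1 / 2 + (x - 1 / 2) * i N + P x * (i N)\<^sup>2) * ((n N)\<^sup>2 * \<rho> N))"
    proof -
      have i: "i N = 1 / n N" by (simp add: i_def)
      show ?thesis unfolding Pn l i using n0[of N] by (simp add: field_simps power2_eq_square)
    qed
    have "em_sum_deriv (x + n N) - em_sum_deriv (n N) - (x * of_nat N + x / 2 + x\<^sup>2 / 2) * of_real (ln (real N))
        = (P (x + n N) - P (n N)) * of_real (ln (real N + 1)) + (P (x + n N) * l - (2 * x * n N + x\<^sup>2) / 4)
          - (x * of_nat N + x / 2 + x\<^sup>2 / 2) * of_real (ln (real N))"
      unfolding em_sum_deriv_def ln_xn ln_n P_def by (simp add: field_simps power2_eq_square)
    also have "P (x + n N) - P (n N) = x * of_nat N + x / 2 + x\<^sup>2 / 2"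
      by (simp add: P_def n_def field_simps power2_eq_square)
    also have "P (x + n N) * l - (2 * x * n N + x\<^sup>2) / 4 = (3 * x\<^sup>2 / 4 - x / 2 + (P x * x - (x - 1 / 2) * x\<^sup>2 / 2) * i N - P x * x\<^sup>2 / 2 * (i N)\<^sup>2
         + (1 / 2 + (x - 1 / 2) * i N + P x * (i N)\<^sup>2) * ((n N)\<^sup>2 * \<rho> N)) - x\<^sup>2 / 4" (is "_ = ?R")
      unfolding l2 by (simp add: field_simps)
    finally show "(x * of_real (real N * (ln (real N + 1) - ln (real N))) + (x / 2 + x\<^sup>2 / 2) * of_real (ln (real N + 1) - ln (real N)))
      + (3 * x\<^sup>2 / 4 - x / 2 + (P x * x - (x - 1 / 2) * x\<^sup>2 / 2) * i N - P x * x\<^sup>2 / 2 * (i N)\<^sup>2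
         + (1 / 2 + (x - 1 / 2) * i N + P x * (i N)\<^sup>2) * ((n N)\<^sup>2 * \<rho> N)) - x\<^sup>2 / 4 =
      em_sum_deriv (x + of_nat (Suc N)) - em_sum_deriv (of_nat (Suc N)) - (x * of_nat N + x / 2 + x\<^sup>2 / 2) * of_real (ln (real N))"
      by (simp add: n_def algebra_simps)
  qed
qed

section \<open>The Hurwitz derivative in terms of the Gamma and Barnes functions\<close>

context hurwitz_sequence
begin

text \<open>All four quantities are limits of finite sums of logarithms. Splitting Ln (x + k) into
  ln k + Ln (1 + x / k) expresses them through the same sums \<open>S\<close>, \<open>S1\<close> and
  \<open>T\<close>, which occur in the products for Gamma and G and in the hyperfactorial.\<close>

lemma deriv_hurwitz_eq_Barnes:
  "deriv hurwitz 0 - deriv zeta.hurwitz 0 = x * ln_Gamma x - ln_Barnes_G (x + 1)"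
proof -
  have x: "x \<notin> \<int>\<^sub>\<le>\<^sub>0"
    using nonzero(1) by (auto elim!: nonpos_Ints_cases') (metis add.left_inverse)
  define S where "S = (\<lambda>N. \<Sum>k=1..N. Ln (1 + x / of_nat k))"
  define S1 where "S1 = (\<lambda>N. \<Sum>k=1..N. of_nat k * Ln (1 + x / of_nat k))"
  define T where "T = (\<lambda>N. \<Sum>k=1..N. of_nat k * of_real (ln (real k)) :: complex)"
  have 1: "(\<lambda>N. em_sum_deriv (x + of_nat (Suc N)) - (x * Ln x + S1 N + x * S N + x * of_real (ln (fact N)) + T N)) \<longlonglongrightarrow> deriv hurwitz 0"
  proof -
    have "(\<Sum>m<Suc N. (x + of_nat m) * Ln (x + of_nat m)) = x * Ln x + S1 N + x * S N + x * of_real (ln (fact N)) + T N" for N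
    proof (induction N)
      case (Suc N)
      have "x + of_nat (Suc N) = of_real (real (Suc N)) * (1 + x / of_nat (Suc N))"
        by (simp add: field_simps del: of_nat_Suc)
      moreover have "1 + x / of_nat (Suc N) \<noteq> 0"
        using nonzero(1)[of "Suc N"] by (simp add: field_simps del: of_nat_Suc)
      ultimately have ln: "Ln (x + of_nat (Suc N)) = of_real (ln (real (Suc N))) + Ln (1 + x / of_nat (Suc N))"
        using Ln_times_of_real[of "real (Suc N)" "1 + x / of_nat (Suc N)"] Ln_of_real[of "real (Suc N)"] by simp
      have lnf: "ln (fact (Suc N) :: real) = ln (real (Suc N)) + ln (fact N)"
        by (simp add: ln_mult del: of_nat_Suc)
      have "(\<Sum>m<Suc (Suc N). (x + of_nat m) * Ln (x + of_nat m)) =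
          x * Ln x + S1 N + x * S N + x * of_real (ln (fact N)) + T N + (x + of_nat (Suc N)) * Ln (x + of_nat (Suc N))"
        using Suc.IH by simp
      also have "\<dots> = x * Ln x + S1 (Suc N) + x * S (Suc N) + x * of_real (ln (fact (Suc N))) + T (Suc N)"
        unfolding ln lnf by (simp add: S_def S1_def T_def algebra_simps del: of_nat_Suc)
      finally show ?case .
    qed (simp add: S_def S1_def T_def)
    with LIMSEQ_Suc[OF hurwitz_deriv_0] show ?thesis by (simp only:)
  qed
  have 2: "(\<lambda>N. em_sum_deriv (of_nat (Suc N)) - T N) \<longlonglongrightarrow> deriv zeta.hurwitz 0"
  proof -
    have "(\<Sum>m<N. (1 + of_nat m) * Ln (1 + of_nat m)) = T N" for N
    proof (induction N)
      case (Suc N)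
      have "Ln (1 + of_nat N) = of_real (ln (real (Suc N)))"
        using Ln_of_real[of "real (Suc N)"] by simp
      then show ?case using Suc.IH by (simp add: T_def)
    qed (simp add: T_def)
    with zeta.hurwitz_deriv_0 show ?thesis by simp
  qed
  have 3: "(\<lambda>N. x * of_real (ln (real N)) - Ln x - S N) \<longlonglongrightarrow> ln_Gamma x"
    using ln_Gamma_complex_LIMSEQ[OF x]
    by (rule Lim_transform_eventually, intro eventually_mono[OF eventually_gt_at_top[of 0]])
       (auto simp: ln_Gamma_series_def S_def add.commute Ln_of_nat)
  have 4: "(\<lambda>N. x / 2 * of_real (ln (2 * pi)) - (x + x\<^sup>2 * (1 + euler_mascheroni)) / 2
      + (S1 N + x\<^sup>2 / 2 * of_real (harm N) - x * of_nat N)) \<longlonglongrightarrow> ln_Barnes_G (x + 1)"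
  proof -
    have "(\<lambda>N. \<Sum>k<N. of_nat (Suc k) * Ln (1 + x / of_nat (Suc k)) + (x\<^sup>2 / (2 * of_nat (Suc k)) - x))
        \<longlonglongrightarrow> (\<Sum>k. of_nat (Suc k) * Ln (1 + x / of_nat (Suc k)) + (x\<^sup>2 / (2 * of_nat (Suc k)) - x))"
      using summable_ln_Barnes_G[of x] by (rule summable_LIMSEQ)
    moreover have "(\<Sum>k<N. of_nat (Suc k) * Ln (1 + x / of_nat (Suc k)) + (x\<^sup>2 / (2 * of_nat (Suc k)) - x)) =
        S1 N + x\<^sup>2 / 2 * of_real (harm N) - x * of_nat N" for N
    proof (induction N)
      case (Suc N)
      then show ?case
        by (simp add: S1_def harm_Suc algebra_simps inverse_eq_divide add_divide_distrib)
    qed (simp add: S1_def harm_def)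
    ultimately have "(\<lambda>N. S1 N + x\<^sup>2 / 2 * of_real (harm N) - x * of_nat N)
        \<longlonglongrightarrow> (\<Sum>k. of_nat (Suc k) * Ln (1 + x / of_nat (Suc k)) + (x\<^sup>2 / (2 * of_nat (Suc k)) - x))"
      by simp
    then show ?thesis unfolding ln_Barnes_G_def Let_def
      by (simp only: add_diff_cancel) (intro tendsto_intros)
  qed
  have 5: "(\<lambda>N. em_sum_deriv (x + of_nat (Suc N)) - em_sum_deriv (of_nat (Suc N))
      - (x * of_nat N + x / 2 + x\<^sup>2 / 2) * of_real (ln (real N))) \<longlonglongrightarrow> x / 2 + x\<^sup>2 / 2"
    using nonzero(1) by (rule em_sum_deriv_diff_limit)
  have 6: "(\<lambda>N. of_real (ln (fact N) - ((real N + 1 / 2) * ln (real N) - real N)) :: complex) \<longlonglongrightarrow> of_real (ln (2 * pi) / 2)"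
    by (intro tendsto_of_real ln_fact_asymptotics)
  have 7: "(\<lambda>N. of_real (harm N - ln (real N)) :: complex) \<longlonglongrightarrow> euler_mascheroni"
    by (rule euler_mascheroni_LIMSEQ_of_real)
  \<comment> \<open>Each divergent quantity is paired with its asymptotics:
    \<open>em_sum_deriv\<close> with its growth, the factorial with Stirling, the harmonic number
    with ln N. The surplus logarithms add up to -x^2 ln N, the normalisation that x times the Gamma
    limit brings in.\<close>
  have "(\<lambda>N. (em_sum_deriv (x + of_nat (Suc N)) - em_sum_deriv (of_nat (Suc N))
      - (x * of_nat N + x / 2 + x\<^sup>2 / 2) * of_real (ln (real N)))
      - x * of_real (ln (fact N) - ((real N + 1 / 2) * ln (real N) - real N))
      + x\<^sup>2 / 2 * of_real (harm N - ln (real N))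
      + x / 2 * of_real (ln (2 * pi)) - (x + x\<^sup>2 * (1 + euler_mascheroni)) / 2)
      \<longlonglongrightarrow> (x / 2 + x\<^sup>2 / 2) - x * of_real (ln (2 * pi) / 2) + x\<^sup>2 / 2 * euler_mascheroni
       + x / 2 * of_real (ln (2 * pi)) - (x + x\<^sup>2 * (1 + euler_mascheroni)) / 2"
    by (intro tendsto_intros 5 6 7)
  also have "(x / 2 + x\<^sup>2 / 2) - x * of_real (ln (2 * pi) / 2) + x\<^sup>2 / 2 * euler_mascheroni
       + x / 2 * of_real (ln (2 * pi)) - (x + x\<^sup>2 * (1 + euler_mascheroni)) / 2 = 0"
    by (simp add: field_simps)
  finally have 8: "(\<lambda>N. (em_sum_deriv (x + of_nat (Suc N)) - em_sum_deriv (of_nat (Suc N))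
      - (x * of_nat N + x / 2 + x\<^sup>2 / 2) * of_real (ln (real N)))
      - x * of_real (ln (fact N) - ((real N + 1 / 2) * ln (real N) - real N))
      + x\<^sup>2 / 2 * of_real (harm N - ln (real N))
      + x / 2 * of_real (ln (2 * pi)) - (x + x\<^sup>2 * (1 + euler_mascheroni)) / 2) \<longlonglongrightarrow> 0" .
  \<comment> \<open>Here \<open>S\<close>, \<open>S1\<close>, \<open>T\<close> and
    \<open>x * Ln x\<close> cancel, so this is the null sequence just found.\<close>
  have "(\<lambda>N. (em_sum_deriv (x + of_nat (Suc N)) - (x * Ln x + S1 N + x * S N + x * of_real (ln (fact N)) + T N))
       - (em_sum_deriv (of_nat (Suc N)) - T N)
       + (x / 2 * of_real (ln (2 * pi)) - (x + x\<^sup>2 * (1 + euler_mascheroni)) / 2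
      + (S1 N + x\<^sup>2 / 2 * of_real (harm N) - x * of_nat N)) - x * (x * of_real (ln (real N)) - Ln x - S N))
      \<longlonglongrightarrow> deriv hurwitz 0 - deriv zeta.hurwitz 0 + ln_Barnes_G (x + 1) - x * ln_Gamma x"
    by (intro tendsto_intros 1 2 3 4)
  also have "(\<lambda>N. (em_sum_deriv (x + of_nat (Suc N)) - (x * Ln x + S1 N + x * S N + x * of_real (ln (fact N)) + T N))
       - (em_sum_deriv (of_nat (Suc N)) - T N)
       + (x / 2 * of_real (ln (2 * pi)) - (x + x\<^sup>2 * (1 + euler_mascheroni)) / 2
      + (S1 N + x\<^sup>2 / 2 * of_real (harm N) - x * of_nat N)) - x * (x * of_real (ln (real N)) - Ln x - S N)) =
    (\<lambda>N. (em_sum_deriv (x + of_nat (Suc N)) - em_sum_deriv (of_nat (Suc N))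
      - (x * of_nat N + x / 2 + x\<^sup>2 / 2) * of_real (ln (real N)))
      - x * of_real (ln (fact N) - ((real N + 1 / 2) * ln (real N) - real N))
      + x\<^sup>2 / 2 * of_real (harm N - ln (real N))
      + x / 2 * of_real (ln (2 * pi)) - (x + x\<^sup>2 * (1 + euler_mascheroni)) / 2)"
    by (rule ext) (simp add: field_simps power2_eq_square del: of_nat_Suc)
  finally have "deriv hurwitz 0 - deriv zeta.hurwitz 0 + ln_Barnes_G (x + 1) - x * ln_Gamma x = 0"
    using 8 LIMSEQ_unique by blast
  then show ?thesis by (simp add: algebra_simps)
qed

end

section \<open>The double zeta function for small \<open>\<tau>\<close>\<close>

text \<open>
  Midpoint Euler--Maclaurin approximation of \<open>\<Sum>n. (p + (n + 1 / 2) \<tau>) powr (- s)\<close>, with one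
  correction term, which makes the defect small enough to be summed over the lattice near \<open>s = 0\<close>.
\<close>

definition midpoint_sum :: "complex \<Rightarrow> complex \<Rightarrow> complex \<Rightarrow> complex" where
  "midpoint_sum s \<tau> p = p powr (1 - s) / (\<tau> * (s - 1)) - \<tau> * s / 24 * p powr (- 1 - s)"

definition midpoint_defect :: "complex \<Rightarrow> complex \<Rightarrow> complex \<Rightarrow> complex" where
  "midpoint_defect s \<tau> c = c powr (- s) - (midpoint_sum s \<tau> (c - \<tau> / 2) - midpoint_sum s \<tau> (c + \<tau> / 2))"

text \<open>With r = tau / (2 c), the expansions at r and -r cancel in every even order by symmetry
  about the midpoint, and the correction with tau / 24 removes the r^2 term of the quotient. A
  remainder of order 4 divided by r and a remainder of order 2 times r both give order 3. The
  constants 2 / d and B come from these two remainders.\<close>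

lemma midpoint_defect_bound:
  assumes \<phi>: "- pi / 2 < \<phi>" "\<phi> \<le> pi / 2"
    and c: "c \<in> half_plane \<phi>" "c - \<tau> / 2 \<in> half_plane \<phi>" "c + \<tau> / 2 \<in> half_plane \<phi>"
    and \<tau>: "\<tau> \<noteq> 0" "norm \<tau> \<le> norm c" and s: "norm s \<le> B" "d \<le> norm (s - 1)" "d > 0"
  shows "norm (midpoint_defect s \<tau> c) \<le>
    norm (c powr (- s)) * (2 powr (B + 1) * (2 / d + B) * (norm \<tau> / norm c) ^ 3)"
proof -
  define r where "r = \<tau> / (2 * c)"
  have cnz: "c \<noteq> 0" using c(1) half_plane_nonzero by blast
  have rnz: "r \<noteq> 0" using \<tau> cnz by (simp add: r_def)
  have nr: "norm r = norm \<tau> / norm c / 2" by (simp add: r_def norm_divide norm_mult)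
  have r: "norm r \<le> 1 / 2" using \<tau> cnz by (simp add: nr divide_le_eq)
  have s1: "s \<noteq> 1" using s by auto
  have B: "B \<ge> 0" using s(1) norm_ge_zero[of s] by linarith
  define E where "E = (\<lambda>n b (q::complex). (1 + q) powr b - (\<Sum>k<n. (b gchoose k) * q ^ k))"
  have E: "norm (E n b q) \<le> 2 powr (B + 1) * (2 * norm r) ^ n" if "norm b \<le> B + 1" "norm q = norm r" for n b q
    unfolding E_def using powr_Taylor_remainder[of q b "B + 1" n] r that by simp
  have b: "norm (1 - s) \<le> B + 1" "norm (- 1 - s) \<le> B + 1"
    using s(1) norm_triangle_ineq4[of 1 s] norm_triangle_ineq4[of "-1" s] by auto
  have plus: "(c + \<tau> / 2) powr w = c powr w * (1 + r) powr w" for w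
  proof -
    have "norm (\<tau> / 2) < norm c" using \<tau> by (simp add: norm_divide) (smt (verit) norm_le_zero_iff)
    then show ?thesis using powr_add_half_plane[OF \<phi> c(1,3)] by (simp add: r_def field_simps)
  qed
  have minus: "(c - \<tau> / 2) powr w = c powr w * (1 + (- r)) powr w" for w
  proof -
    have "norm (- \<tau> / 2) < norm c" using \<tau> by (simp add: norm_divide) (smt (verit) norm_le_zero_iff)
    then show ?thesis using powr_add_half_plane[OF \<phi> c(1), of "- \<tau> / 2"] c(2) by (simp add: r_def field_simps)
  qed
  define D where "D = (E 4 (1 - s) r - E 4 (1 - s) (- r)) / (2 * r * (s - 1)) + s * r / 12 * (E 2 (- 1 - s) (- r) - E 2 (- 1 - s) r)"
  have "midpoint_defect s \<tau> c = c powr (- s) * D"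
  proof -
    have \<tau>r: "\<tau> = 2 * (c * r)" using cnz by (simp add: r_def)
    define u1 u2 v1 v2 where "u1 = (1 + (- r)) powr (1 - s)" and "u2 = (1 + r) powr (1 - s)"
      and "v1 = (1 + (- r)) powr (- 1 - s)" and "v2 = (1 + r) powr (- 1 - s)"
    have "midpoint_defect s \<tau> c = c powr (- s) * (1 - (u1 - u2) / (2 * r * (s - 1)) + s * r / 12 * (v1 - v2))"
    proof -
      have "midpoint_defect s \<tau> c = c powr (- s) - (c powr (- s) * c * u1 / (\<tau> * (s - 1)) - \<tau> * s / 24 * (c powr (- s) / c * v1)
          - (c powr (- s) * c * u2 / (\<tau> * (s - 1)) - \<tau> * s / 24 * (c powr (- s) / c * v2)))"
        unfolding midpoint_defect_def midpoint_sum_def plus minus powr_minus_numeral[OF cnz] u1_def u2_def v1_def v2_def ..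
      also have "\<dots> = c powr (- s) * (1 - (u1 - u2) / (2 * r * (s - 1)) + s * r / 12 * (v1 - v2))"
      proof -
        have "y * c * u / (\<tau> * (s - 1)) = y * (u / (2 * r * (s - 1)))"
          and "\<tau> * s / 24 * (y / c * u) = y * (s * r / 12 * u)" for y u :: complex
          unfolding \<tau>r using cnz by simp_all
        then show ?thesis by (simp only: right_diff_distrib distrib_left diff_divide_distrib) simp
      qed
      finally show ?thesis .
    qed
    moreover have "1 - (u1 - u2) / (2 * r * (s - 1)) + s * r / 12 * (v1 - v2) = D"
    proof -
      have u: "u1 - u2 = - (E 4 (1 - s) r - E 4 (1 - s) (- r)) + 2 * r * (s - 1) * (1 + s * (s + 1) * r\<^sup>2 / 6)"
        unfolding E_def powr_Taylor_polynomials u1_def u2_def by (simp add: field_simps power2_eq_square power3_eq_cube)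
      have v: "v1 - v2 = E 2 (- 1 - s) (- r) - E 2 (- 1 - s) r + 2 * (s + 1) * r"
        unfolding E_def powr_Taylor_polynomials v1_def v2_def by (simp add: field_simps)
      have uu: "(u1 - u2) / (2 * r * (s - 1)) = - ((E 4 (1 - s) r - E 4 (1 - s) (- r)) / (2 * r * (s - 1))) + (1 + s * (s + 1) * r\<^sup>2 / 6)"
        unfolding u add_divide_distrib using rnz s1 by (simp add: minus_divide_left)
      have "1 - (- y + (1 + s * (s + 1) * r\<^sup>2 / 6)) + s * r / 12 * (e + 2 * (s + 1) * r) = y + s * r / 12 * e"
        for y e :: complex
        by (simp add: field_simps power2_eq_square)
      then show ?thesis unfolding uu v D_def .
    qed
    ultimately show ?thesis by simp
  qed
  moreover have "norm D \<le> 2 powr (B + 1) * (2 / d + B) * (norm \<tau> / norm c) ^ 3"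
  proof -
    have "norm ((E 4 (1 - s) r - E 4 (1 - s) (- r)) / (2 * r * (s - 1))) \<le>
        (2 powr (B + 1) * (2 * norm r) ^ 4 + 2 powr (B + 1) * (2 * norm r) ^ 4) / (2 * norm r * d)"
      unfolding norm_divide norm_mult using s rnz
      by (intro frac_le order_trans[OF norm_triangle_ineq4] add_mono E b mult_mono) auto
    also have "\<dots> = 2 powr (B + 1) * (2 / d) * (2 * norm r) ^ 3"
      using rnz s by (simp add: field_simps power3_eq_cube power4_eq_xxxx)
    finally have 1: "norm ((E 4 (1 - s) r - E 4 (1 - s) (- r)) / (2 * r * (s - 1))) \<le> 2 powr (B + 1) * (2 / d) * (2 * norm r) ^ 3" .
    have "norm (s * r / 12 * (E 2 (- 1 - s) (- r) - E 2 (- 1 - s) r)) \<le>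
        B * norm r / 12 * (2 powr (B + 1) * (2 * norm r) ^ 2 + 2 powr (B + 1) * (2 * norm r) ^ 2)"
      unfolding norm_mult using s B
      by (intro mult_mono order_trans[OF norm_triangle_ineq4] add_mono E b)
         (auto simp: norm_divide norm_mult intro!: mult_right_mono divide_right_mono)
    also have "\<dots> = (2 powr (B + 1) * B * (2 * norm r) ^ 3) / 12"
      by (simp add: field_simps power2_eq_square power3_eq_cube)
    also have "\<dots> \<le> 2 powr (B + 1) * B * (2 * norm r) ^ 3"
      using B by (simp add: field_simps)
    finally have 2: "norm (s * r / 12 * (E 2 (- 1 - s) (- r) - E 2 (- 1 - s) r)) \<le> 2 powr (B + 1) * B * (2 * norm r) ^ 3" .
    have "norm D \<le> 2 powr (B + 1) * (2 / d) * (2 * norm r) ^ 3 + 2 powr (B + 1) * B * (2 * norm r) ^ 3"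
      unfolding D_def by (intro order_trans[OF norm_triangle_ineq] add_mono 1 2)
    also have "\<dots> = 2 powr (B + 1) * (2 / d + B) * (norm \<tau> / norm c) ^ 3"
      by (simp add: nr algebra_simps)
    finally show ?thesis .
  qed
  ultimately show ?thesis
    by (simp add: norm_mult mult_left_mono)
qed

lemma holomorphic_on_midpoint_sum: "1 \<notin> A \<Longrightarrow> \<tau> \<noteq> 0 \<Longrightarrow> (\<lambda>s. midpoint_sum s \<tau> p) holomorphic_on A"
  unfolding midpoint_sum_def by (intro holomorphic_intros) auto

lemma holomorphic_on_midpoint_defect: "1 \<notin> A \<Longrightarrow> \<tau> \<noteq> 0 \<Longrightarrow> (\<lambda>s. midpoint_defect s \<tau> p) holomorphic_on A"
  unfolding midpoint_defect_def by (intro holomorphic_intros holomorphic_on_midpoint_sum)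

definition midpoint_sum_deriv :: "complex \<Rightarrow> complex \<Rightarrow> complex" where
  "midpoint_sum_deriv \<tau> p = (p * Ln p - p) / \<tau> - \<tau> / (24 * p)"

lemma has_field_derivative_midpoint_sum:
  assumes "p \<noteq> 0" "\<tau> \<noteq> 0"
  shows "((\<lambda>s. midpoint_sum s \<tau> p) has_field_derivative midpoint_sum_deriv \<tau> p) (at 0)"
proof -
  have pw: "p powr (- 1) = 1 / p" using assms powr_minus[of p 1] by (simp add: inverse_eq_divide)
  have "((\<lambda>s. midpoint_sum s \<tau> p) has_field_derivative
     ((- (Ln p * p powr (1 - 0))) * (\<tau> * (0 - 1)) - p powr (1 - 0) * \<tau>) / ((\<tau> * (0 - 1)) * (\<tau> * (0 - 1)))
     - (\<tau> / 24 * p powr (- 1 - 0) + \<tau> * 0 / 24 * - (Ln p * p powr (- 1 - 0)))) (at 0)"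
    unfolding midpoint_sum_def using assms
    by (auto intro!: derivative_eq_intros has_field_derivative_powr_diff)
  from this show ?thesis
    by (rule DERIV_cong) (use assms in \<open>simp add: pw midpoint_sum_deriv_def field_simps\<close>)
qed

lemma powr_tendsto_0_at_infinity:
  fixes b :: complex
  assumes "filterlim (\<lambda>n. norm (z n)) at_top G" "Re b < 0"
  shows "((\<lambda>n. z n powr b) \<longlongrightarrow> 0) G"
proof (rule Lim_null_comparison)
  show "\<forall>\<^sub>F n in G. norm (z n powr b) \<le> norm (z n) powr Re b * exp (pi * \<bar>Im b\<bar>)"
    by (intro always_eventually allI norm_powr_le)
  show "((\<lambda>n. norm (z n) powr Re b * exp (pi * \<bar>Im b\<bar>)) \<longlongrightarrow> 0) G"
    using tendsto_neg_powr[OF assms(2,1)] by (intro tendsto_mult_left_zero)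
qed

text \<open>The single constant kappa is both the growth rate and the radius allowed for tau: |tau|
  < kappa gives |tau| <= |c| at every lattice point c, and with kappa <= 1 also |tau| < 1.\<close>

locale lattice_cone = hurwitz_sequence x \<phi> \<kappa> for x :: complex and \<phi> \<kappa> :: real +
  fixes \<alpha> \<beta> :: real
  assumes \<kappa>_le: "\<kappa> \<le> 1" and \<alpha>_nonneg: "0 \<le> \<alpha>" and \<beta>_le: "\<beta> \<le> pi / 2"
    and cone_in_half_plane: "\<And>\<tau> v (m::nat). \<tau> \<in> sector \<alpha> \<beta> \<Longrightarrow> v \<ge> 0 \<Longrightarrow>
      x + of_nat m + of_real v * \<tau> \<in> half_plane \<phi>"
    and cone_lower: "\<And>\<tau> v (m::nat). \<tau> \<in> sector \<alpha> \<beta> \<Longrightarrow> v \<ge> 0 \<Longrightarrow>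
      norm (x + of_nat m + of_real v * \<tau>) \<ge> \<kappa> * (1 + real m + v * norm \<tau>)"
begin

definition lattice_point :: "complex \<Rightarrow> nat \<times> nat \<Rightarrow> complex" where
  "lattice_point \<tau> = (\<lambda>(m, n). x + of_nat m + of_real (real n + 1 / 2) * \<tau>)"

definition defect_sum :: "complex \<Rightarrow> complex \<Rightarrow> complex" where
  "defect_sum \<tau> s = (\<Sum>\<^sub>\<infinity>p. midpoint_defect s \<tau> (lattice_point \<tau> p))"

lemma sector_nonzero: "\<tau> \<in> sector \<alpha> \<beta> \<Longrightarrow> \<tau> \<noteq> 0"
  using \<alpha>_nonneg by (auto simp: sector_def Arg_zero)

lemma sector_Re_pos:
  assumes "\<tau> \<in> sector \<alpha> \<beta>"
  shows "Re \<tau> > 0"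
proof -
  have "cos (Arg \<tau>) > 0"
    using assms \<alpha>_nonneg \<beta>_le pi_gt_zero by (intro cos_gt_zero_pi) (auto simp: sector_def)
  moreover have "Re \<tau> = norm \<tau> * cos (Arg \<tau>)"
    using arg_cong[OF rcis_cmod_Arg[of \<tau>], of Re] by simp
  ultimately show ?thesis using sector_nonzero[OF assms] by simp
qed

lemma lattice_point_shift:
  "lattice_point \<tau> (m, n) - \<tau> / 2 = x + of_nat m + of_real (real n) * \<tau>"
  "lattice_point \<tau> (m, n) + \<tau> / 2 = x + of_nat m + of_real (real (Suc n)) * \<tau>"
  by (simp_all add: lattice_point_def algebra_simps)

lemma lattice_point_in_half_plane:
  assumes "\<tau> \<in> sector \<alpha> \<beta>"
  shows "lattice_point \<tau> p \<in> half_plane \<phi>" "lattice_point \<tau> p - \<tau> / 2 \<in> half_plane \<phi>"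
    "lattice_point \<tau> p + \<tau> / 2 \<in> half_plane \<phi>"
proof -
  obtain m n where p: "p = (m, n)" by (cases p)
  show "lattice_point \<tau> p \<in> half_plane \<phi>"
    using cone_in_half_plane[OF assms, of "real n + 1 / 2" m] by (simp add: p lattice_point_def)
  show "lattice_point \<tau> p - \<tau> / 2 \<in> half_plane \<phi>" "lattice_point \<tau> p + \<tau> / 2 \<in> half_plane \<phi>"
    unfolding p lattice_point_shift by (intro cone_in_half_plane assms; simp)+
qed

lemma lattice_point_lower:
  assumes "\<tau> \<in> sector \<alpha> \<beta>"
  shows "\<kappa> * (1 + real m + real n * norm \<tau>) \<le> norm (lattice_point \<tau> (m, n))"
proof -
  have "\<kappa> * (1 + real m + real n * norm \<tau>) \<le> \<kappa> * (1 + real m + (real n + 1 / 2) * norm \<tau>)"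
    using \<kappa> by (intro mult_left_mono add_left_mono mult_right_mono) auto
  also have "\<dots> \<le> norm (lattice_point \<tau> (m, n))"
    using cone_lower[OF assms, of "real n + 1 / 2" m] by (simp add: lattice_point_def)
  finally show ?thesis .
qed

text \<open>The defect is at most a constant times |tau|^3 |c|^(-3 - sigma). Dividing the exponent
  equally between 1 + m and 1 + n |tau| >= |tau| (1 + n) costs |tau|^(-rho) with rho = (3 + sigma) /
  2. As 1 < rho <= 3, the majorant is summable and the remaining power of |tau| is at most
  1.\<close>

lemma defect_uniformly_dominated:
  assumes C: "compact C" "C \<subseteq> {s. Re s > - 1} - {1}"
  shows "\<exists>M. M summable_on UNIV \<and>
    (\<forall>\<tau>\<in>sector \<alpha> \<beta> \<inter> ball 0 \<kappa>. \<forall>s\<in>C. \<forall>p. norm (midpoint_defect s \<tau> (lattice_point \<tau> p)) \<le> M p)"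
proof -
  obtain \<sigma>' B where \<sigma>': "\<sigma>' > - 1" and C': "\<And>s. s \<in> C \<Longrightarrow> Re s \<ge> \<sigma>'" and CB: "\<And>s. s \<in> C \<Longrightarrow> norm s \<le> B"
    using compact_subset_Re_gt[of C "-1"] C by blast
  obtain d where d: "d > 0" "\<And>s. s \<in> C \<Longrightarrow> d \<le> norm (s - 1)"
    using compact_norm_diff_ge[OF C(1), of 1] C(2) by blast
  \<comment> \<open>The cap at 0 ensures rho <= 3, so that the power 3 - rho of |tau| is
    nonnegative.\<close>
  define \<sigma> where "\<sigma> = min \<sigma>' 0"
  have \<sigma>: "\<sigma> > - 1" "\<sigma> \<le> 0" and C\<sigma>: "\<And>s. s \<in> C \<Longrightarrow> Re s \<ge> \<sigma>"
    using \<sigma>' C' by (auto simp: \<sigma>_def min_def) (smt (verit) C')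
  define \<rho> where "\<rho> = (3 + \<sigma>) / 2"
  have \<rho>: "\<rho> > 1" "\<rho> \<le> 3" using \<sigma> by (auto simp: \<rho>_def)
  define K where "K = exp (pi * \<bar>B\<bar>) * \<kappa> powr (\<sigma> - \<bar>B\<bar>) * (2 powr (\<bar>B\<bar> + 1) * (2 / d + \<bar>B\<bar>)) * \<kappa> powr (- (3 + \<sigma>))"
  have K: "K \<ge> 0" using d by (simp add: K_def)
  define M where "M = (\<lambda>p::nat \<times> nat. K * (case p of (m, n) \<Rightarrow> (1 + real m) powr (- \<rho>) * (1 + real n) powr (- \<rho>)))"
  have "M summable_on UNIV"
    unfolding M_def using \<rho> by (intro summable_on_cmult_right summable_on_Suc_powr_prod)
  moreover have "norm (midpoint_defect s \<tau> (lattice_point \<tau> (m, n))) \<le> M (m, n)"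
    if \<tau>: "\<tau> \<in> sector \<alpha> \<beta> \<inter> ball 0 \<kappa>" and s: "s \<in> C" for s \<tau> m n
  proof -
    define c where "c = lattice_point \<tau> (m, n)"
    define X where "X = exp (pi * \<bar>B\<bar>) * \<kappa> powr (\<sigma> - \<bar>B\<bar>) * (2 powr (\<bar>B\<bar> + 1) * (2 / d + \<bar>B\<bar>))"
    have \<tau>0: "\<tau> \<noteq> 0" and \<tau>\<kappa>: "norm \<tau> < \<kappa>" using \<tau> sector_nonzero by auto
    have lower: "\<kappa> * (1 + real m + real n * norm \<tau>) \<le> norm c"
      unfolding c_def using \<tau> lattice_point_lower by blast
    have "\<kappa> * 1 \<le> \<kappa> * (1 + real m + real n * norm \<tau>)"
      using \<kappa> by (intro mult_left_mono) auto
    then have c\<kappa>: "norm c \<ge> \<kappa>" using lower by linarith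
    have c0: "norm c > 0" using c\<kappa> \<kappa> by linarith
    have "norm (c powr (- s)) \<le> norm c powr Re (- s) * exp (pi * \<bar>Im (- s)\<bar>)"
      by (rule norm_powr_le)
    also have "\<dots> \<le> (\<kappa> powr (\<sigma> - \<bar>B\<bar>) * norm c powr (- \<sigma>)) * exp (pi * \<bar>B\<bar>)"
    proof (intro mult_mono)
      \<comment> \<open>Monotonicity in the exponent needs a base of at least 1, and only norm c >=
        kappa is known; hence the division by kappa.\<close>
      have "norm c powr Re (- s) = (\<kappa> * (norm c / \<kappa>)) powr (- Re s)" using \<kappa> by simp
      also have "\<dots> = \<kappa> powr (- Re s) * (norm c / \<kappa>) powr (- Re s)"
        using \<kappa> by (intro powr_mult)
      also have "\<dots> \<le> \<kappa> powr (- \<bar>B\<bar>) * (norm c / \<kappa>) powr (- \<sigma>)"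
        using \<kappa> \<kappa>_le c\<kappa> C\<sigma>[OF s] CB[OF s] complex_Re_le_cmod[of s]
        by (intro mult_mono powr_mono powr_mono') (auto simp: le_divide_eq)
      also have "\<dots> = \<kappa> powr (\<sigma> - \<bar>B\<bar>) * norm c powr (- \<sigma>)"
        using \<kappa> c0 by (simp add: powr_divide powr_diff powr_minus field_simps)
      finally show "norm c powr Re (- s) \<le> \<kappa> powr (\<sigma> - \<bar>B\<bar>) * norm c powr (- \<sigma>)" .
      show "exp (pi * \<bar>Im (- s)\<bar>) \<le> exp (pi * \<bar>B\<bar>)"
        using CB[OF s] abs_Im_le_cmod[of s] by auto
    qed auto
    finally have cs: "norm (c powr (- s)) \<le> exp (pi * \<bar>B\<bar>) * \<kappa> powr (\<sigma> - \<bar>B\<bar>) * norm c powr (- \<sigma>)"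
      by (simp add: mult_ac)
    have "norm (midpoint_defect s \<tau> c) \<le> norm (c powr (- s)) * (2 powr (\<bar>B\<bar> + 1) * (2 / d + \<bar>B\<bar>) * (norm \<tau> / norm c) ^ 3)"
      unfolding c_def using \<tau> \<tau>0 d s CB[OF s] c\<kappa> \<tau>\<kappa>
      by (intro midpoint_defect_bound[OF \<phi>] lattice_point_in_half_plane) (auto simp: c_def)
    also have "\<dots> \<le> (exp (pi * \<bar>B\<bar>) * \<kappa> powr (\<sigma> - \<bar>B\<bar>) * norm c powr (- \<sigma>)) * (2 powr (\<bar>B\<bar> + 1) * (2 / d + \<bar>B\<bar>) * (norm \<tau> / norm c) ^ 3)"
      using cs d by (intro mult_right_mono) auto
    also have "\<dots> = X * (norm \<tau> ^ 3 * (norm c powr (- \<sigma>) / norm c ^ 3))"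
      by (simp add: power_divide X_def)
    also have "norm c powr (- \<sigma>) / norm c ^ 3 = norm c powr (- (3 + \<sigma>))"
    proof -
      have "- (3 + \<sigma>) = - \<sigma> - 3" by simp
      then show ?thesis using c0 by (simp only: powr_diff) simp
    qed
    also have "X * (norm \<tau> ^ 3 * norm c powr (- (3 + \<sigma>))) \<le>
        X * (\<kappa> powr (- (3 + \<sigma>)) * ((1 + real m) powr (- \<rho>) * (1 + real n) powr (- \<rho>)))"
    proof (rule mult_left_mono)
      have "norm c powr (- (3 + \<sigma>)) \<le> (\<kappa> * (1 + real m + real n * norm \<tau>)) powr (- (3 + \<sigma>))"
        using lower \<kappa> \<sigma> by (intro powr_mono2') (auto intro!: mult_pos_pos add_pos_nonneg)
      also have "\<dots> = \<kappa> powr (- (3 + \<sigma>)) * (1 + real m + real n * norm \<tau>) powr (- (3 + \<sigma>))"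
        using \<kappa> by (intro powr_mult)
      also have "\<dots> \<le> \<kappa> powr (- (3 + \<sigma>)) * ((1 + real m) powr (- \<rho>) * (1 + real n * norm \<tau>) powr (- \<rho>))"
        unfolding \<rho>_def using \<sigma> by (intro mult_left_mono powr_minus_le_prod) auto
      also have "\<dots> \<le> \<kappa> powr (- (3 + \<sigma>)) * ((1 + real m) powr (- \<rho>) * (norm \<tau> * (1 + real n)) powr (- \<rho>))"
      proof (intro mult_left_mono powr_mono2')
        have "norm \<tau> * (1 + real n) = norm \<tau> + real n * norm \<tau>" by (simp add: algebra_simps)
        also have "\<dots> \<le> 1 + real n * norm \<tau>" using \<tau>\<kappa> \<kappa>_le by simp
        finally show "norm \<tau> * (1 + real n) \<le> 1 + real n * norm \<tau>" .
      qed (use \<rho> \<tau>0 in auto)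
      also have "\<dots> = norm \<tau> powr (- \<rho>) * (\<kappa> powr (- (3 + \<sigma>)) * ((1 + real m) powr (- \<rho>) * (1 + real n) powr (- \<rho>)))"
        by (simp add: powr_mult)
      finally have "norm \<tau> ^ 3 * norm c powr (- (3 + \<sigma>)) \<le>
          norm \<tau> ^ 3 * (norm \<tau> powr (- \<rho>) * (\<kappa> powr (- (3 + \<sigma>)) * ((1 + real m) powr (- \<rho>) * (1 + real n) powr (- \<rho>))))"
        by (intro mult_left_mono) auto
      also have "\<dots> = norm \<tau> powr (3 - \<rho>) * (\<kappa> powr (- (3 + \<sigma>)) * ((1 + real m) powr (- \<rho>) * (1 + real n) powr (- \<rho>)))"
        using \<tau>0 by (simp add: powr_diff powr_minus field_simps)
      also have "\<dots> \<le> 1 * (\<kappa> powr (- (3 + \<sigma>)) * ((1 + real m) powr (- \<rho>) * (1 + real n) powr (- \<rho>)))"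
        using \<rho> \<tau>\<kappa> \<kappa>_le by (intro mult_right_mono powr_le1) auto
      finally show "norm \<tau> ^ 3 * norm c powr (- (3 + \<sigma>)) \<le>
          \<kappa> powr (- (3 + \<sigma>)) * ((1 + real m) powr (- \<rho>) * (1 + real n) powr (- \<rho>))" by simp
      show "X \<ge> 0" using d by (simp add: X_def)
    qed
    also have "\<dots> = M (m, n)"
      by (simp add: M_def K_def X_def)
    finally show ?thesis unfolding c_def .
  qed
  then have "\<forall>\<tau>\<in>sector \<alpha> \<beta> \<inter> ball 0 \<kappa>. \<forall>s\<in>C. \<forall>p. norm (midpoint_defect s \<tau> (lattice_point \<tau> p)) \<le> M p"
    by auto
  ultimately show ?thesis by blast
qed

end

section \<open>Expansion of the double zeta function and its derivative at 0\<close>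

context lattice_cone
begin

lemma open_strip_1: "open ({s. Re s > - 1} - {1 :: complex})"
  using open_Re_gt by (intro open_Diff) auto

lemma defect_dominated_at:
  assumes "\<tau> \<in> sector \<alpha> \<beta> \<inter> ball 0 \<kappa>" "compact C" "C \<subseteq> {s. Re s > - 1} - {1}"
  shows "\<exists>M J. finite J \<and> M summable_on UNIV \<and>
    (\<forall>p\<in>UNIV - J. \<forall>s\<in>C. norm (midpoint_defect s \<tau> (lattice_point \<tau> p)) \<le> M p)"
proof -
  obtain M where "M summable_on UNIV" "\<forall>\<tau>\<in>sector \<alpha> \<beta> \<inter> ball 0 \<kappa>. \<forall>s\<in>C. \<forall>p. norm (midpoint_defect s \<tau> (lattice_point \<tau> p)) \<le> M p"
    using defect_uniformly_dominated[OF assms(2,3)] by blast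
  with assms(1) show ?thesis by (intro exI[of _ M] exI[of _ "{}"]) auto
qed

lemma holomorphic_defect:
  assumes "\<tau> \<in> sector \<alpha> \<beta>"
  shows "(\<lambda>s. midpoint_defect s \<tau> (lattice_point \<tau> p)) holomorphic_on {s. Re s > - 1} - {1}"
  using sector_nonzero[OF assms] by (intro holomorphic_on_midpoint_defect) auto

lemma holomorphic_defect_sum:
  assumes "\<tau> \<in> sector \<alpha> \<beta> \<inter> ball 0 \<kappa>"
  shows "defect_sum \<tau> holomorphic_on {s. Re s > - 1} - {1}"
  unfolding defect_sum_def[abs_def]
  by (rule holomorphic_on_infsum[OF open_strip_1 holomorphic_defect defect_dominated_at[OF assms]])
     (use assms in auto)

lemma has_sum_defect_sum:
  assumes "\<tau> \<in> sector \<alpha> \<beta> \<inter> ball 0 \<kappa>" "s \<in> {s. Re s > - 1} - {1}"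
  shows "((\<lambda>p. midpoint_defect s \<tau> (lattice_point \<tau> p)) has_sum defect_sum \<tau> s) UNIV"
  unfolding defect_sum_def
  by (rule has_sum_infsum, rule summable_on_dominated[OF open_strip_1 holomorphic_defect defect_dominated_at[OF assms(1)] assms(2)])
     (use assms in auto)

lemma midpoint_sum_tendsto_0:
  assumes \<tau>: "\<tau> \<in> sector \<alpha> \<beta>" and s: "Re s > 1"
  shows "(\<lambda>n. midpoint_sum s \<tau> (x + of_nat m + of_real (real n) * \<tau>)) \<longlonglongrightarrow> 0"
proof -
  have \<tau>0: "norm \<tau> > 0" using sector_nonzero[OF \<tau>] by simp
  have "filterlim (\<lambda>n. real n * (\<kappa> * norm \<tau>)) at_top sequentially"
    using \<kappa> \<tau>0 by (intro filterlim_at_top_mult_tendsto_pos[OF tendsto_const]) (auto intro: filterlim_real_sequentially)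
  then have lim: "filterlim (\<lambda>n. norm (x + of_nat m + of_real (real n) * \<tau>)) at_top sequentially"
  proof (rule filterlim_at_top_mono, intro always_eventually allI)
    fix n :: nat
    have "real n * (\<kappa> * norm \<tau>) \<le> \<kappa> * (1 + real m + real n * norm \<tau>)"
      using \<kappa> by (simp add: algebra_simps)
    also have "\<dots> \<le> norm (x + of_nat m + of_real (real n) * \<tau>)"
      using cone_lower[OF \<tau>, of "real n" m] by simp
    finally show "real n * (\<kappa> * norm \<tau>) \<le> norm (x + of_nat m + of_real (real n) * \<tau>)" .
  qed
  have "(\<lambda>n. midpoint_sum s \<tau> (x + of_nat m + of_real (real n) * \<tau>)) \<longlonglongrightarrow> 0 / (\<tau> * (s - 1)) - \<tau> * s / 24 * 0"
    unfolding midpoint_sum_def using s \<tau>0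
    by (intro tendsto_intros powr_tendsto_0_at_infinity[OF lim]) auto
  then show ?thesis by simp
qed

text \<open>For Re s > 2 all sums may be rearranged. In row m the differences of
  \<open>midpoint_sum\<close> telescope over n to the value at x + m, and summing over m produces
  the two Hurwitz functions.\<close>

lemma double_zeta_expansion:
  assumes \<tau>: "\<tau> \<in> sector \<alpha> \<beta> \<inter> ball 0 \<kappa>" and s: "Re s > 2"
  shows "double_zeta (x + \<tau> / 2) 1 \<tau> s =
    hurwitz s / (\<tau> * (s - 1)) - \<tau> / 24 * hurwitz_shift s + defect_sum \<tau> s"
proof -
  define c where "c = lattice_point \<tau>"
  define f where "f = (\<lambda>m n::nat. midpoint_sum s \<tau> (x + of_nat m + of_real (real n) * \<tau>))"
  define g where "g = (\<lambda>(m::nat, n). f m n - f m (Suc n))"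
  have \<tau>': "\<tau> \<in> sector \<alpha> \<beta>" and \<tau>0: "\<tau> \<noteq> 0" using \<tau> sector_nonzero by auto
  have s': "s \<in> {s. Re s > - 1} - {1}" using s by auto
  have "(\<lambda>(m::nat, n::nat). (x + \<tau> / 2 + of_nat m + of_nat n * \<tau>) powr (- s)) = (\<lambda>p. c p powr (- s))"
    by (auto simp: c_def lattice_point_def fun_eq_iff algebra_simps)
  with double_zeta_continuation(2)[OF sector_Re_pos[OF \<tau>'] s, of "x + \<tau> / 2"]
  have "((\<lambda>p. c p powr (- s)) has_sum double_zeta (x + \<tau> / 2) 1 \<tau> s) UNIV" by simp
  from has_sum_add[OF this has_sum_uminusI[OF has_sum_defect_sum[OF \<tau> s']]]
  have "((\<lambda>p. c p powr (- s) + - midpoint_defect s \<tau> (c p)) has_sum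
      (double_zeta (x + \<tau> / 2) 1 \<tau> s + - defect_sum \<tau> s)) UNIV"
    by (simp add: c_def)
  also have "(\<lambda>p. c p powr (- s) + - midpoint_defect s \<tau> (c p)) = g"
    by (auto simp: fun_eq_iff g_def f_def c_def midpoint_defect_def lattice_point_shift)
  finally have g: "(g has_sum (double_zeta (x + \<tau> / 2) 1 \<tau> s - defect_sum \<tau> s)) (UNIV \<times> UNIV)"
    by simp
  have row: "((\<lambda>n. g (m, n)) has_sum midpoint_sum s \<tau> (x + of_nat m)) UNIV" for m
  proof -
    have "g summable_on range (Pair m)"
      by (rule summable_on_subset_banach[OF has_sum_imp_summable[OF g]]) auto
    then have summ: "(\<lambda>n. f m n - f m (Suc n)) summable_on UNIV"
      by (subst (asm) summable_on_reindex) (auto simp: inj_on_def o_def g_def)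
    moreover have "f m \<longlonglongrightarrow> 0"
      unfolding f_def using s by (intro midpoint_sum_tendsto_0 \<tau>') auto
    ultimately have "(\<Sum>\<^sub>\<infinity>n. f m n - f m (Suc n)) = f m 0"
      by (intro infsum_telescope)
    with has_sum_infsum[OF summ] show ?thesis by (simp add: g_def f_def)
  qed
  have "((\<lambda>m. midpoint_sum s \<tau> (x + of_nat m)) has_sum (double_zeta (x + \<tau> / 2) 1 \<tau> s - defect_sum \<tau> s)) UNIV"
    by (rule has_sum_SigmaD[OF g]) (rule row)
  moreover have "((\<lambda>m. midpoint_sum s \<tau> (x + of_nat m)) has_sum
      (1 / (\<tau> * (s - 1)) * hurwitz s + - (\<tau> / 24) * hurwitz_shift s)) UNIV"
  proof -
    have "((\<lambda>m::nat. 1 / (\<tau> * (s - 1)) * (x + of_nat m) powr (1 - s) + - (\<tau> / 24) * (s * (x + of_nat m) powr (- 1 - s)))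
       has_sum (1 / (\<tau> * (s - 1)) * hurwitz s + - (\<tau> / 24) * hurwitz_shift s)) UNIV"
      using s by (intro has_sum_add has_sum_cmult_right has_sum_hurwitz has_sum_hurwitz_shift) auto
    moreover have "midpoint_sum s \<tau> p = 1 / (\<tau> * (s - 1)) * p powr (1 - s) + - (\<tau> / 24) * (s * p powr (- 1 - s))" for p
      by (simp add: midpoint_sum_def)
    ultimately show ?thesis by (simp only:)
  qed
  ultimately have "double_zeta (x + \<tau> / 2) 1 \<tau> s - defect_sum \<tau> s =
      1 / (\<tau> * (s - 1)) * hurwitz s + - (\<tau> / 24) * hurwitz_shift s"
    by (rule has_sum_unique)
  then show ?thesis by (simp add: algebra_simps)
qed

text \<open>Unique continuation carries the expansion to s = 0 around the singular points 1 and 2 of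
  its explicit terms. Since 1 / (s - 1) has value and derivative -1 at 0, both
  \<open>hurwitz 0\<close> and \<open>deriv hurwitz 0\<close> enter with the factor -1 /
  tau.\<close>

lemma deriv_double_zeta:
  assumes \<tau>: "\<tau> \<in> sector \<alpha> \<beta> \<inter> ball 0 \<kappa>"
  shows "deriv (double_zeta (x + \<tau> / 2) 1 \<tau>) 0 =
    - (deriv hurwitz 0 + hurwitz 0) / \<tau> - \<tau> / 24 * deriv hurwitz_shift 0 + deriv (defect_sum \<tau>) 0"
proof -
  let ?A = "{s. Re s > - 1} - {1, 2 :: complex}"
  let ?h = "\<lambda>s. hurwitz s / (\<tau> * (s - 1)) - \<tau> / 24 * hurwitz_shift s + defect_sum \<tau> s"
  have \<tau>0: "\<tau> \<noteq> 0" and \<tau>': "\<tau> \<in> sector \<alpha> \<beta>" using \<tau> sector_nonzero by auto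
  have A: "open ?A" "connected ?A"
    using open_Re_gt[of "- 1"] connected_Re_gt[of "- 1"]
    by (auto intro!: open_Diff connected_open_delete_finite)
  have hol: "?h holomorphic_on ?A"
    using \<tau>0
    by (intro holomorphic_intros holomorphic_on_subset[OF hurwitz_holomorphic]
         holomorphic_on_subset[OF hurwitz_shift_holomorphic] holomorphic_on_subset[OF holomorphic_defect_sum[OF \<tau>]]) auto
  have eq: "double_zeta (x + \<tau> / 2) 1 \<tau> w = ?h w" if "w \<in> ?A" for w
  proof (rule nicely_meromorphic_on_eq[of _ ?A ?h "{s. Re s > 2}" w])
    show "double_zeta (x + \<tau> / 2) 1 \<tau> nicely_meromorphic_on ?A"
      using double_zeta_continuation(1)[OF sector_Re_pos[OF \<tau>']] by (rule nicely_meromorphic_on_subset) auto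
    show "?h nicely_meromorphic_on ?A"
      using hol A by (intro analytic_on_imp_nicely_meromorphic_on) (auto simp: analytic_on_open)
    show "{s. Re s > 2} \<noteq> {}" by (auto intro!: exI[of _ 3])
    show "open {s. Re s > 2}" by (rule open_Re_gt)
    show "double_zeta (x + \<tau> / 2) 1 \<tau> v = ?h v" if "v \<in> {s. Re s > 2}" for v
      using that double_zeta_expansion[OF \<tau>] by simp
  qed (use that A in auto)
  have d1: "(hurwitz has_field_derivative deriv hurwitz 0) (at 0)"
    by (rule holomorphic_derivI[OF hurwitz_holomorphic open_strip]) simp
  have d2: "(hurwitz_shift has_field_derivative deriv hurwitz_shift 0) (at 0)"
    by (rule holomorphic_derivI[OF hurwitz_shift_holomorphic open_Re_gt]) simp
  have d3: "(defect_sum \<tau> has_field_derivative deriv (defect_sum \<tau>) 0) (at 0)"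
    by (rule holomorphic_derivI[OF holomorphic_defect_sum[OF \<tau>] open_strip_1]) simp
  have "(?h has_field_derivative (deriv hurwitz 0 * (\<tau> * (0 - 1)) - hurwitz 0 * \<tau>) / ((\<tau> * (0 - 1)) * (\<tau> * (0 - 1)))
      - \<tau> / 24 * deriv hurwitz_shift 0 + deriv (defect_sum \<tau>) 0) (at 0)"
    using \<tau>0 by (auto intro!: derivative_eq_intros d1 d2 d3)
  then have "(double_zeta (x + \<tau> / 2) 1 \<tau> has_field_derivative (deriv hurwitz 0 * (\<tau> * (0 - 1)) - hurwitz 0 * \<tau>) / ((\<tau> * (0 - 1)) * (\<tau> * (0 - 1)))
      - \<tau> / 24 * deriv hurwitz_shift 0 + deriv (defect_sum \<tau>) 0) (at 0)"
    by (rule has_field_derivative_transform_within_open[OF _ A(1)]) (use eq in auto)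
  then have "deriv (double_zeta (x + \<tau> / 2) 1 \<tau>) 0 =
      (deriv hurwitz 0 * (\<tau> * (0 - 1)) - hurwitz 0 * \<tau>) / ((\<tau> * (0 - 1)) * (\<tau> * (0 - 1)))
      - \<tau> / 24 * deriv hurwitz_shift 0 + deriv (defect_sum \<tau>) 0"
    by (rule DERIV_imp_deriv)
  also have "(deriv hurwitz 0 * (\<tau> * (0 - 1)) - hurwitz 0 * \<tau>) / ((\<tau> * (0 - 1)) * (\<tau> * (0 - 1))) = - (deriv hurwitz 0 + hurwitz 0) / \<tau>"
    using \<tau>0 by (simp add: field_simps)
  finally show ?thesis .
qed

text \<open>Cauchy's inequality on |s| = 1/2, which stays away from s = 1 and Re s = -1, turns the
  majorant \<open>M\<close> of the defects into 2 M for their derivatives. The same M-test yields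
  the bound and, through uniform convergence in tau, the continuity.\<close>

lemma
  shows bounded_deriv_defect_sum:
      "\<exists>K. \<forall>\<tau>\<in>sector \<alpha> \<beta> \<inter> ball 0 \<kappa>. norm (deriv (defect_sum \<tau>) 0) \<le> K"
    and continuous_on_deriv_defect_sum:
      "continuous_on (sector \<alpha> \<beta> \<inter> ball 0 \<kappa>) (\<lambda>\<tau>. deriv (defect_sum \<tau>) 0)"
proof -
  let ?T = "sector \<alpha> \<beta> \<inter> ball 0 \<kappa>"
  define g where "g = (\<lambda>p \<tau>. deriv (\<lambda>s. midpoint_defect s \<tau> (lattice_point \<tau> p)) 0)"
  have sub: "cball 0 (1 / 2) \<subseteq> {s. Re s > - 1} - {1 :: complex}"
  proof
    fix s :: complex assume "s \<in> cball 0 (1 / 2)"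
    then have "norm s \<le> 1 / 2" by simp
    then show "s \<in> {s. Re s > - 1} - {1}" using abs_Re_le_cmod[of s] by auto
  qed
  obtain M where M: "M summable_on UNIV"
    "\<And>\<tau> s p. \<tau> \<in> ?T \<Longrightarrow> s \<in> cball 0 (1 / 2) \<Longrightarrow> norm (midpoint_defect s \<tau> (lattice_point \<tau> p)) \<le> M p"
    using defect_uniformly_dominated[OF compact_cball sub] by blast
  have bound: "norm (g p \<tau>) \<le> 2 * M p" if \<tau>: "\<tau> \<in> ?T" for p \<tau>
  proof -
    have hol: "(\<lambda>s. midpoint_defect s \<tau> (lattice_point \<tau> p)) holomorphic_on cball 0 (1 / 2)"
      using holomorphic_defect \<tau> sub by (meson IntD1 holomorphic_on_subset)
    have "norm ((deriv ^^ 1) (\<lambda>s. midpoint_defect s \<tau> (lattice_point \<tau> p)) 0) \<le> fact 1 * M p / (1 / 2) ^ 1"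
    proof (rule Cauchy_inequality)
      show "(\<lambda>s. midpoint_defect s \<tau> (lattice_point \<tau> p)) holomorphic_on ball 0 (1 / 2)"
        using hol ball_subset_cball by (rule holomorphic_on_subset)
      show "continuous_on (cball 0 (1 / 2)) (\<lambda>s. midpoint_defect s \<tau> (lattice_point \<tau> p))"
        using hol by (rule holomorphic_on_imp_continuous_on)
      show "norm (midpoint_defect s \<tau> (lattice_point \<tau> p)) \<le> M p" if "norm (0 - s) = 1 / 2" for s
        using M(2)[OF \<tau>, of s p] that by simp
    qed auto
    then show ?thesis by (simp add: g_def)
  qed
  have sum: "((\<lambda>p. g p \<tau>) has_sum deriv (defect_sum \<tau>) 0) UNIV" if \<tau>: "\<tau> \<in> ?T" for \<tau>
    unfolding g_def defect_sum_def[abs_def]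
    by (rule deriv_infsum_has_sum[OF open_strip_1 holomorphic_defect defect_dominated_at[OF \<tau>]])
       (use \<tau> in auto)
  have M2: "(\<lambda>p. 2 * M p) summable_on UNIV"
    using M(1) by (rule summable_on_cmult_right)
  have "norm (deriv (defect_sum \<tau>) 0) \<le> (\<Sum>\<^sub>\<infinity>p. 2 * M p)" if "\<tau> \<in> ?T" for \<tau>
    by (rule norm_infsum_le[OF sum[OF that] has_sum_infsum[OF M2] bound[OF that]])
  then show "\<exists>K. \<forall>\<tau>\<in>?T. norm (deriv (defect_sum \<tau>) 0) \<le> K" by blast
  \<comment> \<open>The explicit derivative exhibits the dependence on tau through
    \<open>Ln\<close>, which is continuous on the common half-plane.\<close>
  have g_eq: "g p \<tau> = - Ln (lattice_point \<tau> p) -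
      (midpoint_sum_deriv \<tau> (lattice_point \<tau> p - \<tau> / 2) - midpoint_sum_deriv \<tau> (lattice_point \<tau> p + \<tau> / 2))"
    if \<tau>: "\<tau> \<in> ?T" for p \<tau>
  proof -
    let ?c = "lattice_point \<tau> p"
    have nz: "?c \<noteq> 0" "?c - \<tau> / 2 \<noteq> 0" "?c + \<tau> / 2 \<noteq> 0" "\<tau> \<noteq> 0"
      using lattice_point_in_half_plane[of \<tau> p] half_plane_nonzero \<tau> sector_nonzero by blast+
    have "((\<lambda>s. midpoint_defect s \<tau> ?c) has_field_derivative - (Ln ?c * ?c powr (0 - 0)) -
        (midpoint_sum_deriv \<tau> (?c - \<tau> / 2) - midpoint_sum_deriv \<tau> (?c + \<tau> / 2))) (at 0)"
      unfolding midpoint_defect_def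
      using nz has_field_derivative_powr_diff[OF nz(1), of 0 0]
      by (intro DERIV_diff has_field_derivative_midpoint_sum) auto
    then show ?thesis unfolding g_def using nz by (auto dest!: DERIV_imp_deriv)
  qed
  have cont: "continuous_on ?T (g p)" for p
  proof -
    obtain m n where p: "p = (m, n)" by (cases p)
    have c: "continuous_on ?T (\<lambda>\<tau>. lattice_point \<tau> p)"
      unfolding p lattice_point_def by (auto intro!: continuous_intros)
    have Ln: "continuous_on ?T (\<lambda>\<tau>. Ln (h \<tau>))"
      if "continuous_on ?T h" "\<And>\<tau>. \<tau> \<in> ?T \<Longrightarrow> h \<tau> \<in> half_plane \<phi>" for h
      by (rule continuous_on_compose2[OF continuous_on_Ln_half_plane[OF \<phi>] that(1)]) (use that(2) in auto)
    have h: "lattice_point \<tau> p \<in> half_plane \<phi>" "lattice_point \<tau> p - \<tau> / 2 \<in> half_plane \<phi>"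
      "lattice_point \<tau> p + \<tau> / 2 \<in> half_plane \<phi>" if "\<tau> \<in> ?T" for \<tau>
      using lattice_point_in_half_plane[of \<tau> p] that by auto
    define q1 q2 where "q1 = (\<lambda>\<tau>. lattice_point \<tau> p - \<tau> / 2)" and "q2 = (\<lambda>\<tau>. lattice_point \<tau> p + \<tau> / 2)"
    have q: "q1 \<tau> \<noteq> 0" "q2 \<tau> \<noteq> 0" "\<tau> \<noteq> 0" if "\<tau> \<in> ?T" for \<tau>
      using h[OF that] half_plane_nonzero sector_nonzero that unfolding q1_def q2_def by blast+
    have qc: "continuous_on ?T q1" "continuous_on ?T q2"
      unfolding q1_def q2_def by (intro continuous_intros c; simp)+
    have qh: "q1 \<tau> \<in> half_plane \<phi>" "q2 \<tau> \<in> half_plane \<phi>" if "\<tau> \<in> ?T" for \<tau>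
      using h[OF that] by (simp_all add: q1_def q2_def)
    have "continuous_on ?T (\<lambda>\<tau>. - Ln (lattice_point \<tau> p) -
      (((q1 \<tau> * Ln (q1 \<tau>) - q1 \<tau>) / \<tau> - \<tau> / (24 * q1 \<tau>)) - ((q2 \<tau> * Ln (q2 \<tau>) - q2 \<tau>) / \<tau> - \<tau> / (24 * q2 \<tau>))))"
      by (intro continuous_on_diff continuous_on_minus continuous_on_divide continuous_on_mult continuous_on_const
           continuous_on_id qc Ln[OF c h(1)] Ln[OF qc(1) qh(1)] Ln[OF qc(2) qh(2)] ballI) (use q in auto)
    then have "continuous_on ?T (\<lambda>\<tau>. - Ln (lattice_point \<tau> p) -
      (midpoint_sum_deriv \<tau> (lattice_point \<tau> p - \<tau> / 2) - midpoint_sum_deriv \<tau> (lattice_point \<tau> p + \<tau> / 2)))"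
      unfolding midpoint_sum_deriv_def q1_def q2_def .
    then show ?thesis
      by (rule continuous_on_cong[THEN iffD1, rotated 2]) (use g_eq in auto)
  qed
  have "uniform_limit ?T (\<lambda>X \<tau>. \<Sum>p\<in>X. g p \<tau>) (\<lambda>\<tau>. deriv (defect_sum \<tau>) 0) (finite_subsets_at_top UNIV)"
    using bound sum M2 by (intro Weierstrass_m_test_general') auto
  then show "continuous_on ?T (\<lambda>\<tau>. deriv (defect_sum \<tau>) 0)"
  proof (rule uniform_limit_theorem[rotated])
    show "\<forall>\<^sub>F X in finite_subsets_at_top UNIV. continuous_on ?T (\<lambda>\<tau>. \<Sum>p\<in>X. g p \<tau>)"
      by (intro always_eventually allI continuous_intros cont)
  qed auto
qed

end

section \<open>Branches of the logarithm and the limit\<close>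

text \<open>The set is the image of a rectangle under polar coordinates. The origin is taken out
  because \<open>Arg 0 = 0\<close> would place it in any sector with alpha < 0 < beta.\<close>

lemma connected_sector_ball:
  assumes "- pi \<le> \<alpha>" "\<beta> \<le> pi"
  shows "connected (sector \<alpha> \<beta> \<inter> ball 0 \<delta> - {0})"
proof -
  have "sector \<alpha> \<beta> \<inter> ball 0 \<delta> - {0} = (\<lambda>(r, \<theta>). rcis r \<theta>) ` ({0<..<\<delta>} \<times> {\<alpha><..<\<beta>})"
  proof (intro equalityI subsetI)
    fix \<tau> assume "\<tau> \<in> sector \<alpha> \<beta> \<inter> ball 0 \<delta> - {0}"
    then show "\<tau> \<in> (\<lambda>(r, \<theta>). rcis r \<theta>) ` ({0<..<\<delta>} \<times> {\<alpha><..<\<beta>})"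
      by (intro image_eqI[of _ _ "(norm \<tau>, Arg \<tau>)"]) (auto simp: rcis_cmod_Arg sector_def)
  next
    fix \<tau> assume "\<tau> \<in> (\<lambda>(r, \<theta>). rcis r \<theta>) ` ({0<..<\<delta>} \<times> {\<alpha><..<\<beta>})"
    then obtain r \<theta> where r: "0 < r" "r < \<delta>" "\<alpha> < \<theta>" "\<theta> < \<beta>" and \<tau>: "\<tau> = rcis r \<theta>" by auto
    have "Arg \<tau> = \<theta>"
      unfolding \<tau> using r assms by (intro Arg_rcis) auto
    then show "\<tau> \<in> sector \<alpha> \<beta> \<inter> ball 0 \<delta> - {0}"
      using r by (auto simp: sector_def \<tau> rcis_def norm_mult)
  qed
  also have "connected \<dots>"
    by (intro connected_continuous_image connected_Times)
       (auto intro!: continuous_intros simp: case_prod_unfold rcis_def)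
  finally show ?thesis .
qed

text \<open>The difference of two branches takes values in 2 pi i times the integers, and distinct
  values are at least 2 pi apart, so on a connected set it is constant.\<close>

lemma log_branch_unique:
  assumes T: "connected T" and L: "log_branch_on T f L1" "log_branch_on T f L2"
  shows "\<exists>k. \<forall>\<tau>\<in>T. L1 \<tau> = L2 \<tau> + k"
proof -
  have "continuous_on T (\<lambda>\<tau>. L1 \<tau> - L2 \<tau>)"
    using L by (auto simp: log_branch_on_def intro!: continuous_intros)
  moreover have "\<exists>e>0. \<forall>y. y \<in> T \<and> L1 y - L2 y \<noteq> L1 \<tau> - L2 \<tau> \<longrightarrow> e \<le> norm (L1 y - L2 y - (L1 \<tau> - L2 \<tau>))"
    if \<tau>: "\<tau> \<in> T" for \<tau>
  proof (intro exI[of _ "2 * pi"] conjI allI impI)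
    fix y assume y: "y \<in> T \<and> L1 y - L2 y \<noteq> L1 \<tau> - L2 \<tau>"
    have "exp (L1 v - L2 v) = 1" if "v \<in> T" for v
      using L that by (simp add: log_branch_on_def exp_diff) (metis exp_not_eq_zero)
    with y \<tau> have "exp (L1 y - L2 y) = exp (L1 \<tau> - L2 \<tau>)" by simp
    then obtain n :: int where n: "L1 y - L2 y = L1 \<tau> - L2 \<tau> + of_int (2 * n) * pi * \<i>"
      by (auto simp: exp_eq)
    with y have "n \<noteq> 0" by auto
    then have "1 \<le> \<bar>real_of_int n\<bar>" by linarith
    then show "2 * pi \<le> norm (L1 y - L2 y - (L1 \<tau> - L2 \<tau>))"
      using n by (simp add: norm_mult abs_mult)
  qed simp
  ultimately have "(\<lambda>\<tau>. L1 \<tau> - L2 \<tau>) constant_on T"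
    by (rule continuous_discrete_range_constant[OF T])
  then obtain k where "\<And>\<tau>. \<tau> \<in> T \<Longrightarrow> L1 \<tau> - L2 \<tau> = k"
    by (auto simp: constant_on_def)
  then have "\<forall>\<tau>\<in>T. L1 \<tau> = L2 \<tau> + k" by (auto simp: algebra_simps)
  then show ?thesis by blast
qed

text \<open>Any other branch differs near 0 by a constant k, and tau k tends to 0; so the limit
  along one branch is the limit along all.\<close>

lemma has_scaled_log_limitI:
  assumes S: "\<And>\<delta>. connected (S \<inter> ball 0 \<delta>)" and \<delta>: "\<delta> > 0"
    and L: "log_branch_on (S \<inter> ball 0 \<delta>) f L"
    and lim: "((\<lambda>\<tau>. 2 * of_real pi * \<i> * \<tau> * L \<tau>) \<longlongrightarrow> h) (at 0 within S)"
  shows "has_scaled_log_limit S f h"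
  unfolding has_scaled_log_limit_def
proof (intro conjI allI impI)
  show "\<exists>\<delta>>0. \<exists>L. log_branch_on (S \<inter> ball 0 \<delta>) f L" using \<delta> L by blast
  fix \<delta>' L' assume \<delta>': "\<delta>' > (0 :: real)" and L': "log_branch_on (S \<inter> ball 0 \<delta>') f L'"
  define T where "T = S \<inter> ball 0 (min \<delta> \<delta>')"
  have T: "connected T" unfolding T_def by (rule S)
  have sub: "T \<subseteq> S \<inter> ball 0 \<delta>" "T \<subseteq> S \<inter> ball 0 \<delta>'" by (auto simp: T_def)
  have "log_branch_on T f L" "log_branch_on T f L'"
    using L L' sub unfolding log_branch_on_def by (blast intro: continuous_on_subset)+
  from log_branch_unique[OF T this(2,1)] obtain k where k: "\<And>\<tau>. \<tau> \<in> T \<Longrightarrow> L' \<tau> = L \<tau> + k"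
    by blast
  have "((\<lambda>\<tau>. 2 * of_real pi * \<i> * \<tau> * L \<tau> + 2 * of_real pi * \<i> * \<tau> * k) \<longlongrightarrow> h + 2 * of_real pi * \<i> * 0 * k) (at 0 within S)"
    by (intro tendsto_intros lim)
  then have lim': "((\<lambda>\<tau>. 2 * of_real pi * \<i> * \<tau> * L \<tau> + 2 * of_real pi * \<i> * \<tau> * k) \<longlongrightarrow> h) (at 0 within S)"
    by simp
  have "\<forall>\<^sub>F \<tau> in at 0 within S. \<tau> \<in> T"
    unfolding eventually_at using \<delta> \<delta>' by (intro exI[of _ "min \<delta> \<delta>'"]) (auto simp: T_def)
  then have "\<forall>\<^sub>F \<tau> in at 0 within S. 2 * of_real pi * \<i> * \<tau> * L \<tau> + 2 * of_real pi * \<i> * \<tau> * k = 2 * of_real pi * \<i> * \<tau> * L' \<tau>"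
    by eventually_elim (simp add: k algebra_simps)
  from Lim_transform_eventually[OF lim' this]
  show "((\<lambda>\<tau>. (2 * of_real pi * \<i> * \<tau>) * L' \<tau>) \<longlongrightarrow> h) (at 0 within S)" .
qed

section \<open>The logarithm of F and its scaled limit\<close>

context lattice_cone
begin

text \<open>A logarithm of F at eta = x - w + tau / 2 whose Gamma part is the zeta derivative itself
  and hence free of branch jumps. The literal factors 1 stand for the first period, so that
  \<open>exp_add\<close> alone matches it with \<open>F\<close>.\<close>

definition ln_F :: "complex \<Rightarrow> complex \<Rightarrow> complex" where
  "ln_F w \<tau> = deriv (double_zeta (x + \<tau> / 2) 1 \<tau>) 0 + 1 / 2 * B22 (x + \<tau> / 2) 1 \<tau> * Ln w +
     (- (3 * w\<^sup>2) / (4 * 1 * \<tau>) - (x - w + \<tau> / 2) * w / (1 * \<tau>) + w * (1 + \<tau>) / (2 * 1 * \<tau>))"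

lemma exp_ln_F:
  assumes \<tau>: "\<tau> \<in> sector \<alpha> \<beta> \<inter> ball 0 \<kappa>"
  shows "exp (ln_F w \<tau>) = F w (x - w + \<tau> / 2) 1 \<tau>"
proof -
  have "x + \<tau> / 2 + of_nat m * 1 + of_nat n * \<tau> = lattice_point \<tau> (m, n)" for m n
    by (simp add: lattice_point_def algebra_simps)
  then have "x + \<tau> / 2 + of_nat m * 1 + of_nat n * \<tau> \<noteq> 0" for m n
    using lattice_point_in_half_plane(1)[of \<tau>] half_plane_nonzero \<tau> by (metis IntD1)
  then have "Gamma2 (x + \<tau> / 2) 1 \<tau> = exp (deriv (double_zeta (x + \<tau> / 2) 1 \<tau>) 0)"
    unfolding Gamma2_def by simp
  moreover have "w + (x - w + \<tau> / 2) = x + \<tau> / 2" by simp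
  ultimately show ?thesis
    unfolding F_def ln_F_def by (simp only: exp_add)
qed

lemma continuous_on_ln_F: "continuous_on (sector \<alpha> \<beta> \<inter> ball 0 \<kappa>) (ln_F w)"
proof -
  have nz: "0 \<notin> sector \<alpha> \<beta>"
    using sector_nonzero by blast
  have "continuous_on (sector \<alpha> \<beta> \<inter> ball 0 \<kappa>) (\<lambda>\<tau>.
      (- (deriv hurwitz 0 + hurwitz 0) / \<tau> - \<tau> / 24 * deriv hurwitz_shift 0 + deriv (defect_sum \<tau>) 0)
      + 1 / 2 * B22 (x + \<tau> / 2) 1 \<tau> * Ln w +
     (- (3 * w\<^sup>2) / (4 * 1 * \<tau>) - (x - w + \<tau> / 2) * w / (1 * \<tau>) + w * (1 + \<tau>) / (2 * 1 * \<tau>)))"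
    unfolding B22_def using nz
    by (auto intro!: continuous_intros continuous_on_deriv_defect_sum)
  then show ?thesis
    by (rule continuous_on_cong[THEN iffD1, rotated 2]) (auto simp: ln_F_def deriv_double_zeta)
qed

text \<open>Multiplication by tau leaves the coefficients of 1 / tau and sends the bounded defect
  term to 0. With eta = x - w, the value \<open>- hurwitz 0\<close> and the limit of the last
  exponential factor combine to -w^2 / 4 + eta^2 / 2 - eta / 2 + 1 / 12, while tau times
  \<open>B22\<close> tends to x^2 - x + 1/6.\<close>

lemma tendsto_mult_ln_F:
  "((\<lambda>\<tau>. \<tau> * ln_F w \<tau>) \<longlongrightarrow> ln_Delta w (x - w)) (at 0 within sector \<alpha> \<beta>)"
proof -
  let ?G = "at 0 within sector \<alpha> \<beta>"
  obtain K where K: "\<And>\<tau>. \<tau> \<in> sector \<alpha> \<beta> \<inter> ball 0 \<kappa> \<Longrightarrow> norm (deriv (defect_sum \<tau>) 0) \<le> K"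
    using bounded_deriv_defect_sum by blast
  have ev: "\<forall>\<^sub>F \<tau> in ?G. \<tau> \<in> sector \<alpha> \<beta> \<inter> ball 0 \<kappa>"
    unfolding eventually_at using \<kappa> by (intro exI[of _ \<kappa>]) auto
  have E: "((\<lambda>\<tau>. \<tau> * deriv (defect_sum \<tau>) 0) \<longlongrightarrow> 0) ?G"
  proof (rule Lim_null_comparison)
    show "\<forall>\<^sub>F \<tau> in ?G. norm (\<tau> * deriv (defect_sum \<tau>) 0) \<le> norm \<tau> * K"
      using ev by eventually_elim (auto simp: norm_mult intro!: mult_left_mono K)
    have "((\<lambda>\<tau>. norm \<tau> * K) \<longlongrightarrow> norm (0 :: complex) * K) ?G" by (intro tendsto_intros)
    then show "((\<lambda>\<tau>. norm \<tau> * K) \<longlongrightarrow> 0) ?G" by simp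
  qed
  have "((\<lambda>\<tau>. - (deriv hurwitz 0 + hurwitz 0) - \<tau>\<^sup>2 / 24 * deriv hurwitz_shift 0 + \<tau> * deriv (defect_sum \<tau>) 0
      + 1 / 2 * ((x + \<tau> / 2)\<^sup>2 - (\<tau> + 1) * (x + \<tau> / 2) + 1 / 6 * (\<tau>\<^sup>2 + 1) + \<tau> / 2) * Ln w +
     (- (3 * w\<^sup>2) / 4 - (x - w + \<tau> / 2) * w + w * (1 + \<tau>) / 2)) \<longlongrightarrow>
     - (deriv hurwitz 0 + hurwitz 0) - 0\<^sup>2 / 24 * deriv hurwitz_shift 0 + 0
      + 1 / 2 * ((x + 0 / 2)\<^sup>2 - (0 + 1) * (x + 0 / 2) + 1 / 6 * (0\<^sup>2 + 1) + 0 / 2) * Ln w +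
     (- (3 * w\<^sup>2) / 4 - (x - w + 0 / 2) * w + w * (1 + 0) / 2)) ?G"
    by (intro tendsto_intros E) auto
  also have "- (deriv hurwitz 0 + hurwitz 0) - 0\<^sup>2 / 24 * deriv hurwitz_shift 0 + 0
      + 1 / 2 * ((x + 0 / 2)\<^sup>2 - (0 + 1) * (x + 0 / 2) + 1 / 6 * (0\<^sup>2 + 1) + 0 / 2) * Ln w +
     (- (3 * w\<^sup>2) / 4 - (x - w + 0 / 2) * w + w * (1 + 0) / 2) = ln_Delta w (x - w)"
  proof -
    have H: "deriv hurwitz 0 = deriv riemann_zeta (- 1) + x * ln_Gamma x - ln_Barnes_G (x + 1)"
      using deriv_hurwitz_eq_Barnes deriv_riemann_zeta_eq_hurwitz by (simp add: algebra_simps)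
    have "w + (x - w) = x" by simp
    then show ?thesis
      unfolding ln_Delta_def hurwitz_0 H by (simp add: field_simps power2_eq_square)
  qed
  finally show ?thesis
  proof (rule Lim_transform_eventually)
    show "\<forall>\<^sub>F \<tau> in ?G. - (deriv hurwitz 0 + hurwitz 0) - \<tau>\<^sup>2 / 24 * deriv hurwitz_shift 0 + \<tau> * deriv (defect_sum \<tau>) 0
      + 1 / 2 * ((x + \<tau> / 2)\<^sup>2 - (\<tau> + 1) * (x + \<tau> / 2) + 1 / 6 * (\<tau>\<^sup>2 + 1) + \<tau> / 2) * Ln w +
     (- (3 * w\<^sup>2) / 4 - (x - w + \<tau> / 2) * w + w * (1 + \<tau>) / 2) = \<tau> * ln_F w \<tau>"
      using ev
    proof eventually_elim
      case (elim \<tau>)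
      then have \<tau>0: "\<tau> \<noteq> 0" using sector_nonzero by blast
      have "\<tau> * (- (deriv hurwitz 0 + hurwitz 0) / \<tau> - \<tau> / 24 * deriv hurwitz_shift 0 + deriv (defect_sum \<tau>) 0)
          = - (deriv hurwitz 0 + hurwitz 0) - \<tau>\<^sup>2 / 24 * deriv hurwitz_shift 0 + \<tau> * deriv (defect_sum \<tau>) 0"
        using \<tau>0 by (simp add: field_simps power2_eq_square)
      moreover have "\<tau> * (1 / 2 * B22 (x + \<tau> / 2) 1 \<tau> * Ln w) =
          1 / 2 * ((x + \<tau> / 2)\<^sup>2 - (\<tau> + 1) * (x + \<tau> / 2) + 1 / 6 * (\<tau>\<^sup>2 + 1) + \<tau> / 2) * Ln w"
        unfolding B22_def using \<tau>0 by (simp add: field_simps power2_eq_square)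
      moreover have "\<tau> * (- (3 * w\<^sup>2) / (4 * 1 * \<tau>) - (x - w + \<tau> / 2) * w / (1 * \<tau>) + w * (1 + \<tau>) / (2 * 1 * \<tau>)) =
          - (3 * w\<^sup>2) / 4 - (x - w + \<tau> / 2) * w + w * (1 + \<tau>) / 2"
        using \<tau>0 by (simp add: field_simps)
      ultimately show ?case
        unfolding ln_F_def deriv_double_zeta[OF elim] distrib_left by (simp only:)
    qed
  qed
qed

end

theorem lemma4p1:
  fixes z t \<theta> \<sigma> w \<eta> :: complex and \<alpha> \<beta> :: real
  assumes "\<sigma> = 1 \<or> \<sigma> = -1"
    and "z \<noteq> 0" and "t \<noteq> 0" and "t \<notin> (\<lambda>u. \<i> * u) ` ell \<sigma> z"
    and "w = \<sigma> * z / (2 * of_real pi * \<i> * t)" and "\<eta> = 1 / 2 - \<sigma> * \<theta>"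
    and "w + \<eta> \<notin> \<int>\<^sub>\<le>\<^sub>0"
    and "0 \<le> \<alpha>" and "\<alpha> < \<beta>" and "\<beta> \<le> pi / 2"
    and "\<beta> - pi < Arg (w + \<eta>)" and "Arg (w + \<eta>) < pi + \<alpha>"
  shows "exp (ln_Delta w \<eta>) = Delta w \<eta> \<and>
    has_scaled_log_limit (sector \<alpha> \<beta>) (psi \<sigma> z t \<theta>) (- (2 * of_real pi * \<i>) * ln_Delta w \<eta>)"
proof
  define x where "x = w + \<eta>"
  have ab: "0 \<le> \<alpha>" "\<alpha> < \<beta>" "\<beta> \<le> pi / 2" by fact+
  have x: "x \<notin> \<int>\<^sub>\<le>\<^sub>0" "\<beta> - pi < Arg x" "Arg x < pi + \<alpha>"
    using assms(7,11,12) by (simp_all add: x_def)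
  have "\<sigma> \<noteq> 0" using assms(1) by auto
  then have "w \<noteq> 0" using assms(2,3,5) by simp
  then show "exp (ln_Delta w \<eta>) = Delta w \<eta>"
    using assms(7) by (rule exp_ln_Delta)
  obtain \<kappa>0 where \<kappa>0: "\<kappa>0 > 0" "\<And>\<tau> v (m::nat). \<tau> \<in> sector \<alpha> \<beta> \<Longrightarrow> v \<ge> 0 \<Longrightarrow>
      norm (x + of_nat m + of_real v * \<tau>) \<ge> \<kappa>0 * (1 + real m + v * norm \<tau>)"
    using cone_lower_bound[OF x(1) ab x(2,3)] by blast
  obtain \<phi> where \<phi>: "- pi / 2 < \<phi>" "\<phi> \<le> pi / 2"
    and half: "\<And>\<tau> v (m::nat). \<tau> \<in> sector \<alpha> \<beta> \<Longrightarrow> v \<ge> 0 \<Longrightarrow> x + of_nat m + of_real v * \<tau> \<in> half_plane \<phi>"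
    using cone_half_plane[OF x(1) ab x(2,3)] by blast
  define \<kappa> where "\<kappa> = min \<kappa>0 1"
  have \<kappa>: "\<kappa> > 0" "\<kappa> \<le> 1" using \<kappa>0(1) by (auto simp: \<kappa>_def)
  have lower: "norm (x + of_nat m + of_real v * \<tau>) \<ge> \<kappa> * (1 + real m + v * norm \<tau>)"
    if "\<tau> \<in> sector \<alpha> \<beta>" "v \<ge> 0" for \<tau> v and m :: nat
  proof -
    have "\<kappa> * (1 + real m + v * norm \<tau>) \<le> \<kappa>0 * (1 + real m + v * norm \<tau>)"
      using that by (intro mult_right_mono) (auto simp: \<kappa>_def)
    then show ?thesis using \<kappa>0(2)[OF that, of m] by linarith
  qed
  \<comment> \<open>The bisecting direction shows that the sector is not empty; the cone estimates
    for it at v = 0 are the conditions on x + m alone that \<open>hurwitz_sequence\<close> asks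
    for.\<close>
  have "Arg (cis ((\<alpha> + \<beta>) / 2)) = (\<alpha> + \<beta>) / 2"
    using ab pi_gt_zero by (intro Arg_cis) auto
  then have \<tau>0: "cis ((\<alpha> + \<beta>) / 2) \<in> sector \<alpha> \<beta>"
    using ab by (simp add: sector_def)
  interpret lattice_cone x \<phi> \<kappa> \<alpha> \<beta>
  proof
    show "x + of_nat m \<in> half_plane \<phi>" for m :: nat
      using half[OF \<tau>0, of 0 m] by simp
    show "\<kappa> * (1 + real m) \<le> norm (x + of_nat m)" for m :: nat
      using lower[OF \<tau>0, of 0 m] by simp
  qed (fact \<phi> \<kappa> half lower ab)+
  have zero: "0 \<notin> sector \<alpha> \<beta>" using sector_nonzero by blast
  show "has_scaled_log_limit (sector \<alpha> \<beta>) (psi \<sigma> z t \<theta>) (- (2 * of_real pi * \<i>) * ln_Delta w \<eta>)"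
  proof (rule has_scaled_log_limitI)
    show "connected (sector \<alpha> \<beta> \<inter> ball 0 \<delta>)" for \<delta>
      using connected_sector_ball[of \<alpha> \<beta> \<delta>] ab pi_gt_zero zero by (simp add: Diff_triv)
    have "exp (- ln_F w \<tau>) = psi \<sigma> z t \<theta> \<tau>" if "\<tau> \<in> sector \<alpha> \<beta> \<inter> ball 0 \<kappa>" for \<tau>
    proof -
      have "x - w + \<tau> / 2 = (1 + \<tau>) / 2 - \<sigma> * \<theta>"
        by (simp add: x_def assms(6) add_divide_distrib)
      then show ?thesis
        using exp_ln_F[OF that, of w] by (simp add: psi_def exp_minus assms(5))
    qed
    then show "log_branch_on (sector \<alpha> \<beta> \<inter> ball 0 \<kappa>) (psi \<sigma> z t \<theta>) (\<lambda>\<tau>. - ln_F w \<tau>)"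
      unfolding log_branch_on_def using continuous_on_ln_F by (auto intro!: continuous_intros)
    have "((\<lambda>\<tau>. - (2 * of_real pi * \<i>) * (\<tau> * ln_F w \<tau>)) \<longlongrightarrow> - (2 * of_real pi * \<i>) * ln_Delta w (x - w)) (at 0 within sector \<alpha> \<beta>)"
      by (intro tendsto_intros tendsto_mult_ln_F)
    then show "((\<lambda>\<tau>. 2 * of_real pi * \<i> * \<tau> * - ln_F w \<tau>) \<longlongrightarrow> - (2 * of_real pi * \<i>) * ln_Delta w \<eta>) (at 0 within sector \<alpha> \<beta>)"
      by (simp add: x_def mult.assoc)
  qed (fact \<kappa>(1))
qed

end
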